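(* Let $f_1,\dots,f_m$ and $g$ be measurable functions. Suppose that for some exponents $1\le p_1,\dots,p_m<\infty$ with $\frac1p=\sum_{i=1}^m\frac1{p_i}$ and for all $\vec w=(w_1,\dots,w_m)\in A_{\vec p}^{\mathcal R}$ we have $$\|g\|_{L^{p,\infty}\left(\prod_{i=1}^m w_i^{p/p_i}\right)}\lesssim\prod_{i=1}^m\|f_i\|_{L^{p_i,1}(w_i)}.$$ Then for all $\vec v=(v_1,\dots,v_m)\in A_{\vec{\frac1m}}$, $$\|g\|_{L^{1/m,\infty}\left(\prod_{i=1}^m v_i^{1/m}\right)}\lesssim\prod_{i=1}^m\|f_i\|_{L^{1,1/p_i}(v_i)}.$$
   Context: Functions and weights are defined on $\mathbb R^n$. A weight is an a.e. positive measurable function $w$, identified with the measure $w\,dx$, and $w(E)=\int_E w$. Suprema $\sup_Q$ are over all cubes $Q$ in $\mathbb R^n$, and $p'$ denotes the conjugate exponent of $p$. The notation $A\lesssim B$ means $A\le CB$ for some constant $C$; the statement does not specify the constants any further. Lorentz quasi-norms: for $0<p<\infty$ and $0<\alpha<\infty$, $\|f\|_{L^{p,\alpha}(w)}=\big(p\int_0^\infty s^{\alpha-1}\,w(\{|f|>s\})^{\alpha/p}\,ds\big)^{1/\alpha}$ (other usual normalizations differ by a constant factor), and $\|f\|_{L^{p,\infty}(w)}=\sup_{t>0}t\,w(\{|f|>t\})^{1/p}$. For $1\le p_i<\infty$, $\frac1p=\sum_{i=1}^m\frac1{p_i}$ and $\vec p=(p_1,\dots,p_m)$, a vector of weights $\vec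 w=(w_1,\dots,w_m)$ belongs to $A_{\vec p}^{\mathcal R}$ if $$\sup_Q\Big(\frac1{|Q|}\int_Q\prod_{i=1}^m w_i^{\frac p{p_i}}\Big)^{1/p}\prod_{i=1}^m\big\|\chi_Q w_i^{-1}\big\|_{L^{p_i',\infty}\left(\frac{w_i}{|Q|}\right)}<\infty,$$ where $L^{p_i',\infty}(w_i/|Q|)$ is taken with respect to the measure $w_i\,dx/|Q|$, and for $p_i=1$ the corresponding factor is $\operatorname{ess\,sup}_Q w_i^{-1}$. The class $A_{\vec{\frac1m}}$ is the one corresponding to $p_1=\dots=p_m=1$ (so $p=1/m$): $\vec v\in A_{\vec{\frac1m}}$ if $$\sup_Q\Big(\frac1{|Q|}\int_Q\prod_{i=1}^m v_i^{1/m}\Big)^{m}\prod_{i=1}^m\operatorname{ess\,sup}_Q v_i^{-1}<\infty.$$ *)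

theory Defs
  imports "HOL-Analysis.Analysis" "HOL-Probability.Essential_Supremum"
begin

text \<open>Powers of extended nonnegative reals; used for exponents \<open>a > 0\<close> only.\<close>

definition ennpow :: "ennreal \<Rightarrow> real \<Rightarrow> ennreal" where
  "ennpow x a = (if x = \<infinity> then \<infinity> else ennreal (enn2real x powr a))"

definition cubes :: "(real ^ 'n) set set" where
  "cubes = {cbox a (\<chi> i. a $ i + l) | a l. 0 < l}"

definition weight :: "(real ^ 'n \<Rightarrow> real) \<Rightarrow> bool" where
  "weight w \<longleftrightarrow> w \<in> borel_measurable lebesgue \<and> (AE x in lebesgue. 0 < w x)"

definition weighted :: "(real ^ 'n \<Rightarrow> real) \<Rightarrow> (real ^ 'n) measure" where
  "weighted w = density lebesgue (\<lambda>x. ennreal (w x))"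

definition lorentz_norm ::
    "'a measure \<Rightarrow> real \<Rightarrow> real \<Rightarrow> ('a \<Rightarrow> 'b::real_normed_vector) \<Rightarrow> ennreal" where
  "lorentz_norm M p \<alpha> f =
     ennpow (ennreal p *
       (\<integral>\<^sup>+ s\<in>{0<..}. ennreal (s powr (\<alpha> - 1)) *
          ennpow (emeasure M {x \<in> space M. norm (f x) > s}) (\<alpha> / p) \<partial>lborel)) (1 / \<alpha>)"

definition weak_norm ::
    "'a measure \<Rightarrow> real \<Rightarrow> ('a \<Rightarrow> 'b::real_normed_vector) \<Rightarrow> ennreal" where
  "weak_norm M p f =
     (SUP t\<in>{0<..}. ennreal t * ennpow (emeasure M {x \<in> space M. norm (f x) > t}) (1 / p))"

text \<open>The norm of \<open>\<chi>\<^sub>Q w\<^sup>-\<^sup>1\<close> in \<open>L\<^sup>q\<^sup>'\<^sup>,\<^sup>\<infinity>(w dx / |Q|)\<close>, where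
  \<open>q' = q / (q - 1)\<close>; for \<open>q = 1\<close> the essential supremum of \<open>w\<^sup>-\<^sup>1\<close> over \<open>Q\<close>.\<close>

definition dual_factor :: "real \<Rightarrow> (real ^ 'n \<Rightarrow> real) \<Rightarrow> (real ^ 'n) set \<Rightarrow> ennreal" where
  "dual_factor q w Q =
     (if q = 1 then esssup (restrict_space lebesgue Q) (\<lambda>x. ennreal (inverse (w x)))
      else weak_norm (weighted (\<lambda>x. w x / measure lebesgue Q)) (q / (q - 1))
             (\<lambda>x. indicator Q x * inverse (w x)))"

definition harmonic_exponent :: "nat \<Rightarrow> (nat \<Rightarrow> real) \<Rightarrow> real" where
  "harmonic_exponent m ps = 1 / (\<Sum>i\<in>{1..m}. 1 / ps i)"

text \<open>Vectors are functions on \<open>nat\<close> of which only the entries with index in \<open>{1..m}\<close> matter.\<close>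

definition A_R_const :: "nat \<Rightarrow> (nat \<Rightarrow> real) \<Rightarrow> (nat \<Rightarrow> real ^ 'n \<Rightarrow> real) \<Rightarrow> ennreal" where
  "A_R_const m ps w = (let p = harmonic_exponent m ps in
     (SUP Q\<in>cubes.
        ennpow ((\<integral>\<^sup>+ x\<in>Q. ennreal (\<Prod>i\<in>{1..m}. w i x powr (p / ps i)) \<partial>lebesgue)
                  / emeasure lebesgue Q) (1 / p)
        * (\<Prod>i\<in>{1..m}. dual_factor (ps i) (w i) Q)))"

definition A_R :: "nat \<Rightarrow> (nat \<Rightarrow> real) \<Rightarrow> (nat \<Rightarrow> real ^ 'n \<Rightarrow> real) \<Rightarrow> bool" where
  "A_R m ps w \<longleftrightarrow> (\<forall>i\<in>{1..m}. weight (w i)) \<and> A_R_const m ps w < \<infinity>"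

definition A_endpoint :: "nat \<Rightarrow> (nat \<Rightarrow> real ^ 'n \<Rightarrow> real) \<Rightarrow> bool" where
  "A_endpoint m v \<longleftrightarrow> A_R m (\<lambda>_. 1) v"

lemma A_endpoint_iff:
  "A_endpoint m v \<longleftrightarrow> (\<forall>i\<in>{1..m}. weight (v i)) \<and>
     (SUP Q\<in>cubes.
        ennpow ((\<integral>\<^sup>+ x\<in>Q. ennreal (\<Prod>i\<in>{1..m}. v i x powr (1 / real m)) \<partial>lebesgue)
                  / emeasure lebesgue Q) (real m)
        * (\<Prod>i\<in>{1..m}. esssup (restrict_space lebesgue Q) (\<lambda>x. ennreal (inverse (v i x))))) < \<infinity>"
  by (simp add: A_endpoint_def A_R_def A_R_const_def dual_factor_def harmonic_exponent_def)

text \<open>The constants hidden in \<open>A \<lesssim> B\<close> may depend on the weights but not on the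
  functions. The theorem therefore speaks of an arbitrary family \<open>F\<close> of tuples
  \<open>(f, g)\<close> with one constant for all of its members; a single tuple is the case of a
  one-element family.\<close>

end

theory Submission
  imports Defs
begin

text \<open>
  Write \<open>\<nu> = \<Prod>\<^sub>i v\<^sub>i\<^bsup>1/m\<^esup>\<close>; for \<open>v \<in> A\<^sub>1\<^sub>/\<^sub>m\<close> it is an \<open>A\<^sub>1\<close> weight. Given \<open>H \<in> L\<^sup>1(dx)\<close>, let \<open>N\<close> be the maximum of \<open>H/\<nu>\<close>
  and the maximal function \<open>sup\<^sub>B (\<integral>\<^sub>B H) / \<nu>(B)\<close>, and put \<open>w\<^sub>i = v\<^sub>i\<^bsup>p\<^sub>i\<^esup> (\<nu>N)\<^bsup>1-p\<^sub>i\<^esup>\<close>.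
  Then \<open>\<Prod>\<^sub>i w\<^sub>i\<^bsup>p/p\<^sub>i\<^esup> = \<nu> N\<^bsup>1-mp\<^esup>\<close>, while \<open>w\<^sub>i \<le> v\<^sub>i s\<^bsup>1-p\<^sub>i\<^esup>\<close> wherever \<open>v\<^sub>i s \<le> H\<close>. The membership
  \<open>w \<in> A\<^sub>p\<^sup>R\<close> reduces to a localised Sawyer type inequality
  \<open>t |{x \<in> Q. \<nu>N > t}| \<le> C \<nu>(Q) inf\<^sub>Q N\<close>, which follows from the reverse Hoelder inequality for \<open>\<nu>\<close> by
  grouping the balls \<open>B\<close> containing \<open>x\<close> according to the size of \<open>\<nu>(x) |B| / \<nu>(B)\<close>.

  The constant in the hypothesis depends on the weight only, hence a gliding hump argument gives uniformity
  over the family: if the conclusion failed for \<open>v\<close>, choose tuples violating it with constants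
  \<open>(k+1) 2\<^sup>k\<^sup>m\<close> and let \<open>H\<close> be the sum of \<open>2\<^sup>-\<^sup>k v\<^sub>i |f\<^sub>i| / \<parallel>f\<^sub>i\<parallel>\<close> over all of them. The single weight
  vector \<open>w\<close> built from this \<open>H\<close> contradicts the hypothesis.
\<close>

section \<open>Covering arguments\<close>

text \<open>The shape of \<open>w\<close> is dictated by the two sides it has to serve. The
  \<open>w_i\<close>-measure of \<open>{|f_i| > s}\<close> must be at most \<open>s^(1-p_i)\<close>
  times its \<open>v_i\<close>-measure, because this turns the integrand of the
  \<open>L^(p_i,1)(w_i)\<close> norm into that of the \<open>L^(1,1/p_i)(v_i)\<close> norm. On a
  cube, \<open>1 / w_i > t\<close> must become a lower bound for \<open>\<nu> N\<close>; only weak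
  type information on \<open>\<nu> N\<close> is available, and the weak norms in the definition of
  the class ask for no more. The obstacle is the product \<open>\<nu> N\<close>: a weak bound for
  \<open>N\<close> alone says nothing about it, since \<open>\<nu>\<close> may exceed its average on
  a ball by any factor. Points where it does so by \<open>T^i\<close> cost a factor
  \<open>T^i\<close>, but reverse Hoelder leaves them only a share of order
  \<open>2^(-i) T^(-i)\<close> of the ball, and the costs become summable. On a cube
  \<open>N\<close> is known only through its infimum. The product weight and the dual factors
  contain opposite powers of it, which cancel because \<open>1/p\<close> is the sum of the
  \<open>1/p_i\<close>. The hypothesis does not say how its constant depends on \<open>w\<close>. A
  separate weight for each tuple would therefore yield unrelated constants, and only
  \<open>\<integral>H < \<infinity>\<close> limits how many tuples one \<open>H\<close> can
  serve.\<close>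

lemma sets_lebesgue_open: "open S \<Longrightarrow> S \<in> sets lebesgue"
  by (intro sets_completionI_sets) simp

lemma sets_lebesgue_less:
  fixes f g :: "'a::euclidean_space \<Rightarrow> ennreal"
  assumes [measurable]: "f \<in> borel_measurable lebesgue" "g \<in> borel_measurable lebesgue"
  shows "{x. f x < g x} \<in> sets lebesgue"
proof -
  have "{x \<in> space lebesgue. f x < g x} \<in> sets lebesgue" by measurable
  then show ?thesis by simp
qed

text \<open>Vitali selections are countable index sets rather than sequences, hence the sum as an
  integral over \<open>count_space\<close>.\<close>

lemma emeasure_UN_countable_le:
  assumes [measurable]: "\<And>i. i \<in> I \<Longrightarrow> X i \<in> sets M" and "countable I"
  shows "emeasure M (\<Union>i\<in>I. X i) \<le> (\<integral>\<^sup>+i. emeasure M (X i) \<partial>count_space I)"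
proof -
  have [measurable]: "(\<Union>i\<in>I. X i) \<in> sets M"
    using assms by (intro sets.countable_UN') auto
  have "emeasure M (\<Union>i\<in>I. X i) = (\<integral>\<^sup>+x. indicator (\<Union>i\<in>I. X i) x \<partial>M)"
    by simp
  also have "\<dots> \<le> (\<integral>\<^sup>+x. (\<integral>\<^sup>+i. indicator (X i) x \<partial>count_space I) \<partial>M)"
  proof (intro nn_integral_mono)
    fix x
    show "indicator (\<Union>i\<in>I. X i) x \<le> (\<integral>\<^sup>+i. indicator (X i) x \<partial>count_space I :: ennreal)"
    proof (cases "x \<in> (\<Union>i\<in>I. X i)")
      case True
      then obtain i where "i \<in> I" "x \<in> X i" by blast
      then have "1 = (\<integral>\<^sup>+j. indicator {i} j \<partial>count_space I :: ennreal)"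
        by (subst nn_integral_indicator) (auto simp: emeasure_count_space)
      also have "\<dots> \<le> (\<integral>\<^sup>+i. indicator (X i) x \<partial>count_space I)"
        using \<open>x \<in> X i\<close> by (intro nn_integral_mono) (auto simp: indicator_def)
      finally show ?thesis using True by simp
    qed simp
  qed
  also have "\<dots> = (\<integral>\<^sup>+i. (\<integral>\<^sup>+x. indicator (X i) x \<partial>M) \<partial>count_space I)"
    using \<open>countable I\<close> by (intro nn_integral_count_space_nn_integral) auto
  also have "\<dots> = (\<integral>\<^sup>+i. emeasure M (X i) \<partial>count_space I)"
    by (intro nn_integral_cong) auto
  finally show ?thesis .
qed

text \<open>The common core of three covering arguments. Vitali selects disjoint balls whose
  fivefold dilates swallow all the others; \<open>cover\<close> asks for a ball attached to
  \<open>x\<close> such that \<open>x\<close> lies in \<open>S j\<close> whenever the dilate of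
  \<open>j\<close> swallows that ball. The mixed estimate needs \<open>S j\<close> to be smaller
  than the dilate. The set \<open>Y\<close> appears because \<open>X\<close> is not known to be
  measurable.\<close>

lemma vitali_emeasure_bound:
  fixes c :: "'i \<Rightarrow> 'a::euclidean_space" and \<rho> :: "'i \<Rightarrow> real"
  assumes sM: "sets M = sets lebesgue" and sN: "sets N = sets lebesgue"
    and r: "\<And>i. i \<in> K \<Longrightarrow> 0 < \<rho> i \<and> \<rho> i \<le> B"
    and S: "\<And>i. i \<in> K \<Longrightarrow> S i \<in> sets lebesgue"
    and bound: "\<And>i. i \<in> K \<Longrightarrow> emeasure M (S i) \<le> C * emeasure N (ball (c i) (\<rho> i))"
    and cover: "\<And>x. x \<in> X \<Longrightarrow>
      \<exists>i\<in>K. \<forall>j\<in>K. ball (c i) (\<rho> i) \<subseteq> ball (c j) (5 * \<rho> j) \<longrightarrow> x \<in> S j"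
  shows "\<exists>Y\<in>sets lebesgue. X \<subseteq> Y \<and> emeasure M Y \<le> C * emeasure N (\<Union>i\<in>K. ball (c i) (\<rho> i))"
proof -
  obtain D where D: "countable D" "D \<subseteq> K"
    and pw: "pairwise (\<lambda>i j. disjnt (cball (c i) (\<rho> i)) (cball (c j) (\<rho> j))) D"
    and cov: "\<And>i. i \<in> K \<Longrightarrow> \<exists>j. j \<in> D \<and> \<not> disjnt (cball (c i) (\<rho> i)) (cball (c j) (\<rho> j)) \<and>
                        cball (c i) (\<rho> i) \<subseteq> ball (c j) (5 * \<rho> j)"
    by (rule Vitali_covering_lemma_cballs_balls[OF r, where a = c]) (blast intro: that)+
  define Y where "Y = (\<Union>i\<in>D. S i)"
  have DS: "\<And>i. i \<in> D \<Longrightarrow> S i \<in> sets M"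
    using D S sM by auto
  have "X \<subseteq> Y"
  proof
    fix x assume "x \<in> X"
    then obtain i where i: "i \<in> K" "\<forall>j\<in>K. ball (c i) (\<rho> i) \<subseteq> ball (c j) (5 * \<rho> j) \<longrightarrow> x \<in> S j"
      using cover by blast
    with cov[of i] obtain j where "j \<in> D" "cball (c i) (\<rho> i) \<subseteq> ball (c j) (5 * \<rho> j)"
      by blast
    with i D show "x \<in> Y"
      unfolding Y_def using subset_trans[OF ball_subset_cball] by (metis UN_I subsetD)
  qed
  moreover have "Y \<in> sets lebesgue"
    unfolding Y_def using D S by (intro sets.countable_UN') auto
  moreover have "emeasure M Y \<le> C * emeasure N (\<Union>i\<in>K. ball (c i) (\<rho> i))"
  proof -
    have dj: "disjoint_family_on (\<lambda>i. ball (c i) (\<rho> i)) D"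
      using pw unfolding disjoint_family_on_def pairwise_def disjnt_def
      by (intro ballI impI) (meson ball_subset_cball disjnt_def disjnt_subset1 disjnt_subset2)
    have "emeasure M Y \<le> (\<integral>\<^sup>+i. emeasure M (S i) \<partial>count_space D)"
      unfolding Y_def by (rule emeasure_UN_countable_le) (use D DS in auto)
    also have "\<dots> \<le> (\<integral>\<^sup>+i. C * emeasure N (ball (c i) (\<rho> i)) \<partial>count_space D)"
      using D bound by (intro nn_integral_mono) auto
    also have "\<dots> = C * (\<integral>\<^sup>+i. emeasure N (ball (c i) (\<rho> i)) \<partial>count_space D)"
      by (rule nn_integral_cmult) auto
    also have "(\<integral>\<^sup>+i. emeasure N (ball (c i) (\<rho> i)) \<partial>count_space D)
        = emeasure N (\<Union>i\<in>D. ball (c i) (\<rho> i))"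
      using D dj sN by (subst emeasure_UN_countable) auto
    also have "\<dots> \<le> emeasure N (\<Union>i\<in>K. ball (c i) (\<rho> i))"
    proof (rule emeasure_mono)
      have "open (\<Union>i\<in>K. ball (c i) (\<rho> i))" by auto
      then show "(\<Union>i\<in>K. ball (c i) (\<rho> i)) \<in> sets N"
        unfolding sN by (intro sets_completionI_sets) simp
    qed (use D in auto)
    finally show ?thesis
      by (simp add: mult_left_mono)
  qed
  ultimately show ?thesis by blast
qed

text \<open>Takes the place of a differentiation theorem. Small disjoint balls centred in
  \<open>E\<close> fill \<open>E\<close> up to a null set and stay inside an open \<open>V\<close>
  that exceeds \<open>E\<close> by little; the hypothesis is then summed over these balls.\<close>

lemma emeasure_le_of_small_balls:
  fixes f :: "'a::euclidean_space \<Rightarrow> ennreal"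
  assumes f[measurable]: "f \<in> borel_measurable lebesgue"
    and E[measurable]: "E \<in> sets lebesgue" and E_fin: "emeasure lebesgue E < \<infinity>" and "0 \<le> s"
    and small: "\<And>x r. x \<in> E \<Longrightarrow> 0 < r \<Longrightarrow>
      emeasure (density lebesgue f) (ball x r) \<le> ennreal s * emeasure lebesgue (ball x r)"
  shows "emeasure (density lebesgue f) E \<le> ennreal s * emeasure lebesgue E"
proof -
  let ?F = "density lebesgue f"
  have *: "emeasure ?F E \<le> ennreal s * (emeasure lebesgue E + ennreal e)" if "0 < e" for e
  proof -
    obtain V where V: "open V" "E \<subseteq> V" "V - E \<in> lmeasurable" "emeasure lebesgue (V - E) < ennreal e"
      using sets_lebesgue_outer_open[OF E \<open>0 < e\<close>] by blast
    have [measurable]: "V \<in> sets lebesgue" 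
      using V by (simp add: borel_open)
    define K where "K = {(x, r). x \<in> E \<and> 0 < r \<and> ball x r \<subseteq> V}"
    obtain D where D: "countable D" "D \<subseteq> K"
      and pw: "pairwise (\<lambda>i j. disjnt (ball (fst i) (snd i)) (ball (fst j) (snd j))) D"
      and neg: "negligible (E - (\<Union>i\<in>D. ball (fst i) (snd i)))"
    proof (rule Vitali_covering_theorem_balls[of E K fst snd])
      fix x and d :: real assume x: "x \<in> E" "0 < d"
      then obtain k where k: "0 < k" "ball x k \<subseteq> V" using V by (meson openE subsetD)
      show "\<exists>i. i \<in> K \<and> x \<in> ball (fst i) (snd i) \<and> snd i < d"
        using x k by (intro exI[of _ "(x, min k (d/2))"]) (auto simp: K_def)
    qed blast
    let ?B = "\<Union>i\<in>D. ball (fst i) (snd i)"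
    have dj: "disjoint_family_on (\<lambda>i. ball (fst i) (snd i)) D"
      using pw unfolding disjoint_family_on_def pairwise_def disjnt_def by blast
    have B[measurable]: "?B \<in> sets lebesgue" using D by (intro sets.countable_UN') auto
    have "AE x in lebesgue. x \<in> E \<longrightarrow> x \<in> ?B"
      using AE_not_in[of "E - ?B" lebesgue] neg by (auto simp: negligible_iff_null_sets)
    then have "emeasure ?F E \<le> emeasure ?F ?B"
      by (intro emeasure_mono_AE) (auto simp: AE_density)
    also have "\<dots> = (\<integral>\<^sup>+i. emeasure ?F (ball (fst i) (snd i)) \<partial>count_space D)"
      using D dj by (subst emeasure_UN_countable) auto
    also have "\<dots> \<le> (\<integral>\<^sup>+i. ennreal s * emeasure lebesgue (ball (fst i) (snd i)) \<partial>count_space D)"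
      using D small by (intro nn_integral_mono) (auto simp: K_def)
    also have "\<dots> = ennreal s * (\<integral>\<^sup>+i. emeasure lebesgue (ball (fst i) (snd i)) \<partial>count_space D)"
      by (rule nn_integral_cmult) auto
    also have "(\<integral>\<^sup>+i. emeasure lebesgue (ball (fst i) (snd i)) \<partial>count_space D) = emeasure lebesgue ?B"
      using D dj by (subst emeasure_UN_countable) auto
    also have "emeasure lebesgue ?B \<le> emeasure lebesgue V"
      using D by (intro emeasure_mono) (fastforce simp: K_def)+
    also have "\<dots> \<le> emeasure lebesgue E + emeasure lebesgue (V - E)"
    proof -
      have "V = E \<union> (V - E)" using V by auto
      then show ?thesis
        using emeasure_subadditive[of E lebesgue "V - E"] V E by (metis fmeasurableD)
    qed
    also have "\<dots> \<le> emeasure lebesgue E + ennreal e"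
      using V by (intro add_left_mono) simp
    finally show ?thesis by (simp add: mult_left_mono)
  qed
  show ?thesis
  proof (rule ennreal_le_epsilon)
    fix e :: real assume e: "0 < e"
    \<comment> \<open>Dividing by \<open>s + 1\<close> instead of \<open>s\<close> covers the case
      \<open>s = 0\<close>.\<close>
    have "emeasure ?F E \<le> ennreal s * (emeasure lebesgue E + ennreal (e / (s + 1)))"
      using e \<open>0 \<le> s\<close> by (intro *) (simp add: add_nonneg_pos)
    also have "\<dots> = ennreal s * emeasure lebesgue E + ennreal (s * (e / (s + 1)))"
      using e \<open>0 \<le> s\<close> by (simp only: distrib_left) (subst ennreal_mult, auto)
    also have "\<dots> \<le> ennreal s * emeasure lebesgue E + ennreal e"
      using e \<open>0 \<le> s\<close> by (intro add_left_mono ennreal_leI) (simp add: field_simps)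
    finally show "emeasure ?F E \<le> ennreal s * emeasure lebesgue E + ennreal e" .
  qed
qed

lemma emeasure_ball_scale:
  fixes x z :: "'a::euclidean_space"
  assumes "0 \<le> c" "0 \<le> r"
  shows "emeasure lebesgue (ball z (c * r)) = ennreal (c ^ DIM('a)) * emeasure lebesgue (ball x r)"
  using assms by (simp add: emeasure_ball power_mult_distrib ennreal_mult' mult_ac)

lemma emeasure_ball_pos_finite:
  fixes x :: "'a::euclidean_space"
  assumes "0 < r"
  shows "0 < emeasure lebesgue (ball x r)" "emeasure lebesgue (ball x r) < \<infinity>"
  using assms by (simp_all add: emeasure_ball)

section \<open>Muckenhoupt weights of class \<open>A\<^sub>1\<close>\<close>

text \<open>Stated for balls, the sets of the covering lemmas, and multiplied out, so that the
  condition makes sense before \<open>U\<close> is known to be finite on balls.\<close>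

locale A1_weight =
  fixes u :: "'a::euclidean_space \<Rightarrow> ennreal" and A :: real
  assumes u_meas[measurable]: "u \<in> borel_measurable lebesgue"
    and u_pos: "AE x in lebesgue. 0 < u x"
    and u_fin: "AE x in lebesgue. u x < \<infinity>"
    and A_ge1: "1 \<le> A"
    and A1: "\<And>x r. 0 < r \<Longrightarrow> AE y in lebesgue. y \<in> ball x r \<longrightarrow>
      emeasure (density lebesgue u) (ball x r) \<le> ennreal A * u y * emeasure lebesgue (ball x r)"
begin

abbreviation U :: "'a measure" where "U \<equiv> density lebesgue u"

definition avg :: "'a \<Rightarrow> real \<Rightarrow> real" where
  "avg x r = enn2real (emeasure U (ball x r) / emeasure lebesgue (ball x r))"

text \<open>Integrate \<open>A1\<close> over \<open>y \<in> S\<close>.\<close>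

lemma A1_subset:
  assumes "0 < r" and S[measurable]: "S \<in> sets lebesgue" and sub: "S \<subseteq> ball x r"
  shows "emeasure U (ball x r) * emeasure lebesgue S
    \<le> ennreal A * emeasure U S * emeasure lebesgue (ball x r)"
proof -
  have "emeasure U (ball x r) * emeasure lebesgue S
      = (\<integral>\<^sup>+y. emeasure U (ball x r) * indicator S y \<partial>lebesgue)"
    by (simp add: nn_integral_cmult)
  also have "\<dots> \<le> (\<integral>\<^sup>+y. (ennreal A * emeasure lebesgue (ball x r)) * (u y * indicator S y) \<partial>lebesgue)"
    using A1[OF \<open>0 < r\<close>, of x] sub
    by (intro nn_integral_mono_AE) (auto elim!: eventually_mono simp: indicator_def mult_ac)
  also have "\<dots> = ennreal A * emeasure U S * emeasure lebesgue (ball x r)"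
    by (subst nn_integral_cmult) (auto simp: emeasure_density mult_ac)
  finally show ?thesis .
qed

text \<open>A ball of infinite mass would force \<open>u = \<infinity>\<close> almost everywhere on
  it.\<close>

lemma U_ball_finite:
  assumes "0 < r"
  shows "emeasure U (ball x r) < \<infinity>"
proof -
  have "AE y in lebesgue. y \<in> ball x r \<longrightarrow> emeasure U (ball x r) < \<infinity>"
    using A1[OF assms, of x] u_fin
  proof eventually_elim
    case (elim y)
    then show ?case
      using emeasure_ball_pos_finite(2)[OF assms, of x]
      by (auto simp: ennreal_mult_less_top elim!: order.strict_trans1)
  qed
  then have "AE y in lebesgue. y \<notin> ball x r" if "\<not> emeasure U (ball x r) < \<infinity>"
    by (rule eventually_mono) (use that in auto)
  then have "ball x r \<in> null_sets lebesgue" if "\<not> emeasure U (ball x r) < \<infinity>"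
    using that by (subst AE_iff_null_sets) auto
  then show ?thesis
    using emeasure_ball_pos_finite(1)[OF assms, of x] by (metis less_irrefl null_setsD1)
qed

lemma U_eq_0_imp:
  assumes "S \<in> sets lebesgue" "emeasure U S = 0"
  shows "emeasure lebesgue S = 0"
proof -
  have "AE x in lebesgue. x \<in> S \<longrightarrow> u x = 0"
    using assms by (subst (asm) emeasure_density)
      (auto simp: nn_integral_0_iff_AE elim!: eventually_mono)
  with u_pos have "AE x in lebesgue. x \<notin> S"
    by eventually_elim auto
  then show ?thesis
    using assms by (subst (asm) AE_iff_measurable[OF _ refl]) auto
qed

lemma U_ball_pos:
  assumes "0 < r"
  shows "0 < emeasure U (ball x r)"
  using U_eq_0_imp[of "ball x r"] emeasure_ball_pos_finite(1)[OF assms, of x]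
  by (auto simp: zero_less_iff_neq_zero)

lemma U_ball_eq:
  assumes "0 < r"
  shows "emeasure U (ball x r) = ennreal (avg x r) * emeasure lebesgue (ball x r)"
proof -
  obtain a where "0 < a" "emeasure lebesgue (ball x r) = ennreal a"
    using emeasure_ball_pos_finite[OF assms, of x] by (cases "emeasure lebesgue (ball x r)") auto
  moreover obtain b where "0 \<le> b" "emeasure U (ball x r) = ennreal b"
    using U_ball_finite[OF assms, of x] by (cases "emeasure U (ball x r)") auto
  ultimately show ?thesis
    unfolding avg_def by (simp add: divide_ennreal ennreal_mult''[symmetric])
qed

lemma avg_pos:
  assumes "0 < r"
  shows "0 < avg x r"
  using U_ball_eq[OF assms, of x] U_ball_pos[OF assms, of x]
  by (metis ennreal_0 ennreal_neg linorder_not_less mult_zero_left order_less_irrefl)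

text \<open>\<open>A1_subset\<close> with the small ball as \<open>S\<close>. Passing to a subball
  may raise the average without limit but lowers it at most by the factor \<open>A\<close>; the
  stopping arguments below rest on this one-sided control.\<close>

lemma avg_le_subball:
  assumes "0 < r" "0 < s" "ball x r \<subseteq> ball y s"
  shows "avg y s \<le> A * avg x r"
proof -
  have "emeasure U (ball y s) * emeasure lebesgue (ball x r)
      \<le> ennreal A * emeasure U (ball x r) * emeasure lebesgue (ball y s)"
    using assms by (intro A1_subset) auto
  moreover obtain a where a: "0 < a" "emeasure lebesgue (ball x r) = ennreal a"
    using emeasure_ball_pos_finite[OF \<open>0 < r\<close>, of x] by (cases "emeasure lebesgue (ball x r)") auto
  moreover obtain b where b: "0 < b" "emeasure lebesgue (ball y s) = ennreal b"
    using emeasure_ball_pos_finite[OF \<open>0 < s\<close>, of y] by (cases "emeasure lebesgue (ball y s)") auto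
  ultimately have "avg y s * b * a \<le> A * (avg x r * a) * b"
    using assms avg_pos[of r x] avg_pos[of s y] A_ge1
    by (simp add: U_ball_eq ennreal_mult''[symmetric] ennreal_mult'[symmetric])
  with a b have "avg y s * (a * b) \<le> (A * avg x r) * (a * b)" by (simp add: mult_ac)
  then show ?thesis using a b by simp
qed

lemma avg_le_AE:
  assumes "0 < r"
  shows "AE y in lebesgue. y \<in> ball x r \<longrightarrow> ennreal (avg x r) \<le> ennreal A * u y"
  using A1[OF assms, of x]
proof eventually_elim
  case (elim y)
  then show ?case
    using emeasure_ball_pos_finite[OF assms, of x]
      ennreal_mult_le_mult_iff[of "emeasure lebesgue (ball x r)" "ennreal (avg x r)" "ennreal A * u y"]
    by (simp add: U_ball_eq[OF assms] mult_ac)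
qed

lemma doubling:
  assumes "0 < r" "0 \<le> c" "ball x r \<subseteq> ball y (c * r)" 
  shows "emeasure U (ball y (c * r)) \<le> ennreal (A * c ^ DIM('a)) * emeasure U (ball x r)"
proof -
  have "0 < c"
    using assms by (cases "c = 0") auto
  have "emeasure U (ball y (c * r)) = ennreal (avg y (c * r) * c ^ DIM('a)) * emeasure lebesgue (ball x r)"
    using assms \<open>0 < c\<close> avg_pos[of "c * r" y] emeasure_ball_scale[of c r y x]
    by (simp add: U_ball_eq ennreal_mult' mult_ac)
  also have "\<dots> \<le> ennreal (A * avg x r * c ^ DIM('a)) * emeasure lebesgue (ball x r)"
    using assms \<open>0 < c\<close> by (intro mult_right_mono ennreal_leI avg_le_subball) auto
  also have "\<dots> = ennreal (A * c ^ DIM('a)) * emeasure U (ball x r)"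
    using assms \<open>0 < c\<close> avg_pos[of r x] A_ge1
    by (simp add: U_ball_eq ennreal_mult' mult_ac)
  finally show ?thesis .
qed

end

section \<open>Reverse Hoelder inequality in the form of geometric decay of level sets\<close>

lemma sum_dyadic_below_le:
  fixes s a :: real
  assumes "0 \<le> s"
  shows "(\<Sum>j<J. if 2 ^ j * s < a then 2 ^ j * s else 0) \<le> (if s < a then 2 * a else 0)"
proof (cases "s < a")
  case True
  \<comment> \<open>The bound by \<open>2 ^ J * s\<close> carries the induction: if
    \<open>2 ^ J * s < a\<close>, the old sum and the new term are both at most
    \<open>2 ^ J * s\<close>, hence together below \<open>2 * a\<close>.\<close>
  have "(\<Sum>j<J. if 2 ^ j * s < a then 2 ^ j * s else 0) \<le> min (2 ^ J * s) (2 * a)"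
  proof (induction J)
    case 0
    then show ?case using True assms by auto
  next
    case (Suc J)
    show ?case
    proof (cases "2 ^ J * s < a")
      case True
      have "(\<Sum>j<Suc J. if 2 ^ j * s < a then 2 ^ j * s else 0)
          = (\<Sum>j<J. if 2 ^ j * s < a then 2 ^ j * s else 0) + 2 ^ J * s"
        using True by simp
      moreover have "(\<Sum>j<J. if 2 ^ j * s < a then 2 ^ j * s else 0) \<le> 2 ^ J * s"
        using Suc by simp
      moreover have "2 ^ Suc J * s = 2 * (2 ^ J * s)" by simp
      ultimately show ?thesis
        using True by (intro min.boundedI) linarith+
    next
      case False
      moreover have "0 \<le> 2 ^ J * s" using assms by simp
      ultimately show ?thesis using Suc by simp
    qed
  qed
  with True show ?thesis by simp
next
  case False
  have "a \<le> 2 ^ j * s" for j :: nat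
  proof -
    have "1 * s \<le> 2 ^ j * s" using assms by (intro mult_right_mono) auto
    with False show ?thesis by linarith
  qed
  then have "(\<Sum>j<J. if 2 ^ j * s < a then 2 ^ j * s else 0) = 0"
    by (intro sum.neutral) (simp add: not_less[symmetric])
  with False show ?thesis by simp
qed

context A1_weight
begin

text \<open>A Calderon-Zygmund stopping argument with balls. Near almost every point with
  \<open>u > s\<close> there is a ball with average above \<open>s\<close> whose fivefold dilate has
  average at most \<open>s\<close>. The dilate then has \<open>U\<close>-mass at most
  \<open>5 ^ DIM('a) * s\<close> times the volume of the ball, and the A1 condition puts almost all
  of the ball into \<open>{s < A * u}\<close>. The threshold on \<open>s\<close> keeps these balls
  small compared with \<open>R\<close>.\<close>

lemma high_part_le:
  assumes R: "0 < R" and s: "A * 5 ^ DIM('a) * avg x R \<le> s"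
  shows "emeasure U (ball x R \<inter> {y. ennreal s < u y})
    \<le> ennreal (5 ^ DIM('a) * s) * emeasure lebesgue (ball x (2 * R) \<inter> {y. ennreal s < ennreal A * u y})"
proof -
  have s_pos: "0 < s"
    using A_ge1 avg_pos[OF R, of x] s by (smt (verit) mult_pos_pos zero_less_power)
  define E where "E = ball x R \<inter> {y. ennreal s < u y}"
  define Z where "Z = {y. ennreal s < ennreal A * u y}"
  have [measurable]: "E \<in> sets lebesgue" "Z \<in> sets lebesgue"
    unfolding E_def Z_def by (auto intro!: sets.Int sets_lebesgue_less)
  define K where "K = {(y, r). 0 < r \<and> s < avg y r \<and> ball y r \<inter> ball x R \<noteq> {}}"
  \<comment> \<open>A ball of radius above \<open>R / 2\<close> that meets \<open>ball x R\<close>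
    swallows it when dilated by 5, so its own average would be at most
    \<open>A * 5 ^ DIM('a) * avg x R\<close>, hence at most \<open>s\<close>.\<close>
  have K_small: "r \<le> R / 2" if yr: "(y, r) \<in> K" for y r
  proof (rule ccontr)
    assume "\<not> r \<le> R / 2"
    then have r: "R / 2 < r" "0 < r" using R by auto
    obtain z where z: "dist y z < r" "dist x z < R" using yr by (auto simp: K_def)
    have "dist x y < R + r" using z dist_triangle2[of x y z] by (simp add: dist_commute)
    then have "ball x R \<subseteq> ball y (5 * r)"
      using r by (auto simp: ball_subset_ball_iff dist_commute)
    then have "avg y (5 * r) \<le> A * avg x R"
      using R r by (intro avg_le_subball) auto
    have "ennreal (avg y r) * emeasure lebesgue (ball y r) \<le> emeasure U (ball y (5 * r))"
      using r by (subst U_ball_eq[symmetric]) (auto intro!: emeasure_mono)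
    also have "\<dots> = ennreal (avg y (5 * r) * 5 ^ DIM('a)) * emeasure lebesgue (ball y r)"
      using r avg_pos[of "5 * r" y] emeasure_ball_scale[of 5 r y y]
      by (simp add: U_ball_eq ennreal_mult' mult_ac)
    finally have "avg y r \<le> avg y (5 * r) * 5 ^ DIM('a)"
      using emeasure_ball_pos_finite[OF r(2), of y] avg_pos[of "5 * r" y] r
      by (simp add: mult.commute[of "ennreal _"] ennreal_mult_le_mult_iff)
    also have "\<dots> \<le> A * avg x R * 5 ^ DIM('a)"
      using \<open>avg y (5 * r) \<le> A * avg x R\<close> by (intro mult_right_mono) auto
    finally show False using s yr by (auto simp: K_def mult_ac)
  qed
  define Ob where "Ob = (\<Union>(y, r)\<in>K. ball y r)"
  have "open Ob" unfolding Ob_def by auto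
  then have [measurable]: "Ob \<in> sets lebesgue" by (rule sets_lebesgue_open)
  have "emeasure lebesgue (E - Ob) \<le> emeasure lebesgue (ball x R)"
    by (intro emeasure_mono) (auto simp: E_def)
  with emeasure_ball_pos_finite(2)[OF R, of x]
  have fin: "emeasure lebesgue (E - Ob) < \<infinity>" by (rule order.strict_trans1[rotated])
  have "emeasure U (E - Ob) \<le> ennreal s * emeasure lebesgue (E - Ob)"
  proof (rule emeasure_le_of_small_balls)
    show "emeasure lebesgue (E - Ob) < \<infinity>" by (rule fin)
    fix y r assume y: "y \<in> E - Ob" and r: "0 < (r::real)"
    have "y \<in> ball y r" "y \<in> ball x R" using y r by (auto simp: E_def)
    then have ne: "ball y r \<inter> ball x R \<noteq> {}" by blast
    then have "(y, r) \<notin> K"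
      using y r by (force simp: Ob_def)
    then have "avg y r \<le> s" 
      using r ne unfolding K_def by auto
    then show "emeasure U (ball y r) \<le> ennreal s * emeasure lebesgue (ball y r)"
      using r by (simp add: U_ball_eq mult_right_mono ennreal_leI)
  qed (use s_pos in auto)
  \<comment> \<open>On this set \<open>u > s\<close>, yet its \<open>U\<close>-mass is at most
    \<open>s\<close> times its volume.\<close>
  have "emeasure lebesgue (E - Ob) = 0"
  proof (rule ccontr)
    assume pos: "emeasure lebesgue (E - Ob) \<noteq> 0"
    have "ennreal s * emeasure lebesgue (E - Ob) = (\<integral>\<^sup>+y. ennreal s * indicator (E - Ob) y \<partial>lebesgue)"
      by (simp add: nn_integral_cmult)
    also have "\<dots> < (\<integral>\<^sup>+y. u y * indicator (E - Ob) y \<partial>lebesgue)"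
    proof (rule nn_integral_less)
      show "(\<integral>\<^sup>+y. ennreal s * indicator (E - Ob) y \<partial>lebesgue) \<noteq> \<infinity>"
        using fin by (simp add: nn_integral_cmult ennreal_mult_eq_top_iff)
      show "AE y in lebesgue. ennreal s * indicator (E - Ob) y \<le> u y * indicator (E - Ob) y"
        by (auto simp: E_def indicator_def)
      show "\<not> (AE y in lebesgue. u y * indicator (E - Ob) y \<le> ennreal s * indicator (E - Ob) y)"
      proof
        assume "AE y in lebesgue. u y * indicator (E - Ob) y \<le> ennreal s * indicator (E - Ob) y"
        then have "AE y in lebesgue. y \<notin> E - Ob"
          by eventually_elim (auto simp: E_def not_le[symmetric] split: split_indicator_asm)
        then have "E - Ob \<in> null_sets lebesgue"
          by (subst AE_iff_null_sets) auto
        with pos show False by auto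
      qed
    qed auto
    also have "\<dots> = emeasure U (E - Ob)" by (simp add: emeasure_density)
    finally show False using \<open>emeasure U (E - Ob) \<le> _\<close> by simp
  qed
  then have "emeasure U (E - Ob) = 0"
    using absolutely_continuousD[OF absolutely_continuousI_density[OF u_meas], of "E - Ob"] by auto
  define K' where "K' = {i\<in>K. avg (fst i) (5 * snd i) \<le> s}"
  have "\<exists>Y\<in>sets lebesgue. E \<inter> Ob \<subseteq> Y \<and> emeasure U Y
      \<le> ennreal (5 ^ DIM('a) * s) * emeasure (density lebesgue (indicator Z)) (\<Union>i\<in>K'. ball (fst i) (snd i))"
  proof (rule vitali_emeasure_bound[where S = "\<lambda>i. ball (fst i) (5 * snd i)"])
    fix i assume "i \<in> K'"
    then show "0 < snd i \<and> snd i \<le> R / 2"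
      using K_small by (cases i) (auto simp: K'_def K_def)
  next
    fix i assume i: "i \<in> K'"
    obtain y r where [simp]: "i = (y, r)" by (cases i)
    have yr: "0 < r" "s < avg y r" "avg y (5 * r) \<le> s" using i by (auto simp: K'_def K_def)
    have "emeasure U (ball y (5 * r)) = ennreal (5 ^ DIM('a) * avg y (5 * r)) * emeasure lebesgue (ball y r)"
      using yr avg_pos[of "5 * r" y] emeasure_ball_scale[of 5 r y y]
      by (simp add: U_ball_eq ennreal_mult' mult_ac)
    also have "\<dots> \<le> ennreal (5 ^ DIM('a) * s) * emeasure lebesgue (ball y r)"
      using yr by (intro mult_right_mono ennreal_leI) auto
    also have "emeasure lebesgue (ball y r) \<le> emeasure (density lebesgue (indicator Z)) (ball y r)"
    proof -
      have "AE z in lebesgue. z \<in> ball y r \<longrightarrow> z \<in> Z"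
        using avg_le_AE[OF yr(1), of y]
      proof eventually_elim
        case (elim z)
        have "ennreal s < ennreal (avg y r)" using yr s_pos by (simp add: ennreal_less_iff)
        with elim show ?case by (auto simp: Z_def)
      qed
      then have "(\<integral>\<^sup>+z. indicator (ball y r) z \<partial>lebesgue) \<le> (\<integral>\<^sup>+z. indicator Z z * indicator (ball y r) z \<partial>lebesgue)"
        by (intro nn_integral_mono_AE) (auto elim!: eventually_mono simp: indicator_def)
      then show ?thesis by (simp add: emeasure_density)
    qed
    finally show "emeasure U (ball (fst i) (5 * snd i))
      \<le> ennreal (5 ^ DIM('a) * s) * emeasure (density lebesgue (indicator Z)) (ball (fst i) (snd i))"
      by (simp add: mult_left_mono)
  next
    fix z assume "z \<in> E \<inter> Ob"
    then obtain y0 r0 where yr0: "(y0, r0) \<in> K" "z \<in> ball y0 r0" by (auto simp: Ob_def)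
    \<comment> \<open>The radii of the balls of \<open>K\<close> through \<open>z\<close>. A radius
      above a fifth of the supremum cannot be multiplied by 5 within \<open>P\<close>, and the only
      clause of \<open>K\<close> that can fail for the dilate is that its average exceeds
      \<open>s\<close>.\<close>
    define P where "P = {r. \<exists>y. (y, r) \<in> K \<and> z \<in> ball y r}"
    have P: "r0 \<in> P" "bdd_above P"
      using yr0 K_small by (auto simp: P_def intro!: bdd_aboveI[of _ "R / 2"])
    have "0 < r0" using yr0 by (auto simp: K_def)
    then have "0 < Sup P" using P cSup_upper[of r0 P] by linarith
    then obtain r where r: "r \<in> P" "Sup P / 5 < r"
      using less_cSupD[of P "Sup P / 5"] P by auto
    then obtain y where y: "(y, r) \<in> K" "z \<in> ball y r" by (auto simp: P_def)
    have "5 * r \<notin> P" using r P cSup_upper[of "5 * r" P] by auto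
    moreover have "z \<in> ball y (5 * r)" using y by (auto simp: K_def)
    ultimately have "(y, 5 * r) \<notin> K" by (auto simp: P_def)
    moreover have "ball y (5 * r) \<inter> ball x R \<noteq> {}"
      using \<open>z \<in> ball y (5 * r)\<close> \<open>z \<in> E \<inter> Ob\<close> unfolding E_def by blast
    ultimately have "(y, r) \<in> K'"
      using y unfolding K_def K'_def by (auto simp: not_le[symmetric])
    then show "\<exists>i\<in>K'. \<forall>j\<in>K'. ball (fst i) (snd i) \<subseteq> ball (fst j) (5 * snd j) \<longrightarrow> z \<in> ball (fst j) (5 * snd j)"
      using y by (intro bexI[of _ "(y, r)"]) auto
  qed auto
  then obtain Y where Y: "Y \<in> sets lebesgue" "E \<inter> Ob \<subseteq> Y" and UY: "emeasure U Y
      \<le> ennreal (5 ^ DIM('a) * s) * emeasure (density lebesgue (indicator Z)) (\<Union>i\<in>K'. ball (fst i) (snd i))"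
    by blast
  have op: "open (\<Union>i\<in>K'. ball (fst i) (snd i))" by auto
  then have [measurable]: "(\<Union>i\<in>K'. ball (fst i) (snd i)) \<in> sets lebesgue"
    by (rule sets_lebesgue_open)
  have "emeasure U E \<le> emeasure U (E \<inter> Ob) + emeasure U (E - Ob)"
    by (rule order_trans[OF _ emeasure_subadditive]) (auto intro!: emeasure_mono)
  also have "\<dots> \<le> emeasure U Y"
    using Y \<open>emeasure U (E - Ob) = 0\<close> by (auto intro!: emeasure_mono)
  also note UY
  also have "emeasure (density lebesgue (indicator Z)) (\<Union>i\<in>K'. ball (fst i) (snd i))
      = emeasure lebesgue (Z \<inter> (\<Union>i\<in>K'. ball (fst i) (snd i)))"
    by (simp add: emeasure_density indicator_inter_arith[symmetric])
  \<comment> \<open>Balls of radius at most \<open>R / 2\<close> that meet \<open>ball x R\<close>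
    stay inside the double ball.\<close>
  also have "\<dots> \<le> emeasure lebesgue (ball x (2 * R) \<inter> Z)"
  proof (intro emeasure_mono subsetI)
    fix z assume "z \<in> Z \<inter> (\<Union>i\<in>K'. ball (fst i) (snd i))"
    then obtain y r where yr: "(y, r) \<in> K" "dist y z < r" and "z \<in> Z" by (auto simp: K'_def)
    obtain w where w: "dist y w < r" "dist x w < R" using yr by (auto simp: K_def)
    have "dist x z \<le> dist x w + dist y w + dist y z"
      by (metis dist_commute dist_triangle add.assoc add_left_mono order_trans)
    also have "\<dots> < 2 * R" using w yr K_small[OF yr(1)] by linarith
    finally show "z \<in> ball x (2 * R) \<inter> Z" using \<open>z \<in> Z\<close> by auto
  qed auto
  finally show ?thesis
    by (simp add: E_def Z_def mult_left_mono)
qed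

end

lemma ennreal_less_divide_iff:
  fixes a b c :: ennreal
  assumes "0 < b" "b < \<infinity>"
  shows "a < c / b \<longleftrightarrow> a * b < c"
proof -
  have "b * (c / b) = c"
    using assms mult_divide_eq_ennreal[of b c] by (simp add: ennreal_times_divide mult.commute)
  then have "c / b \<le> a \<longleftrightarrow> c \<le> a * b"
    using assms ennreal_mult_le_mult_iff[of b "c / b" a] by (simp add: mult.commute)
  then show ?thesis by (metis not_less)
qed

context A1_weight
begin

text \<open>Sum \<open>high_part_le\<close> over the levels \<open>2 ^ j * s\<close> with
  \<open>j < J\<close>. Each left side is at least the mass at the top level; on the right the
  dyadic sum at a single point is at most \<open>2 * A * u\<close>, so the volumes combine to one
  \<open>U\<close>-mass. What is gained is the factor \<open>J\<close>, which can be chosen at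
  will.\<close>

lemma high_part_decay:
  assumes R: "0 < R" and s: "A * 5 ^ DIM('a) * avg x R \<le> s"
  shows "ennreal (real J) * emeasure U (ball x R \<inter> {y. ennreal (2 ^ J * s) < u y})
    \<le> ennreal (5 ^ DIM('a) * (2 * A)) * emeasure U (ball x (2 * R) \<inter> {y. ennreal s < ennreal A * u y})"
proof -
  have s_pos: "0 < s"
    using A_ge1 avg_pos[OF R, of x] s by (smt (verit) mult_pos_pos zero_less_power)
  define B where "B = ball x (2 * R)"
  have Z[measurable]: "{y. ennreal t < ennreal A * u y} \<in> sets lebesgue" for t
    by (rule sets_lebesgue_less) auto
  have B[measurable]: "B \<in> sets lebesgue" by (simp add: B_def)
  have s_le: "s \<le> 2 ^ j * s" for j :: nat
  proof -
    have "1 * s \<le> 2 ^ j * s" using s_pos by (intro mult_right_mono) auto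
    then show ?thesis by simp
  qed
  have "ennreal (real J) * emeasure U (ball x R \<inter> {y. ennreal (2 ^ J * s) < u y})
      = (\<Sum>j<J. emeasure U (ball x R \<inter> {y. ennreal (2 ^ J * s) < u y}))"
    by (simp add: ennreal_of_nat_eq_real_of_nat)
  also have "\<dots> \<le> (\<Sum>j<J. ennreal (5 ^ DIM('a)) * (\<integral>\<^sup>+y. ennreal (2 ^ j * s) *
      indicator (B \<inter> {y. ennreal (2 ^ j * s) < ennreal A * u y}) y \<partial>lebesgue))"
  proof (intro sum_mono)
    fix j assume "j \<in> {..<J}"
    then have "2 ^ j * s \<le> 2 ^ J * s" using s_pos by (intro mult_right_mono power_increasing) auto
    then have "emeasure U (ball x R \<inter> {y. ennreal (2 ^ J * s) < u y})
        \<le> emeasure U (ball x R \<inter> {y. ennreal (2 ^ j * s) < u y})"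
      by (intro emeasure_mono) (auto intro!: sets.Int sets_lebesgue_less
          intro: order.strict_trans1[OF ennreal_leI])
    also have "\<dots> \<le> ennreal (5 ^ DIM('a) * (2 ^ j * s)) * emeasure lebesgue
        (B \<inter> {y. ennreal (2 ^ j * s) < ennreal A * u y})"
      unfolding B_def using s s_le[of j] by (intro high_part_le R) auto
    also have "\<dots> = ennreal (5 ^ DIM('a)) * (\<integral>\<^sup>+y. ennreal (2 ^ j * s) *
      indicator (B \<inter> {y. ennreal (2 ^ j * s) < ennreal A * u y}) y \<partial>lebesgue)"
      using s_pos by (simp add: nn_integral_cmult ennreal_mult' mult.assoc)
    finally show "emeasure U (ball x R \<inter> {y. ennreal (2 ^ J * s) < u y})
      \<le> ennreal (5 ^ DIM('a)) * (\<integral>\<^sup>+y. ennreal (2 ^ j * s) *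
      indicator (B \<inter> {y. ennreal (2 ^ j * s) < ennreal A * u y}) y \<partial>lebesgue)" .
  qed
  also have "\<dots> = ennreal (5 ^ DIM('a)) * (\<integral>\<^sup>+y. (\<Sum>j<J. ennreal (2 ^ j * s) *
      indicator (B \<inter> {y. ennreal (2 ^ j * s) < ennreal A * u y}) y) \<partial>lebesgue)"
    by (subst nn_integral_sum) (auto simp: sum_distrib_left)
  also have "\<dots> \<le> ennreal (5 ^ DIM('a)) * (\<integral>\<^sup>+y. ennreal (2 * A) * (u y *
      indicator (B \<inter> {y. ennreal s < ennreal A * u y}) y) \<partial>lebesgue)"
  proof (intro mult_left_mono nn_integral_mono_AE)
    show "AE y in lebesgue. (\<Sum>j<J. ennreal (2 ^ j * s) *
        indicator (B \<inter> {y. ennreal (2 ^ j * s) < ennreal A * u y}) y)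
        \<le> ennreal (2 * A) * (u y * indicator (B \<inter> {y. ennreal s < ennreal A * u y}) y)"
      using u_fin
    proof eventually_elim
      case (elim y)
      show ?case
      proof (cases "y \<in> B")
        case True
        obtain a where a: "0 \<le> a" "u y = ennreal a" using elim by (cases "u y") auto
        have Aa: "ennreal A * u y = ennreal (A * a)" using a A_ge1 by (simp add: ennreal_mult')
        have "(\<Sum>j<J. ennreal (2 ^ j * s) * indicator (B \<inter> {y. ennreal (2 ^ j * s) < ennreal A * u y}) y)
            = (\<Sum>j<J. ennreal (if 2 ^ j * s < A * a then 2 ^ j * s else 0))"
          using True s_pos by (intro sum.cong) (auto simp: indicator_def Aa ennreal_less_iff)
        also have "\<dots> = ennreal (\<Sum>j<J. if 2 ^ j * s < A * a then 2 ^ j * s else 0)"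
          using s_pos by (intro sum_ennreal) auto
        also have "\<dots> \<le> ennreal (if s < A * a then 2 * (A * a) else 0)"
          using s_pos by (intro ennreal_leI sum_dyadic_below_le) auto
        also have "\<dots> = ennreal (2 * A) * (u y * indicator (B \<inter> {y. ennreal s < ennreal A * u y}) y)"
          using True s_pos A_ge1 a unfolding indicator_def
          by (auto simp: Aa ennreal_less_iff ennreal_mult'[symmetric] mult_ac)
        finally show ?thesis .
      qed simp
    qed
  qed simp
  also have "\<dots> = ennreal (5 ^ DIM('a) * (2 * A)) * emeasure U (B \<inter> {y. ennreal s < ennreal A * u y})"
    using A_ge1 by (subst nn_integral_cmult) (auto simp: emeasure_density ennreal_mult' mult.assoc)
  finally show ?thesis by (simp add: B_def)
qed

text \<open>The bound is proved for all balls at once because the induction on \<open>k\<close> passes from a ball to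
  its double.\<close>

lemma reverse_hoelder:
  assumes c: "0 < c"
  obtains T where "1 < T" and "\<And>k x r. 0 < r \<Longrightarrow>
    emeasure U (ball x r \<inter> {y. ennreal (c * T ^ k * avg x r) < u y}) \<le> ennreal (1 / 2 ^ k) * emeasure U (ball x r)"
proof -
  define K0 where "K0 = A * 5 ^ DIM('a)"
  \<comment> \<open>\<open>J\<close> outweighs the constants of one induction step:
    \<open>5 ^ DIM('a) * (2 * A)\<close> from \<open>high_part_decay\<close>,
    \<open>A * 2 ^ DIM('a)\<close> from doubling, and 2 for the gain from \<open>k\<close> to
    \<open>Suc k\<close>.\<close>
  obtain J :: nat where J: "4 * 10 ^ DIM('a) * A\<^sup>2 \<le> real J"
    using real_arch_simple by blast
  have "1 \<le> A\<^sup>2" using A_ge1 by (simp add: one_le_power)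
  \<comment> \<open>\<open>A\<^sup>2\<close> pays for passing from the average over the double ball
    back to \<open>avg x r\<close> and for the factor \<open>A\<close> in
    \<open>{s < A * u}\<close>; \<open>K0 / c\<close> brings the level above the threshold of
    \<open>high_part_decay\<close>. An arbitrary \<open>c\<close> is harmless because the claim is
    trivial at \<open>k = 0\<close>.\<close>
  define \<tau> where "\<tau> = max (A\<^sup>2) (K0 / c)"
  define T where "T = 2 ^ J * \<tau>"
  have \<tau>: "1 \<le> \<tau>" "A\<^sup>2 \<le> \<tau>" "K0 \<le> c * \<tau>"
    using \<open>1 \<le> A\<^sup>2\<close> c by (auto simp: \<tau>_def le_max_iff_disj max_mult_distrib_left)
  have J_pos: "0 < real J"
  proof -
    have "0 < 4 * 10 ^ DIM('a) * A\<^sup>2" using A_ge1 by simp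
    with J show ?thesis by linarith
  qed
  then have "(2::real) ^ 1 \<le> 2 ^ J" by (intro power_increasing) auto
  then have "2 * 1 \<le> T" unfolding T_def using \<tau> by (intro mult_mono) auto
  then have T: "1 \<le> T" "1 < T" by simp_all
  have "emeasure U (ball x r \<inter> {y. ennreal (c * T ^ k * avg x r) < u y})
      \<le> ennreal (1 / 2 ^ k) * emeasure U (ball x r)" if "0 < r" for x r k
    using that
  proof (induction k arbitrary: x r)
    case 0
    then show ?case by (auto intro!: emeasure_mono)
  next
    case (Suc k)
    define s where "s = c * \<tau> * T ^ k * avg x r"
    have a: "0 < avg x r" using Suc.prems by (rule avg_pos)
    have eq: "c * T ^ Suc k * avg x r = 2 ^ J * s"
      by (simp add: s_def T_def)
    have "K0 * 1 \<le> c * \<tau> * T ^ k"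
      using \<tau> T c by (intro mult_mono) (auto simp: one_le_power)
    then have "A * 5 ^ DIM('a) * avg x r \<le> s"
      unfolding s_def using a by (simp add: K0_def)
    note * = high_part_decay[OF Suc.prems this, of J]
    have sub: "ball x r \<subseteq> ball x (2 * r)" using Suc.prems by auto
    have "avg x (2 * r) \<le> A * avg x r"
      using Suc.prems sub by (intro avg_le_subball) auto
    then have "A * (c * T ^ k * avg x (2 * r)) \<le> A * (c * T ^ k * (A * avg x r))"
      using A_ge1 c T by (intro mult_left_mono) auto
    also have "\<dots> = A\<^sup>2 * (c * T ^ k * avg x r)" by (simp add: power2_eq_square)
    also have "\<dots> \<le> \<tau> * (c * T ^ k * avg x r)"
      using \<tau> c T a by (intro mult_right_mono) auto
    also have "\<dots> = s" by (simp add: s_def)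
    finally have le_s: "A * (c * T ^ k * avg x (2 * r)) \<le> s" .
    have "ennreal (c * T ^ k * avg x (2 * r)) < u y" if y: "ennreal s < ennreal A * u y" for y
    proof (rule ccontr)
      assume "\<not> ennreal (c * T ^ k * avg x (2 * r)) < u y"
      then have "ennreal A * u y \<le> ennreal A * ennreal (c * T ^ k * avg x (2 * r))"
        by (intro mult_left_mono) auto
      also have "\<dots> \<le> ennreal s"
        using A_ge1 le_s by (simp add: ennreal_mult'[symmetric] ennreal_leI)
      finally show False using y by simp
    qed
    then have "emeasure U (ball x (2 * r) \<inter> {y. ennreal s < ennreal A * u y})
        \<le> emeasure U (ball x (2 * r) \<inter> {y. ennreal (c * T ^ k * avg x (2 * r)) < u y})"
      by (intro emeasure_mono) (auto intro!: sets.Int sets_lebesgue_less)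
    also have "\<dots> \<le> ennreal (1 / 2 ^ k) * emeasure U (ball x (2 * r))"
      using Suc by auto
    also have "\<dots> \<le> ennreal (1 / 2 ^ k) * (ennreal (A * 2 ^ DIM('a)) * emeasure U (ball x r))"
      using Suc.prems sub by (intro mult_left_mono doubling) auto
    finally have "ennreal (real J) * emeasure U (ball x r \<inter> {y. ennreal (2 ^ J * s) < u y})
      \<le> ennreal (5 ^ DIM('a) * (2 * A)) * (ennreal (1 / 2 ^ k) * (ennreal (A * 2 ^ DIM('a)) * emeasure U (ball x r)))"
      by (intro order_trans[OF *] mult_left_mono) auto
    also have "\<dots> = ennreal (4 * 10 ^ DIM('a) * A\<^sup>2 * (1 / 2 ^ Suc k)) * emeasure U (ball x r)"
    proof -
      have eq: "5 ^ DIM('a) * (2 * A) * (1 / 2 ^ k * (A * 2 ^ DIM('a))) = 4 * 10 ^ DIM('a) * A\<^sup>2 * (1 / 2 ^ Suc k)"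
        using power_mult_distrib[of "5 :: real" 2 "DIM('a)"] by (simp add: power2_eq_square)
      have "ennreal a * (ennreal b * (ennreal c * e)) = ennreal (a * (b * c)) * e"
        if "0 \<le> a" "0 \<le> b" "0 \<le> c" for a b c e
        using that by (simp add: ennreal_mult mult.assoc)
      then show ?thesis unfolding eq[symmetric] using A_ge1 by simp
    qed
    also have "\<dots> \<le> ennreal (real J * (1 / 2 ^ Suc k)) * emeasure U (ball x r)"
      using J by (intro mult_right_mono ennreal_leI) auto
    also have "\<dots> = ennreal (real J) * (ennreal (1 / 2 ^ Suc k) * emeasure U (ball x r))"
      by (subst ennreal_mult') (simp_all add: mult.assoc)
    finally show ?case
      using J_pos unfolding eq by (subst (asm) ennreal_mult_le_mult_iff) auto
  qed
  with T that show thesis by blast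
qed

section \<open>The uncentred maximal function of \<open>h / u\<close> with respect to the measure
  \<open>U\<close>, and the mixed weak type bound\<close>

definition maxfun :: "('a \<Rightarrow> ennreal) \<Rightarrow> 'a \<Rightarrow> ennreal" where
  "maxfun h x = (SUP (y, r) \<in> {(y, r). 0 < r \<and> x \<in> ball y r}.
     emeasure (density lebesgue h) (ball y r) / emeasure U (ball y r))"

lemma less_maxfun_iff:
  "a < maxfun h x \<longleftrightarrow> (\<exists>y r. 0 < r \<and> x \<in> ball y r \<and>
     a * emeasure U (ball y r) < emeasure (density lebesgue h) (ball y r))"
proof -
  have *: "a < e / emeasure U (ball y r) \<longleftrightarrow> a * emeasure U (ball y r) < e" if "0 < r" for y r e
    using U_ball_pos[OF that, of y] U_ball_finite[OF that, of y]
    by (simp add: ennreal_less_divide_iff)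
  have "a < maxfun h x \<longleftrightarrow> (\<exists>y r. 0 < r \<and> x \<in> ball y r \<and>
     a < emeasure (density lebesgue h) (ball y r) / emeasure U (ball y r))"
    unfolding maxfun_def less_SUP_iff by (simp add: Bex_def split_paired_Ex conj_assoc del: mem_ball)
  then show ?thesis using * by meson
qed

lemma le_maxfun:
  assumes "0 < r" "x \<in> ball y r"
  shows "emeasure (density lebesgue h) (ball y r) \<le> maxfun h x * emeasure U (ball y r)"
  using less_maxfun_iff[of "maxfun h x" h x] assms by (force simp: not_less)

text \<open>Uncentred balls make the superlevel sets open.\<close>

lemma maxfun_measurable[measurable]: "maxfun h \<in> borel_measurable lebesgue"
proof (rule borel_measurableI_greater)
  fix a
  have "{x \<in> space lebesgue. a < maxfun h x} =
      (\<Union>(y, r) \<in> {(y, r). 0 < r \<and> a * emeasure U (ball y r) < emeasure (density lebesgue h) (ball y r)}. ball y r)"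
    by (fastforce simp: less_maxfun_iff)
  also have "\<dots> \<in> sets lebesgue"
    by (rule sets_lebesgue_open) auto
  finally show "{x \<in> space lebesgue. a < maxfun h x} \<in> sets lebesgue" .
qed


text \<open>Provides the bound on radii that Vitali's lemma asks for. When \<open>r > 1\<close>, the
  estimate \<open>r \<le> r ^ DIM('a)\<close> avoids taking roots.\<close>

lemma ball_radius_bounded:
  fixes y :: 'a and r :: real
  assumes "0 < r" "emeasure lebesgue (ball y r) \<le> ennreal b" "0 \<le> b"
  shows "r \<le> 1 + b / unit_ball_vol (real DIM('a))"
proof (cases "r \<le> 1")
  case True
  then show ?thesis using assms by (simp add: add_increasing2)
next
  case False
  have "unit_ball_vol (real DIM('a)) * r ^ DIM('a) \<le> b"
    using assms by (simp add: emeasure_ball)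
  moreover have "r ^ 1 \<le> r ^ DIM('a)"
    using False by (intro power_increasing) auto
  moreover have "0 < unit_ball_vol (real DIM('a))" by simp
  ultimately have "unit_ball_vol (real DIM('a)) * r \<le> b"
    by (smt (verit) mult_left_mono power_one_right)
  then have "r \<le> b / unit_ball_vol (real DIM('a))"
    by (simp add: pos_le_divide_eq mult.commute)
  then show ?thesis by simp
qed

lemma maxfun_weak_type:
  fixes h :: "'a \<Rightarrow> ennreal"
  assumes [measurable]: "h \<in> borel_measurable lebesgue" and "0 < \<mu>"
  shows "ennreal \<mu> * emeasure U {x. ennreal \<mu> < maxfun h x}
    \<le> ennreal (A * 5 ^ DIM('a)) * (\<integral>\<^sup>+x. h x \<partial>lebesgue)"
proof -
  let ?H = "density lebesgue h"
  \<comment> \<open>Radii are cut off at \<open>n\<close> so that Vitali's lemma applies; the sets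
    \<open>V n\<close> increase to the full superlevel set.\<close>
  define K where "K n = {(y, r). 0 < r \<and> r \<le> real n \<and> ennreal \<mu> * emeasure U (ball y r) < emeasure ?H (ball y r)}" for n :: nat
  define V where "V n = (\<Union>i\<in>K n. ball (fst i) (snd i))" for n
  have op: "open (V n)" for n unfolding V_def by auto
  then have [measurable]: "V n \<in> sets lebesgue" for n by (rule sets_lebesgue_open)
  have eq: "{x. ennreal \<mu> < maxfun h x} = (\<Union>n. V n)"
  proof (intro set_eqI iffI)
    fix x assume "x \<in> {x. ennreal \<mu> < maxfun h x}"
    then obtain y r where yr: "0 < r" "x \<in> ball y r" "ennreal \<mu> * emeasure U (ball y r) < emeasure ?H (ball y r)"
      unfolding less_maxfun_iff by blast
    obtain n where "r \<le> real n" using real_arch_simple by blast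
    with yr show "x \<in> (\<Union>n. V n)"
      unfolding V_def K_def by (intro UN_I[of n] UN_I[of "(y, r)"]) auto
  next
    fix x assume "x \<in> (\<Union>n. V n)"
    then show "x \<in> {x. ennreal \<mu> < maxfun h x}"
      unfolding V_def K_def less_maxfun_iff by auto
  qed
  have "incseq V"
    unfolding V_def K_def incseq_def by (auto intro!: UN_mono)
  have bound: "ennreal \<mu> * emeasure U (V n) \<le> ennreal (A * 5 ^ DIM('a)) * (\<integral>\<^sup>+x. h x \<partial>lebesgue)" for n
  proof -
    have "\<exists>Y\<in>sets lebesgue. V n \<subseteq> Y \<and> emeasure U Y \<le> ennreal (A * 5 ^ DIM('a) / \<mu>) * emeasure ?H (\<Union>i\<in>K n. ball (fst i) (snd i))"
    proof (rule vitali_emeasure_bound[where S = "\<lambda>i. ball (fst i) (5 * snd i)"])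
      fix i assume i: "i \<in> K n"
      then show "0 < snd i \<and> snd i \<le> real n" by (auto simp: K_def)
      obtain y r where [simp]: "i = (y, r)" by (cases i)
      have yr: "0 < r" "ennreal \<mu> * emeasure U (ball y r) < emeasure ?H (ball y r)"
        using i by (auto simp: K_def)
      have "emeasure U (ball y (5 * r)) \<le> ennreal (A * 5 ^ DIM('a)) * emeasure U (ball y r)"
        using yr by (intro doubling) auto
      also have "\<dots> = ennreal (A * 5 ^ DIM('a) / \<mu>) * (ennreal \<mu> * emeasure U (ball y r))"
        using \<open>0 < \<mu>\<close> A_ge1 by (simp add: mult.assoc[symmetric] ennreal_mult'[symmetric])
      also have "\<dots> \<le> ennreal (A * 5 ^ DIM('a) / \<mu>) * emeasure ?H (ball y r)"
        using yr by (intro mult_left_mono) auto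
      finally show "emeasure U (ball (fst i) (5 * snd i))
          \<le> ennreal (A * 5 ^ DIM('a) / \<mu>) * emeasure ?H (ball (fst i) (snd i))" by simp
    next
      fix x assume "x \<in> V n"
      then show "\<exists>i\<in>K n. \<forall>j\<in>K n. ball (fst i) (snd i) \<subseteq> ball (fst j) (5 * snd j) \<longrightarrow> x \<in> ball (fst j) (5 * snd j)"
        unfolding V_def by blast
    qed auto
    then obtain Y where Y: "Y \<in> sets lebesgue" "V n \<subseteq> Y"
      "emeasure U Y \<le> ennreal (A * 5 ^ DIM('a) / \<mu>) * emeasure ?H (\<Union>i\<in>K n. ball (fst i) (snd i))" by blast
    have "emeasure U (V n) \<le> emeasure U Y" using Y by (intro emeasure_mono) auto
    also note Y(3)
    also have "emeasure ?H (\<Union>i\<in>K n. ball (fst i) (snd i)) \<le> emeasure ?H (space ?H)"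
      by (rule emeasure_space)
    also have "\<dots> = (\<integral>\<^sup>+x. h x \<partial>lebesgue)" by (simp add: emeasure_density)
    finally have "ennreal \<mu> * emeasure U (V n) \<le> ennreal \<mu> * (ennreal (A * 5 ^ DIM('a) / \<mu>) * (\<integral>\<^sup>+x. h x \<partial>lebesgue))"
      by (simp add: mult_left_mono)
    then show ?thesis
      using \<open>0 < \<mu>\<close> A_ge1 by (simp add: mult.assoc[symmetric] ennreal_mult'[symmetric])
  qed
  have "emeasure U (\<Union>n. V n) = (SUP n. emeasure U (V n))"
    using \<open>incseq V\<close> by (intro SUP_emeasure_incseq[symmetric]) auto
  then show ?thesis
    unfolding eq using bound by (simp add: SUP_mult_left_ennreal SUP_least)
qed

text \<open>If \<open>t < u x * maxfun h x\<close>, a ball \<open>B\<close> through \<open>x\<close>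
  witnesses it; put \<open>x\<close> into the class \<open>i\<close> with
  \<open>T ^ i * avg \<le> u x < T ^ Suc i * avg\<close>. The upper bound gives
  \<open>|B| \<le> T ^ Suc i / t * \<integral>_B h\<close>, which loses \<open>T ^ i\<close>. The
  lower bound confines \<open>x\<close> to the part of the Vitali dilate where \<open>u\<close> is
  at least of order \<open>T ^ i\<close> times its average, and this part is a fraction of order
  \<open>2 ^ (-i) * T ^ (-i)\<close>. The classes therefore contribute a geometric series.\<close>

lemma mixed_weak_type:
  obtains C where "0 < C" and "\<And>(h :: 'a \<Rightarrow> ennreal) t. h \<in> borel_measurable lebesgue \<Longrightarrow> 0 < t \<Longrightarrow>
    ennreal t * emeasure lebesgue {x. ennreal t < u x * maxfun h x} \<le> ennreal C * (\<integral>\<^sup>+x. h x \<partial>lebesgue)"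
proof -
  \<comment> \<open>The dilate of the selected ball that swallows the given one may have an average
    larger by the factor \<open>A\<close>; the additional 2 makes the resulting inequality
    strict.\<close>
  define c where "c = 1 / (2 * A)"
  have c: "0 < c" using A_ge1 by (simp add: c_def)
  obtain T where T1: "1 < T" and RH: "\<And>k x r. 0 < r \<Longrightarrow>
    emeasure U (ball x r \<inter> {y. ennreal (c * T ^ k * avg x r) < u y}) \<le> ennreal (1 / 2 ^ k) * emeasure U (ball x r)"
    using reverse_hoelder[OF c] by blast
  then have T: "1 \<le> T" by simp
  define C0 where "C0 = 5 ^ DIM('a) * 2 * A * T"
  have C0: "0 < C0" using A_ge1 T by (simp add: C0_def)
  have main: "ennreal t * emeasure lebesgue {x. ennreal t < u x * maxfun h x} \<le> ennreal (2 * C0) * (\<integral>\<^sup>+x. h x \<partial>lebesgue)"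
    if [measurable]: "h \<in> borel_measurable lebesgue" and l: "0 < t" for h :: "'a \<Rightarrow> ennreal" and t
  proof (cases "(\<integral>\<^sup>+x. h x \<partial>lebesgue) = \<infinity>")
    case True
    then show ?thesis using C0 by (simp add: ennreal_mult_top)
  next
    case False
    define I where "I = enn2real (\<integral>\<^sup>+x. h x \<partial>lebesgue)"
    have I: "0 \<le> I" "(\<integral>\<^sup>+x. h x \<partial>lebesgue) = ennreal I"
      using False by (auto simp: I_def less_top)
    let ?H = "density lebesgue h"
    have Hle: "emeasure ?H S \<le> ennreal I" for S
      using emeasure_space[of ?H S] by (simp add: emeasure_density I)
    define K where "K i = {(y, r). 0 < r \<and> ennreal (t / T ^ Suc i) * emeasure lebesgue (ball y r) < emeasure ?H (ball y r)}" for i :: nat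
    \<comment> \<open>Class 0 carries no lower bound: it takes all points where \<open>u\<close> is
      below \<open>T\<close> times the average, and there the whole dilate is affordable.\<close>
    define X where "X i = {x. \<exists>(y, r)\<in>K i. x \<in> ball y r \<and> (i = 0 \<or> ennreal (T ^ i * avg y r) \<le> u x)}" for i
    define S where "S i = (\<lambda>(y, r). if i = 0 then ball y (5 * r) else ball y (5 * r) \<inter> {x. ennreal (c * T ^ i * avg y (5 * r)) < u x})" for i :: nat
    have "\<exists>Y\<in>sets lebesgue. X i \<subseteq> Y \<and> emeasure lebesgue Y \<le> ennreal (C0 / t / 2 ^ i) * emeasure ?H (\<Union>i\<in>K i. ball (fst i) (snd i))" for i
    proof (rule vitali_emeasure_bound[where S = "S i"])
      fix j assume j: "j \<in> K i"
      obtain y r where [simp]: "j = (y, r)" by (cases j)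
      have yr: "0 < r" "ennreal (t / T ^ Suc i) * emeasure lebesgue (ball y r) < emeasure ?H (ball y r)"
        using j by (auto simp: K_def)
      have T': "0 < t / T ^ Suc i" "0 < T ^ i" using T l by auto
      \<comment> \<open>Serves twice: together with \<open>\<integral>h < \<infinity>\<close> it
        bounds the radii, and it trades volume for \<open>h\<close>-mass in the final
        estimate.\<close>
      have mb: "emeasure lebesgue (ball y r) \<le> ennreal (T ^ Suc i / t) * emeasure ?H (ball y r)"
      proof -
        have "emeasure lebesgue (ball y r) = ennreal (T ^ Suc i / t) * (ennreal (t / T ^ Suc i) * emeasure lebesgue (ball y r))"
          using T l by (simp add: mult.assoc[symmetric] ennreal_mult'[symmetric])
        also have "\<dots> \<le> ennreal (T ^ Suc i / t) * emeasure ?H (ball y r)"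
          using yr by (intro mult_left_mono) auto
        finally show ?thesis .
      qed
      also have "\<dots> \<le> ennreal (T ^ Suc i / t) * ennreal I"
        using Hle by (rule mult_left_mono) auto
      finally have "emeasure lebesgue (ball y r) \<le> ennreal (T ^ Suc i / t * I)"
        using T l I by (subst ennreal_mult') auto
      then show "0 < snd j \<and> snd j \<le> 1 + (T ^ Suc i / t * I) / unit_ball_vol (real DIM('a))"
        using ball_radius_bounded[of r y "T ^ Suc i / t * I"] yr T l I by simp
      show "S i j \<in> sets lebesgue"
        by (auto simp: S_def intro!: sets.Int sets_lebesgue_less)
      have a5: "0 < avg y (5 * r)" using yr by (intro avg_pos) auto
      have scale: "emeasure lebesgue (ball y (5 * r)) = ennreal (5 ^ DIM('a)) * emeasure lebesgue (ball y r)"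
        using yr by (intro emeasure_ball_scale) auto
      \<comment> \<open>For \<open>i > 0\<close>, Chebyshev on the level set of \<open>u\<close>
        followed by reverse Hoelder; the average over the dilate cancels.\<close>
      have Sm: "emeasure lebesgue (S i j) \<le> ennreal (5 ^ DIM('a) * 2 * A / (T ^ i * 2 ^ i)) * emeasure lebesgue (ball y r)"
      proof (cases "i = 0")
        case True
        have "emeasure lebesgue (S i j) = ennreal (5 ^ DIM('a)) * emeasure lebesgue (ball y r)"
          unfolding scale[symmetric] by (simp add: S_def True)
        also have "\<dots> \<le> ennreal (5 ^ DIM('a) * 2 * A / (T ^ i * 2 ^ i)) * emeasure lebesgue (ball y r)"
          using A_ge1 True by (intro mult_right_mono ennreal_leI) auto
        finally show ?thesis .
      next
        case False
        define Z where "Z = ball y (5 * r) \<inter> {x. ennreal (c * T ^ i * avg y (5 * r)) < u x}"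
        have [measurable]: "Z \<in> sets lebesgue" by (auto simp: Z_def intro!: sets.Int sets_lebesgue_less)
        have "ennreal (c * T ^ i * avg y (5 * r)) * emeasure lebesgue Z
            = (\<integral>\<^sup>+x. ennreal (c * T ^ i * avg y (5 * r)) * indicator Z x \<partial>lebesgue)"
          by (simp add: nn_integral_cmult)
        also have "\<dots> \<le> (\<integral>\<^sup>+x. u x * indicator Z x \<partial>lebesgue)"
          by (intro nn_integral_mono) (auto simp: Z_def indicator_def)
        also have "\<dots> = emeasure U Z" by (simp add: emeasure_density)
        also have "\<dots> \<le> ennreal (1 / 2 ^ i) * emeasure U (ball y (5 * r))"
          unfolding Z_def using yr by (intro RH) auto
        also have "\<dots> = ennreal (avg y (5 * r)) * (ennreal (1 / 2 ^ i) * ennreal (5 ^ DIM('a)) * emeasure lebesgue (ball y r))"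
          using yr scale by (simp add: U_ball_eq mult_ac)
        also have "ennreal (c * T ^ i * avg y (5 * r)) * emeasure lebesgue Z
            = ennreal (avg y (5 * r)) * (ennreal (c * T ^ i) * emeasure lebesgue Z)"
          using c T' a5 by (simp add: ennreal_mult' mult_ac)
        finally have *: "ennreal (c * T ^ i) * emeasure lebesgue Z \<le> ennreal (1 / 2 ^ i) * ennreal (5 ^ DIM('a)) * emeasure lebesgue (ball y r)"
          using a5 by (subst (asm) ennreal_mult_le_mult_iff) auto
        have "emeasure lebesgue Z = ennreal (1 / (c * T ^ i)) * (ennreal (c * T ^ i) * emeasure lebesgue Z)"
          using c T' T by (simp add: mult.assoc[symmetric] ennreal_mult'[symmetric])
        also have "\<dots> \<le> ennreal (1 / (c * T ^ i)) * (ennreal (1 / 2 ^ i) * ennreal (5 ^ DIM('a)) * emeasure lebesgue (ball y r))"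
          using * by (rule mult_left_mono) auto
        also have "\<dots> = ennreal (5 ^ DIM('a) * 2 * A / (T ^ i * 2 ^ i)) * emeasure lebesgue (ball y r)"
        proof -
          have "1 / (c * T ^ i) * (1 / 2 ^ i * 5 ^ DIM('a)) = 5 ^ DIM('a) * 2 * A / (T ^ i * 2 ^ i)"
            unfolding c_def by simp
          moreover have "ennreal p * (ennreal q * ennreal s * e) = ennreal (p * (q * s)) * e"
            if "0 \<le> p" "0 \<le> q" "0 \<le> s" for p q s e
            using that by (simp add: ennreal_mult mult.assoc)
          ultimately show ?thesis using c T' by (metis divide_nonneg_nonneg less_imp_le mult_nonneg_nonneg zero_le_one zero_le_numeral zero_le_power)
        qed
        finally show ?thesis using False by (simp add: S_def Z_def)
      qed
      also have "\<dots> \<le> ennreal (5 ^ DIM('a) * 2 * A / (T ^ i * 2 ^ i)) * (ennreal (T ^ Suc i / t) * emeasure ?H (ball y r))"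
        using mb by (rule mult_left_mono) auto
      also have "\<dots> = ennreal (C0 / t / 2 ^ i) * emeasure ?H (ball y r)"
      proof -
        have "5 ^ DIM('a) * 2 * A / (T ^ i * 2 ^ i) * (T ^ Suc i / t) = C0 / t / 2 ^ i"
          using T' l by (simp add: C0_def field_simps)
        then show ?thesis
          using A_ge1 T l by (simp only: mult.assoc[symmetric]) (subst ennreal_mult'[symmetric], auto)
      qed
      finally show "emeasure lebesgue (S i j) \<le> ennreal (C0 / t / 2 ^ i) * emeasure ?H (ball (fst j) (snd j))"
        by simp
    next
      fix x assume "x \<in> X i"
      then obtain y r where yr: "(y, r) \<in> K i" "x \<in> ball y r" "i = 0 \<or> ennreal (T ^ i * avg y r) \<le> u x"
        by (auto simp: X_def)
      have r: "0 < r" using yr by (auto simp: K_def)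
      show "\<exists>j\<in>K i. \<forall>k\<in>K i. ball (fst j) (snd j) \<subseteq> ball (fst k) (5 * snd k) \<longrightarrow> x \<in> S i k"
      proof (intro bexI[of _ "(y, r)"] ballI impI)
        fix k assume k: "k \<in> K i" "ball (fst (y, r)) (snd (y, r)) \<subseteq> ball (fst k) (5 * snd k)"
        obtain z s where [simp]: "k = (z, s)" by (cases k)
        have s: "0 < s" "ball y r \<subseteq> ball z (5 * s)" using k by (auto simp: K_def)
        have "avg z (5 * s) \<le> A * avg y r" using r s by (intro avg_le_subball) auto
        moreover have "0 < avg z (5 * s)" using s by (intro avg_pos) auto
        ultimately have "c * avg z (5 * s) < avg y r"
          using A_ge1 by (simp add: c_def field_simps)
        then have "c * T ^ i * avg z (5 * s) < T ^ i * avg y r"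
          using T by (simp add: mult.left_commute[of c] mult.assoc)
        then have "ennreal (c * T ^ i * avg z (5 * s)) < ennreal (T ^ i * avg y r)"
          using avg_pos[OF r, of y] T by (intro ennreal_lessI) auto
        then show "x \<in> S i k"
          using yr(2,3) s by (auto simp: S_def)
      qed (use yr in auto)
    qed auto
    then obtain Y where Y: "\<And>i. Y i \<in> sets lebesgue" "\<And>i. X i \<subseteq> Y i"
      and mY: "\<And>i. emeasure lebesgue (Y i) \<le> ennreal (C0 / t / 2 ^ i) * emeasure ?H (\<Union>j\<in>K i. ball (fst j) (snd j))"
      by metis
    have "AE x in lebesgue. x \<in> {x. ennreal t < u x * maxfun h x} \<longrightarrow> x \<in> (\<Union>i. Y i)"
      using u_pos u_fin
    proof eventually_elim
      case (elim x)
      show ?case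
      proof
        assume "x \<in> {x. ennreal t < u x * maxfun h x}"
        then have "ennreal t / u x < maxfun h x"
          using elim by (subst divide_less_ennreal) (auto simp: mult.commute)
        then obtain y r where yr: "0 < r" "x \<in> ball y r" "ennreal t / u x * emeasure U (ball y r) < emeasure ?H (ball y r)"
          unfolding less_maxfun_iff by blast
        define a where "a = enn2real (u x)"
        have a: "0 < a" "u x = ennreal a" using elim by (auto simp: a_def enn2real_positive_iff)
        have av: "0 < avg y r" using yr by (intro avg_pos)
        have *: "ennreal (t / a * avg y r) * emeasure lebesgue (ball y r) < emeasure ?H (ball y r)"
          using yr a l av by (subst ennreal_mult') (auto simp: U_ball_eq divide_ennreal mult.assoc)
        have ex: "\<exists>i. a < T ^ Suc i * avg y r"
        proof -
          obtain i where "a / avg y r < T ^ i" using real_arch_pow[OF T1] by blast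
          also have "T ^ i \<le> T ^ Suc i" using T by (intro power_increasing) auto
          finally show ?thesis using av by (auto simp: field_simps)
        qed
        \<comment> \<open>Minimality supplies the lower bound: for \<open>i > 0\<close> the
          predecessor of \<open>i\<close> violates the condition.\<close>
        define i where "i = (LEAST i. a < T ^ Suc i * avg y r)"
        have i: "a < T ^ Suc i * avg y r" unfolding i_def by (rule LeastI_ex[OF ex])
        have i': "i = 0 \<or> T ^ i * avg y r \<le> a"
        proof (cases i)
          case (Suc j)
          then have "\<not> a < T ^ Suc j * avg y r" unfolding i_def using not_less_Least by (metis lessI)
          with Suc show ?thesis by simp
        qed simp
        have "t / T ^ Suc i \<le> t / a * avg y r"
          using i a l T by (simp add: field_simps)
        then have "ennreal (t / T ^ Suc i) * emeasure lebesgue (ball y r) \<le> ennreal (t / a * avg y r) * emeasure lebesgue (ball y r)"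
          by (intro mult_right_mono ennreal_leI) auto
        also note *
        finally have "(y, r) \<in> K i" using yr by (auto simp: K_def)
        moreover have "i = 0 \<or> ennreal (T ^ i * avg y r) \<le> u x" using i' a by (auto intro: ennreal_leI)
        ultimately have "x \<in> X i" using yr unfolding X_def by blast
        then show "x \<in> (\<Union>i. Y i)" using Y by blast
      qed
    qed
    then have "emeasure lebesgue {x. ennreal t < u x * maxfun h x} \<le> emeasure lebesgue (\<Union>i. Y i)"
      using Y by (intro emeasure_mono_AE) auto
    also have "\<dots> \<le> (\<Sum>i. emeasure lebesgue (Y i))"
      using Y by (intro emeasure_subadditive_countably) auto
    also have "\<dots> \<le> (\<Sum>i. ennreal (C0 / t * I * (1 / 2) ^ i))"
    proof (intro suminf_le allI)
      fix i
      note mY[of i]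
      also have "ennreal (C0 / t / 2 ^ i) * emeasure ?H (\<Union>j\<in>K i. ball (fst j) (snd j)) \<le> ennreal (C0 / t / 2 ^ i) * ennreal I"
        using Hle by (rule mult_left_mono) auto
      also have "\<dots> = ennreal (C0 / t * I * (1 / 2) ^ i)"
        using C0 l I by (simp add: ennreal_mult'[symmetric] power_one_over mult_ac)
      finally show "emeasure lebesgue (Y i) \<le> ennreal (C0 / t * I * (1 / 2) ^ i)" .
    qed auto
    also have "\<dots> = ennreal (C0 / t * I * 2)"
    proof (rule suminf_ennreal_eq)
      show "(\<lambda>i. C0 / t * I * (1 / 2) ^ i) sums (C0 / t * I * 2)"
        using geometric_sums[of "1/2::real"] by (intro sums_mult) auto
    qed (use C0 l I in auto)
    finally have "ennreal t * emeasure lebesgue {x. ennreal t < u x * maxfun h x} \<le> ennreal t * ennreal (C0 / t * I * 2)"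
      by (rule mult_left_mono) auto
    also have "\<dots> = ennreal (2 * C0) * (\<integral>\<^sup>+x. h x \<partial>lebesgue)"
      using C0 l I by (simp add: ennreal_mult'[symmetric] ennreal_mult''[symmetric] mult_ac)
    finally show ?thesis .
  qed
  show thesis
    by (rule that[of "2 * C0"]) (use C0 main in auto)
qed

end

section \<open>Localisation of the mixed estimate, and properties of the majorant\<close>

lemma markov_on_set:
  fixes g :: "'a::euclidean_space \<Rightarrow> ennreal"
  assumes [measurable]: "g \<in> borel_measurable lebesgue" "S \<in> sets lebesgue"
  shows "t * emeasure lebesgue (S \<inter> {x. t < g x}) \<le> emeasure (density lebesgue g) S"
proof -
  have [measurable]: "S \<inter> {x. t < g x} \<in> sets lebesgue"
    by (intro sets.Int sets_lebesgue_less) auto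
  have "t * emeasure lebesgue (S \<inter> {x. t < g x}) = (\<integral>\<^sup>+x. t * indicator (S \<inter> {x. t < g x}) x \<partial>lebesgue)"
    by (simp add: nn_integral_cmult)
  also have "\<dots> \<le> (\<integral>\<^sup>+x. g x * indicator S x \<partial>lebesgue)"
    by (intro nn_integral_mono) (auto simp: indicator_def)
  also have "\<dots> = emeasure (density lebesgue g) S" by (simp add: emeasure_density)
  finally show ?thesis .
qed

lemma ennreal_mult_divide_le: "(a::ennreal) * (b / a) \<le> b"
proof (cases "a = 0 \<or> a = \<infinity>")
  case True
  then show ?thesis by auto
next
  case False
  then show ?thesis
    using mult_divide_eq_ennreal[of a b] by (simp add: ennreal_times_divide mult.commute)
qed

context A1_weight
begin

lemma U_ball_le_subset:
  assumes r: "0 < r" and S: "S \<in> sets lebesgue" "S \<subseteq> ball x r"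
    and q: "0 < q" "emeasure lebesgue (ball x r) \<le> ennreal q * emeasure lebesgue S"
  shows "emeasure U (ball x r) \<le> ennreal (A * q) * emeasure U S"
proof -
  have pos: "emeasure lebesgue S \<noteq> 0"
    using q(2) emeasure_ball_pos_finite(1)[OF r, of x] by auto
  have "emeasure lebesgue S \<le> emeasure lebesgue (ball x r)" using S by (intro emeasure_mono) auto
  then have fin: "emeasure lebesgue S \<noteq> \<infinity>"
    using emeasure_ball_pos_finite(2)[OF r, of x] by (auto simp: top_unique)
  have "emeasure lebesgue S * emeasure U (ball x r) = emeasure U (ball x r) * emeasure lebesgue S"
    by (rule mult.commute)
  also have "\<dots> \<le> ennreal A * emeasure U S * emeasure lebesgue (ball x r)"
    using r S by (rule A1_subset)
  also have "\<dots> \<le> ennreal A * emeasure U S * (ennreal q * emeasure lebesgue S)"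
    using q by (intro mult_left_mono) auto
  also have "\<dots> = emeasure lebesgue S * (ennreal (A * q) * emeasure U S)"
    using q A_ge1 by (simp add: ennreal_mult mult_ac)
  finally show ?thesis
    using pos fin by (subst (asm) ennreal_mult_le_mult_iff) auto
qed

text \<open>With \<open>h / u\<close> built into the maximum, \<open>h \<le> u * majorant h\<close>
  holds almost everywhere without any differentiation of integrals.\<close>

definition majorant :: "('a \<Rightarrow> ennreal) \<Rightarrow> 'a \<Rightarrow> ennreal" where
  "majorant h x = max (maxfun h x) (h x / u x)"

lemma majorant_measurable[measurable]:
  assumes [measurable]: "h \<in> borel_measurable lebesgue"
  shows "majorant h \<in> borel_measurable lebesgue"
  unfolding majorant_def by measurable

text \<open>Split by what produces the majorant at \<open>x \<in> Q\<close>. Balls of radius at most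
  \<open>R\<close> see only the part of \<open>h\<close> on \<open>ball z (3 * R)\<close>;
  \<open>mixed_weak_type\<close> applies to it, and its mass is at most \<open>maxfun h y\<close>
  times the \<open>U\<close>-mass of that ball. Larger balls contain \<open>y\<close> after
  tripling, so they contribute at most \<open>D * maxfun h y\<close>. The term \<open>h / u\<close>
  leaves Chebyshev for \<open>h\<close>. Since \<open>y\<close> is free, it can be taken near the
  infimum of \<open>maxfun h\<close> over \<open>Q\<close>.\<close>

lemma mixed_weak_type_local:
  assumes q: "0 < q"
  obtains C where "0 < C" and "\<And>(h :: 'a \<Rightarrow> ennreal) z R Q t y. h \<in> borel_measurable lebesgue \<Longrightarrow> 0 < R \<Longrightarrow>
    Q \<in> sets lebesgue \<Longrightarrow> Q \<subseteq> ball z R \<Longrightarrow> emeasure lebesgue (ball z R) \<le> ennreal q * emeasure lebesgue Q \<Longrightarrow>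
    0 < t \<Longrightarrow> y \<in> Q \<Longrightarrow>
    ennreal t * emeasure lebesgue (Q \<inter> {x. ennreal t < u x * majorant h x})
      \<le> ennreal C * (maxfun h y * emeasure U Q)"
proof -
  obtain C1 where C1: "0 < C1" and mw: "\<And>(h :: 'a \<Rightarrow> ennreal) t. h \<in> borel_measurable lebesgue \<Longrightarrow> 0 < t \<Longrightarrow>
    ennreal t * emeasure lebesgue {x. ennreal t < u x * maxfun h x} \<le> ennreal C1 * (\<integral>\<^sup>+x. h x \<partial>lebesgue)"
    using mixed_weak_type by blast
  define D where "D = A * 3 ^ DIM('a)"
  have D: "0 < D" using A_ge1 by (simp add: D_def)
  \<comment> \<open>\<open>C1\<close> belongs to the local part and 1 to the term
    \<open>h / u\<close>, both measured by the mass of \<open>h\<close> on \<open>B\<close>; the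
    last \<open>D\<close> belongs to the large balls.\<close>
  define C where "C = (C1 + 1) * (D * (A * q)) + D"
  have C: "0 < C" using C1 D q A_ge1 by (simp add: C_def add_pos_pos)
  have "ennreal t * emeasure lebesgue (Q \<inter> {x. ennreal t < u x * majorant h x}) \<le> ennreal C * (maxfun h y * emeasure U Q)"
    if [measurable]: "h \<in> borel_measurable lebesgue" and R: "0 < R" and Q[measurable]: "Q \<in> sets lebesgue"
      and QB: "Q \<subseteq> ball z R" and qQ: "emeasure lebesgue (ball z R) \<le> ennreal q * emeasure lebesgue Q"
      and t: "0 < t" and y: "y \<in> Q" for h :: "'a \<Rightarrow> ennreal" and z R Q t y
  proof -
    let ?H = "density lebesgue h"
    define B where "B = ball z (3 * R)"
    have [measurable]: "B \<in> sets lebesgue" by (simp add: B_def)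
    define h1 where "h1 x = h x * indicator B x" for x
    have [measurable]: "h1 \<in> borel_measurable lebesgue" unfolding h1_def by measurable
    have QB': "Q \<subseteq> B" using QB R unfolding B_def by (auto simp: subset_iff)
    have HB: "emeasure ?H B \<le> ennreal (D * (A * q)) * (maxfun h y * emeasure U Q)"
    proof -
      have "emeasure U B \<le> ennreal D * emeasure U (ball z R)"
        unfolding B_def D_def using R by (intro doubling) auto
      also have "\<dots> \<le> ennreal D * (ennreal (A * q) * emeasure U Q)"
        using R Q QB q qQ by (intro mult_left_mono U_ball_le_subset) auto
      finally have UB: "emeasure U B \<le> ennreal D * (ennreal (A * q) * emeasure U Q)" .
      have "emeasure ?H B \<le> maxfun h y * emeasure U B"
        unfolding B_def using R y QB' by (intro le_maxfun) (auto simp: B_def)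
      also have "\<dots> \<le> maxfun h y * (ennreal D * (ennreal (A * q) * emeasure U Q))"
        using UB by (rule mult_left_mono) auto
      also have "\<dots> = ennreal (D * (A * q)) * (maxfun h y * emeasure U Q)"
        using D A_ge1 q by (simp add: ennreal_mult mult_ac)
      finally show ?thesis .
    qed
    define X1 where "X1 = {x. ennreal t < u x * maxfun h1 x}"
    define X2 where "X2 = Q \<inter> {x. ennreal t < u x * (ennreal D * maxfun h y)}"
    define X3 where "X3 = Q \<inter> {x. ennreal t < h x}"
    have [measurable]: "X1 \<in> sets lebesgue" "X2 \<in> sets lebesgue" "X3 \<in> sets lebesgue"
      unfolding X1_def X2_def X3_def by (auto intro!: sets.Int sets_lebesgue_less)
    have b1: "ennreal t * emeasure lebesgue X1 \<le> ennreal C1 * emeasure ?H B"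
    proof -
      have "ennreal t * emeasure lebesgue X1 \<le> ennreal C1 * (\<integral>\<^sup>+x. h1 x \<partial>lebesgue)"
        unfolding X1_def using t by (intro mw) auto
      also have "(\<integral>\<^sup>+x. h1 x \<partial>lebesgue) = emeasure ?H B"
        by (simp add: emeasure_density h1_def)
      finally show ?thesis .
    qed
    have b2: "ennreal t * emeasure lebesgue X2 \<le> ennreal D * (maxfun h y * emeasure U Q)"
    proof -
      have "ennreal t * emeasure lebesgue X2 \<le> emeasure (density lebesgue (\<lambda>x. u x * (ennreal D * maxfun h y))) Q"
        unfolding X2_def by (rule markov_on_set) auto
      also have "\<dots> = (\<integral>\<^sup>+x. (ennreal D * maxfun h y) * (u x * indicator Q x) \<partial>lebesgue)"
        by (simp add: emeasure_density mult_ac)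
      also have "\<dots> = ennreal D * (maxfun h y * emeasure U Q)"
        by (subst nn_integral_cmult) (auto simp: emeasure_density mult_ac)
      finally show ?thesis .
    qed
    have b3: "ennreal t * emeasure lebesgue X3 \<le> emeasure ?H B"
    proof -
      have "ennreal t * emeasure lebesgue X3 \<le> emeasure ?H Q"
        unfolding X3_def by (rule markov_on_set) auto
      also have "\<dots> \<le> emeasure ?H B" using QB' by (intro emeasure_mono) auto
      finally show ?thesis .
    qed
    have "Q \<inter> {x. ennreal t < u x * majorant h x} \<subseteq> (X1 \<union> X2) \<union> X3"
    proof
      fix x assume "x \<in> Q \<inter> {x. ennreal t < u x * majorant h x}"
      then have x: "x \<in> Q" "ennreal t < u x * majorant h x" by auto
      show "x \<in> X1 \<union> X2 \<union> X3"
      proof (cases "maxfun h x \<le> h x / u x")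
        case True
        then have "ennreal t < u x * (h x / u x)" using x by (simp add: majorant_def max_def)
        also have "\<dots> \<le> h x" by (rule ennreal_mult_divide_le)
        finally show ?thesis using x by (simp add: X3_def)
      next
        case False
        then have tx: "ennreal t < u x * maxfun h x" using x by (simp add: majorant_def max_def split: if_splits)
        show ?thesis
        proof (rule ccontr)
          assume "x \<notin> X1 \<union> X2 \<union> X3"
          then have nx: "u x * maxfun h1 x \<le> ennreal t" "u x * (ennreal D * maxfun h y) \<le> ennreal t"
            using x by (auto simp: X1_def X2_def not_less)
          have "maxfun h x \<le> max (maxfun h1 x) (ennreal D * maxfun h y)"
          proof (rule ccontr)
            define a where "a = max (maxfun h1 x) (ennreal D * maxfun h y)"
            assume "\<not> maxfun h x \<le> max (maxfun h1 x) (ennreal D * maxfun h y)"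
            then have "a < maxfun h x" by (simp add: a_def not_le)
            then obtain w r where wr: "0 < r" "x \<in> ball w r" "a * emeasure U (ball w r) < emeasure ?H (ball w r)"
              unfolding less_maxfun_iff by blast
            have xR: "dist z x < R" "dist z y < R" using x y QB by (auto simp: subset_iff)
            show False
            proof (cases "r \<le> R")
              case True
              have "ball w r \<subseteq> B"
              proof
                fix v assume "v \<in> ball w r"
                then have "dist w v < r" "dist w x < r" using wr by auto
                moreover have "dist z v \<le> dist z x + dist w x + dist w v"
                  using dist_triangle[of z v x] dist_triangle[of x v w] by (simp add: dist_commute)
                ultimately show "v \<in> B" using xR True by (auto simp: B_def)
              qed
              then have "emeasure ?H (ball w r) = emeasure (density lebesgue h1) (ball w r)"
                by (auto simp: emeasure_density h1_def indicator_def intro!: nn_integral_cong)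
              also have "\<dots> \<le> maxfun h1 x * emeasure U (ball w r)"
                using wr by (intro le_maxfun) auto
              also have "\<dots> \<le> a * emeasure U (ball w r)"
                by (intro mult_right_mono) (auto simp: a_def)
              finally show False using wr by simp
            next
              case False
              have "dist w y \<le> dist w x + dist z x + dist z y"
                using dist_triangle[of w y x] dist_triangle[of x y z] by (simp add: dist_commute)
              then have yw: "y \<in> ball w (3 * r)" using xR wr False by auto
              have "emeasure ?H (ball w r) \<le> emeasure ?H (ball w (3 * r))"
                using wr by (intro emeasure_mono) auto
              also have "\<dots> \<le> maxfun h y * emeasure U (ball w (3 * r))"
                using wr yw by (intro le_maxfun) auto
              also have "\<dots> \<le> maxfun h y * (ennreal D * emeasure U (ball w r))"
                unfolding D_def using wr by (intro mult_left_mono doubling) auto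
              also have "\<dots> = ennreal D * maxfun h y * emeasure U (ball w r)"
                by (simp add: mult_ac)
              also have "\<dots> \<le> a * emeasure U (ball w r)"
                by (intro mult_right_mono) (auto simp: a_def)
              finally show False using wr by simp
            qed
          qed
          then have "u x * maxfun h x \<le> u x * max (maxfun h1 x) (ennreal D * maxfun h y)"
            by (rule mult_left_mono) auto
          also have "\<dots> \<le> ennreal t" using nx by (simp add: max_def)
          finally show False using tx by simp
        qed
      qed
    qed
    then have "emeasure lebesgue (Q \<inter> {x. ennreal t < u x * majorant h x}) \<le> emeasure lebesgue ((X1 \<union> X2) \<union> X3)"
      by (intro emeasure_mono) auto
    also have "\<dots> \<le> emeasure lebesgue (X1 \<union> X2) + emeasure lebesgue X3"
      by (intro emeasure_subadditive) auto
    also have "emeasure lebesgue (X1 \<union> X2) \<le> emeasure lebesgue X1 + emeasure lebesgue X2"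
      by (intro emeasure_subadditive) auto
    finally have "ennreal t * emeasure lebesgue (Q \<inter> {x. ennreal t < u x * majorant h x})
        \<le> ennreal t * emeasure lebesgue X1 + ennreal t * emeasure lebesgue X2 + ennreal t * emeasure lebesgue X3"
      unfolding distrib_left[symmetric] by (intro mult_left_mono) (auto intro: add_right_mono)
    also have "\<dots> \<le> ennreal C1 * emeasure ?H B + ennreal D * (maxfun h y * emeasure U Q) + emeasure ?H B"
      by (intro add_mono b1 b2 b3)
    also have "\<dots> = ennreal (C1 + 1) * emeasure ?H B + ennreal D * (maxfun h y * emeasure U Q)"
      using C1 by (simp add: distrib_right add_ac)
    also have "\<dots> \<le> ennreal (C1 + 1) * (ennreal (D * (A * q)) * (maxfun h y * emeasure U Q)) + ennreal D * (maxfun h y * emeasure U Q)"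
      by (intro add_right_mono mult_left_mono HB) auto
    also have "\<dots> = ennreal C * (maxfun h y * emeasure U Q)"
    proof -
      have "ennreal C = ennreal (C1 + 1) * ennreal (D * (A * q)) + ennreal D"
        using C1 D A_ge1 q unfolding C_def by (subst ennreal_plus) (auto simp: ennreal_mult')
      then show ?thesis by (simp only: distrib_right mult.assoc)
    qed
    finally show ?thesis .
  qed
  with C that show thesis by blast
qed

lemma majorant_weak_type:
  fixes h :: "'a \<Rightarrow> ennreal"
  assumes [measurable]: "h \<in> borel_measurable lebesgue" and \<mu>: "0 < \<mu>"
  shows "ennreal \<mu> * emeasure U {x. ennreal \<mu> < majorant h x}
    \<le> ennreal (A * 5 ^ DIM('a) + 1) * (\<integral>\<^sup>+x. h x \<partial>lebesgue)"
proof -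
  define X1 where "X1 = {x. ennreal \<mu> < maxfun h x}"
  define X2 where "X2 = {x. ennreal \<mu> < h x / u x}"
  have [measurable]: "X1 \<in> sets lebesgue" "X2 \<in> sets lebesgue"
    unfolding X1_def X2_def by (auto intro!: sets_lebesgue_less)
  have "ennreal \<mu> * emeasure U X2 = (\<integral>\<^sup>+x. ennreal \<mu> * (u x * indicator X2 x) \<partial>lebesgue)"
    by (subst nn_integral_cmult) (auto simp: emeasure_density)
  also have "\<dots> \<le> (\<integral>\<^sup>+x. h x \<partial>lebesgue)"
    using u_pos u_fin
  proof (intro nn_integral_mono_AE, eventually_elim)
    case (elim x)
    then show ?case
      by (auto simp: X2_def indicator_def ennreal_less_divide_iff)
  qed
  finally have b2: "ennreal \<mu> * emeasure U X2 \<le> (\<integral>\<^sup>+x. h x \<partial>lebesgue)" .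
  have b1: "ennreal \<mu> * emeasure U X1 \<le> ennreal (A * 5 ^ DIM('a)) * (\<integral>\<^sup>+x. h x \<partial>lebesgue)"
    unfolding X1_def using \<mu> by (intro maxfun_weak_type) auto
  have "{x. ennreal \<mu> < majorant h x} = X1 \<union> X2"
    by (auto simp: majorant_def X1_def X2_def less_max_iff_disj)
  then have "ennreal \<mu> * emeasure U {x. ennreal \<mu> < majorant h x} \<le> ennreal \<mu> * (emeasure U X1 + emeasure U X2)"
    by (auto intro!: mult_left_mono emeasure_subadditive)
  also have "\<dots> \<le> ennreal (A * 5 ^ DIM('a)) * (\<integral>\<^sup>+x. h x \<partial>lebesgue) + (\<integral>\<^sup>+x. h x \<partial>lebesgue)"
    unfolding distrib_left by (intro add_mono b1 b2)
  also have "\<dots> = ennreal (A * 5 ^ DIM('a) + 1) * (\<integral>\<^sup>+x. h x \<partial>lebesgue)"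
    using A_ge1 by (simp add: distrib_right)
  finally show ?thesis .
qed

text \<open>Large \<open>\<mu>\<close> in the weak type bound; \<open>U\<close>-null sets are
  Lebesgue null because \<open>u > 0\<close> almost everywhere.\<close>

lemma majorant_finite:
  fixes h :: "'a \<Rightarrow> ennreal"
  assumes [measurable]: "h \<in> borel_measurable lebesgue" and fin: "(\<integral>\<^sup>+x. h x \<partial>lebesgue) < \<infinity>"
  shows "AE x in lebesgue. majorant h x < \<infinity>"
proof -
  define X where "X = {x. majorant h x = \<infinity>}"
  have "X = {x \<in> space lebesgue. majorant h x = \<infinity>}" by (simp add: X_def)
  also have "\<dots> \<in> sets lebesgue" by measurable
  finally have [measurable]: "X \<in> sets lebesgue" .
  define I where "I = enn2real (\<integral>\<^sup>+x. h x \<partial>lebesgue)"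
  have I: "0 \<le> I" "(\<integral>\<^sup>+x. h x \<partial>lebesgue) = ennreal I"
    using fin by (auto simp: I_def less_top)
  define c where "c = (A * 5 ^ DIM('a) + 1) * I"
  have c: "0 \<le> c" using I A_ge1 by (simp add: c_def)
  have le: "ennreal \<mu> * emeasure U X \<le> ennreal c" if "0 < \<mu>" for \<mu>
  proof -
    have "ennreal \<mu> * emeasure U X \<le> ennreal \<mu> * emeasure U {x. ennreal \<mu> < majorant h x}"
      by (intro mult_left_mono emeasure_mono) (auto simp: X_def intro!: sets_lebesgue_less)
    also have "\<dots> \<le> ennreal (A * 5 ^ DIM('a) + 1) * (\<integral>\<^sup>+x. h x \<partial>lebesgue)"
      using that by (intro majorant_weak_type) auto
    also have "\<dots> = ennreal c" using I A_ge1 by (simp add: c_def ennreal_mult)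
    finally show ?thesis .
  qed
  have "emeasure U X = 0"
  proof (rule ccontr)
    assume ne: "emeasure U X \<noteq> 0"
    have "emeasure U X \<noteq> \<infinity>"
      using le[of 1] by (auto simp: top_unique)
    then obtain a where a: "0 < a" "emeasure U X = ennreal a"
      using ne by (cases "emeasure U X") (auto simp: less_le)
    have "ennreal ((c + 1) / a) * emeasure U X = ennreal (c + 1)"
      using a c by (simp add: ennreal_mult'[symmetric])
    then have "ennreal (c + 1) \<le> ennreal c" using le[of "(c + 1) / a"] a c by simp
    then show False using c by (simp add: ennreal_le_iff)
  qed
  then have "X \<in> null_sets lebesgue"
    using U_eq_0_imp[of X] by auto
  then have "AE x in lebesgue. x \<notin> X" by (rule AE_not_in)
  then show ?thesis by eventually_elim (auto simp: X_def less_top)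
qed

text \<open>The balls around \<open>x\<close> exhaust the space, so one of them carries mass. This
  works at every point, not only almost everywhere.\<close>

lemma maxfun_pos:
  fixes h :: "'a \<Rightarrow> ennreal"
  assumes [measurable]: "h \<in> borel_measurable lebesgue" and pos: "0 < (\<integral>\<^sup>+x. h x \<partial>lebesgue)"
  shows "0 < maxfun h x"
proof -
  have "(\<Union>n. ball x (real (Suc n))) = UNIV"
  proof (intro set_eqI iffI UNIV_I)
    fix y
    obtain n where "dist x y < real n" using reals_Archimedean2 by blast
    then show "y \<in> (\<Union>n. ball x (real (Suc n)))" by (intro UN_I[of n]) auto
  qed
  moreover have "(SUP n. emeasure (density lebesgue h) (ball x (real (Suc n))))
      = emeasure (density lebesgue h) (\<Union>n. ball x (real (Suc n)))"
    by (rule SUP_emeasure_incseq) (auto simp: incseq_def)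
  ultimately have "(SUP n. emeasure (density lebesgue h) (ball x (real (Suc n)))) = (\<integral>\<^sup>+x. h x \<partial>lebesgue)"
    by (simp add: emeasure_density)
  with pos have "0 < (SUP n. emeasure (density lebesgue h) (ball x (real (Suc n))))"
    by (simp only:)
  then obtain n where "0 < emeasure (density lebesgue h) (ball x (real (Suc n)))"
    unfolding less_SUP_iff by blast
  then show ?thesis
    unfolding less_maxfun_iff by (intro exI[of _ x] exI[of _ "real (Suc n)"]) auto
qed

lemma le_mult_majorant: "AE x in lebesgue. h x \<le> u x * majorant h x"
  using u_pos u_fin
proof eventually_elim
  case (elim x)
  then have "h x = u x * (h x / u x)"
    using mult_divide_eq_ennreal[of "u x" "h x"] by (simp add: ennreal_times_divide mult.commute)
  also have "\<dots> \<le> u x * majorant h x"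
    by (intro mult_left_mono) (auto simp: majorant_def)
  finally show ?case .
qed

end

section \<open>Weights of endpoint type\<close>

lemma ennpow_mono:
  assumes "x \<le> y" "0 \<le> a"
  shows "ennpow x a \<le> ennpow y a"
proof (cases "y = \<infinity>")
  case False
  then have "x \<noteq> \<infinity>" "enn2real x \<le> enn2real y"
    using assms by (auto simp: top_unique enn2real_mono less_top)
  then show ?thesis
    using False assms by (auto simp: ennpow_def intro!: ennreal_leI powr_mono2)
qed (simp add: ennpow_def)

lemma ennpow_ennreal: "0 \<le> x \<Longrightarrow> ennpow (ennreal x) a = ennreal (x powr a)"
  by (simp add: ennpow_def)

lemma cubeE:
  fixes Q :: "(real ^ 'n) set"
  assumes "Q \<in> cubes"
  obtains a l where "0 < l" "Q = cbox a (\<chi> i. a $ i + l)" "Q \<in> sets lebesgue"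
    "emeasure lebesgue Q = ennreal (l ^ CARD('n))" "measure lebesgue Q = l ^ CARD('n)"
proof -
  obtain a l where al: "Q = cbox a (\<chi> i. a $ i + l)" "0 < (l::real)"
    using assms unfolding cubes_def by auto
  have ne: "cbox a (\<chi> i. a $ i + l) \<noteq> {}"
    using al by (auto simp: mem_box_cart interval_ne_empty_cart)
  have "measure lebesgue Q = l ^ CARD('n)"
    using ne content_cbox_cart[OF ne] al by simp
  moreover from this have "emeasure lebesgue Q = ennreal (l ^ CARD('n))"
    using al emeasure_eq_ennreal_measure[of lebesgue Q] emeasure_lborel_cbox_finite[of a "\<chi> i. a $ i + l"]
    by (simp add: less_top)
  ultimately show thesis using al that by auto
qed

locale endpoint_weights =
  fixes m :: nat and v :: "nat \<Rightarrow> real ^ 'n \<Rightarrow> real"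
  assumes m: "1 \<le> m" and v: "A_endpoint m v"
begin

definition \<nu> :: "real ^ 'n \<Rightarrow> real" where "\<nu> x = (\<Prod>i\<in>{1..m}. v i x powr (1 / real m))"

lemma v_measurable[measurable]: "i \<in> {1..m} \<Longrightarrow> v i \<in> borel_measurable lebesgue"
  using v by (auto simp: A_endpoint_iff weight_def)

lemma v_pos: "AE x in lebesgue. \<forall>i\<in>{1..m}. 0 < v i x"
  using v by (intro AE_finite_allI) (auto simp: A_endpoint_iff weight_def)

lemma \<nu>_measurable[measurable]: "\<nu> \<in> borel_measurable lebesgue"
  unfolding \<nu>_def[abs_def] by measurable

lemma \<nu>_nonneg: "0 \<le> \<nu> x"
  unfolding \<nu>_def by (intro prod_nonneg) auto

lemma \<nu>_pos: "AE x in lebesgue. 0 < \<nu> x"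
  using v_pos by eventually_elim (auto simp: \<nu>_def intro!: prod_pos)

abbreviation S :: "nat \<Rightarrow> (real ^ 'n) set \<Rightarrow> ennreal" where
  "S i Q \<equiv> esssup (restrict_space lebesgue Q) (\<lambda>x. ennreal (inverse (v i x)))"

lemma S_AE:
  assumes "Q \<in> sets lebesgue"
  shows "AE x in lebesgue. x \<in> Q \<longrightarrow> ennreal (inverse (v i x)) \<le> S i Q"
  using esssup_AE[where M = "restrict_space lebesgue Q" and f = "\<lambda>x. ennreal (inverse (v i x))"] assms
  by (simp add: AE_restrict_space_iff)

lemma not_AE_not_in:
  assumes "Q \<in> sets lebesgue" "emeasure lebesgue Q \<noteq> 0"
  shows "\<not> (AE x in lebesgue. x \<notin> Q)"
  using assms AE_iff_null_sets[of Q lebesgue] by auto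

lemma S_pos:
  assumes Q: "Q \<in> sets lebesgue" "emeasure lebesgue Q \<noteq> 0" and i: "i \<in> {1..m}"
  shows "0 < S i Q"
proof (rule ccontr)
  assume "\<not> 0 < S i Q"
  then have "S i Q = 0" by simp
  from S_AE[OF Q(1), of i] v_pos have "AE x in lebesgue. x \<notin> Q"
  proof eventually_elim
    case (elim x)
    then show ?case using i \<open>S i Q = 0\<close> by (force simp: ennreal_eq_0_iff)
  qed
  with not_AE_not_in[OF Q] show False by simp
qed

definition c0 :: real where
  "c0 = enn2real (SUP Q\<in>cubes.
        ennpow ((\<integral>\<^sup>+ x\<in>Q. ennreal (\<nu> x) \<partial>lebesgue) / emeasure lebesgue Q) (real m)
        * (\<Prod>i\<in>{1..m}. S i Q))"

text \<open>Since \<open>0 * \<infinity> = 0\<close> in \<open>ennreal\<close>, a finite product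
  bounds its factors only once they are all known to be nonzero; positivity of the weights on a cube
  of positive measure gives that, and afterwards everything can be expressed in reals.\<close>

lemma cube_bound:
  assumes Q: "Q \<in> cubes"
  obtains a s where "0 < a" "\<And>i. i \<in> {1..m} \<Longrightarrow> 0 < s i" "\<And>i. i \<in> {1..m} \<Longrightarrow> S i Q = ennreal (s i)"
    "emeasure (density lebesgue (\<lambda>x. ennreal (\<nu> x))) Q = ennreal a * emeasure lebesgue Q"
    "a ^ m * (\<Prod>i\<in>{1..m}. s i) \<le> c0"
proof -
  obtain l where l: "0 < (l::real)" and Qs[measurable]: "Q \<in> sets lebesgue" and mQ: "emeasure lebesgue Q = ennreal (l ^ CARD('n))"
    using cubeE[OF Q] by metis
  have mQ0: "emeasure lebesgue Q \<noteq> 0" using mQ l by simp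
  let ?U = "density lebesgue (\<lambda>x. ennreal (\<nu> x))"
  have fin: "(SUP Q\<in>cubes.
        ennpow ((\<integral>\<^sup>+ x\<in>Q. ennreal (\<nu> x) \<partial>lebesgue) / emeasure lebesgue Q) (real m)
        * (\<Prod>i\<in>{1..m}. S i Q)) < \<infinity>"
    using v unfolding A_endpoint_iff \<nu>_def by simp
  have "ennpow ((\<integral>\<^sup>+ x\<in>Q. ennreal (\<nu> x) \<partial>lebesgue) / emeasure lebesgue Q) (real m) * (\<Prod>i\<in>{1..m}. S i Q) \<le> ennreal c0"
    unfolding c0_def using fin by (subst ennreal_enn2real) (auto simp only: infinity_ennreal_def intro!: SUP_upper[OF Q])
  then have le: "ennpow (emeasure ?U Q / emeasure lebesgue Q) (real m) * (\<Prod>i\<in>{1..m}. S i Q) \<le> ennreal c0"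
    by (simp add: emeasure_density)
  have Upos: "emeasure ?U Q \<noteq> 0"
  proof
    assume "emeasure ?U Q = 0"
    then have "AE x in lebesgue. ennreal (\<nu> x) * indicator Q x = 0"
      by (simp add: emeasure_density nn_integral_0_iff_AE)
    with \<nu>_pos have "AE x in lebesgue. x \<notin> Q"
      by eventually_elim (auto simp: indicator_def ennreal_eq_0_iff split: if_splits)
    with not_AE_not_in[OF Qs mQ0] show False by simp
  qed
  have Spos: "S i Q \<noteq> 0" if "i \<in> {1..m}" for i
    using S_pos[OF Qs mQ0 that] by simp
  have Sprod: "(\<Prod>i\<in>{1..m}. S i Q) \<noteq> 0"
    using Spos by (simp add: prod_zero_iff)
  have Ufin: "emeasure ?U Q \<noteq> \<infinity>"
  proof
    assume "emeasure ?U Q = \<infinity>"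
    then have "emeasure ?U Q / emeasure lebesgue Q = \<infinity>"
      using mQ by (simp add: ennreal_top_divide)
    with le Sprod show False by (simp add: ennpow_def ennreal_top_mult top_unique)
  qed
  define a where "a = enn2real (emeasure ?U Q) / l ^ CARD('n)"
  have Ua: "emeasure ?U Q = ennreal (enn2real (emeasure ?U Q))" and "0 < enn2real (emeasure ?U Q)"
    using Upos Ufin by (auto simp: less_top enn2real_positive_iff zero_less_iff_neq_zero)
  then have a: "0 < a" using l by (simp add: a_def)
  have Ua': "emeasure ?U Q = ennreal a * emeasure lebesgue Q"
    unfolding mQ using l a by (subst Ua) (simp add: a_def ennreal_mult'[symmetric])
  have "emeasure ?U Q / emeasure lebesgue Q = ennreal a"
    unfolding mQ using l by (subst Ua) (simp add: a_def divide_ennreal)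
  then have le2: "ennreal (a ^ m) * (\<Prod>i\<in>{1..m}. S i Q) \<le> ennreal c0"
    using le a m by (simp add: ennpow_ennreal powr_realpow)
  have Sprodfin: "(\<Prod>i\<in>{1..m}. S i Q) \<noteq> \<infinity>"
    using le2 a by (auto simp: ennreal_mult_top top_unique)
  have Sfin: "S i Q \<noteq> \<infinity>" if i: "i \<in> {1..m}" for i
  proof
    assume "S i Q = \<infinity>"
    then have "(\<Prod>j\<in>{1..m}. S j Q) = \<infinity> * (\<Prod>j\<in>{1..m} - {i}. S j Q)"
      using i by (subst prod.remove[of _ i]) auto
    moreover have "(\<Prod>j\<in>{1..m} - {i}. S j Q) \<noteq> 0"
      using Spos by (simp add: prod_zero_iff)
    ultimately show False using Sprodfin by (simp add: ennreal_top_mult)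
  qed
  define s where "s i = enn2real (S i Q)" for i
  have s: "0 < s i" "S i Q = ennreal (s i)" if "i \<in> {1..m}" for i
    using Spos[OF that] Sfin[OF that] by (auto simp: s_def less_top enn2real_positive_iff zero_less_iff_neq_zero)
  have "(\<Prod>i\<in>{1..m}. S i Q) = (\<Prod>i\<in>{1..m}. ennreal (s i))"
    using s by (intro prod.cong) auto
  also have "\<dots> = ennreal (\<Prod>i\<in>{1..m}. s i)"
    using s by (intro prod_ennreal) (auto intro: less_imp_le)
  finally have "ennreal (a ^ m * (\<Prod>i\<in>{1..m}. s i)) \<le> ennreal c0"
    using le2 a by (simp add: ennreal_mult')
  moreover have "0 < a ^ m * (\<Prod>i\<in>{1..m}. s i)"
    using a s by (intro mult_pos_pos prod_pos) auto
  ultimately have "a ^ m * (\<Prod>i\<in>{1..m}. s i) \<le> c0"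
    by (metis ennreal_le_iff2 linorder_not_less)
  with a s Ua' show thesis by (intro that[of a s]) auto
qed

lemma c0_pos: "0 < c0"
proof -
  have "cbox 0 (\<chi> i. (0::real ^ 'n) $ i + 1) \<in> cubes" 
    unfolding cubes_def by (intro CollectI exI[of _ 0] exI[of _ 1]) auto
  then obtain a s where "0 < a" "\<And>i. i \<in> {1..m} \<Longrightarrow> 0 < s i" "a ^ m * (\<Prod>i\<in>{1..m}. s i) \<le> c0"
    using cube_bound by metis
  moreover from this have "0 < a ^ m * (\<Prod>i\<in>{1..m}. s i)"
    by (intro mult_pos_pos prod_pos) auto
  ultimately show ?thesis by linarith
qed

lemma \<nu>_power:
  assumes "\<forall>i\<in>{1..m}. 0 < v i x"
  shows "\<nu> x ^ m = (\<Prod>i\<in>{1..m}. v i x)"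
proof -
  have "\<nu> x ^ m = (\<Prod>i\<in>{1..m}. (v i x powr (1 / real m)) ^ m)"
    unfolding \<nu>_def by (rule prod_power_distrib)
  also have "\<dots> = (\<Prod>i\<in>{1..m}. v i x)"
  proof (intro prod.cong refl)
    fix i assume "i \<in> {1..m}"
    then have "0 < v i x" using assms by blast
    then show "(v i x powr (1 / real m)) ^ m = v i x"
      using m by (simp add: powr_realpow[symmetric] powr_powr)
  qed
  finally show ?thesis .
qed

text \<open>For almost every \<open>x \<in> Q\<close> all \<open>v i x\<close> are at least
  \<open>1 / s i\<close>. Multiplying over \<open>i\<close> gives
  \<open>1 \<le> (\<Prod>i. s i) * \<nu> x ^ m\<close>, so
  \<open>a ^ m \<le> c0 * \<nu> x ^ m\<close>, and the constant comes from an \<open>m\<close>-th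
  root.\<close>

lemma cube_A1:
  assumes Q: "Q \<in> cubes"
  shows "AE x in lebesgue. x \<in> Q \<longrightarrow> emeasure (density lebesgue (\<lambda>x. ennreal (\<nu> x))) Q
    \<le> ennreal (root m c0) * ennreal (\<nu> x) * emeasure lebesgue Q"
proof -
  have Qs: "Q \<in> sets lebesgue" using cubeE[OF Q] by metis
  obtain a s where a: "0 < a" and s: "\<And>i. i \<in> {1..m} \<Longrightarrow> 0 < s i" "\<And>i. i \<in> {1..m} \<Longrightarrow> S i Q = ennreal (s i)"
    and Ua: "emeasure (density lebesgue (\<lambda>x. ennreal (\<nu> x))) Q = ennreal a * emeasure lebesgue Q"
    and le: "a ^ m * (\<Prod>i\<in>{1..m}. s i) \<le> c0"
    using cube_bound[OF Q] by metis
  have "AE x in lebesgue. \<forall>i\<in>{1..m}. x \<in> Q \<longrightarrow> ennreal (inverse (v i x)) \<le> S i Q"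
    using S_AE[OF Qs] by (intro AE_finite_allI) auto
  with v_pos show ?thesis
  proof eventually_elim
    case (elim x)
    show ?case
    proof
      assume x: "x \<in> Q"
      have "1 \<le> s i * v i x" if i: "i \<in> {1..m}" for i
      proof -
        have "ennreal (inverse (v i x)) \<le> ennreal (s i)" using elim(2) i x s by auto
        then have "inverse (v i x) \<le> s i" using s(1)[OF i] by (simp add: ennreal_le_iff)
        then show ?thesis using elim(1) i by (simp add: field_simps)
      qed
      then have "(\<Prod>i\<in>{1..m}. 1) \<le> (\<Prod>i\<in>{1..m}. s i * v i x)"
        by (intro prod_mono) auto
      then have "1 \<le> (\<Prod>i\<in>{1..m}. s i) * \<nu> x ^ m"
        using \<nu>_power elim(1) by (simp add: prod.distrib)
      then have "a ^ m * 1 \<le> a ^ m * ((\<Prod>i\<in>{1..m}. s i) * \<nu> x ^ m)"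
        using a by (intro mult_left_mono) auto
      also have "\<dots> = (a ^ m * (\<Prod>i\<in>{1..m}. s i)) * \<nu> x ^ m" by simp
      also have "\<dots> \<le> c0 * \<nu> x ^ m"
        using le \<nu>_nonneg by (intro mult_right_mono) auto
      also have "\<dots> = (root m c0 * \<nu> x) ^ m"
        using m c0_pos by (simp add: power_mult_distrib)
      finally have "a ^ m \<le> (root m c0 * \<nu> x) ^ m" by simp
      then have "a \<le> root m c0 * \<nu> x"
        using m c0_pos \<nu>_nonneg[of x] by (subst (asm) power_mono_iff) (auto simp: a less_imp_le[OF a])
      then have "ennreal a \<le> ennreal (root m c0) * ennreal (\<nu> x)"
        using c0_pos \<nu>_nonneg[of x] m by (simp add: ennreal_mult[symmetric] ennreal_leI)
      then show "emeasure (density lebesgue (\<lambda>x. ennreal (\<nu> x))) Q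
          \<le> ennreal (root m c0) * ennreal (\<nu> x) * emeasure lebesgue Q"
        unfolding Ua by (rule mult_right_mono) simp
    qed
  qed
qed

text \<open>The cube constant times the volume ratio of a ball's circumscribed cube to the ball; the
  maximum with 1 meets the requirement of the locale \<open>A1_weight\<close>.\<close>

definition A :: real where
  "A = max 1 (root m c0 * (2 ^ CARD('n) / unit_ball_vol (real CARD('n))))"

lemma ball_in_cube:
  fixes x :: "real ^ 'n"
  assumes "0 < r"
  obtains Q where "Q \<in> cubes" "ball x r \<subseteq> Q"
    "emeasure lebesgue Q = ennreal (2 ^ CARD('n) / unit_ball_vol (real CARD('n))) * emeasure lebesgue (ball x r)"
proof -
  define a where "a = (\<chi> i. x $ i - r)"
  define Q where "Q = cbox a (\<chi> i. a $ i + 2 * r)"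
  have Q: "Q \<in> cubes" unfolding Q_def cubes_def using assms by (intro CollectI exI[of _ a] exI[of _ "2 * r"]) auto
  have "ball x r \<subseteq> Q"
  proof
    fix y assume "y \<in> ball x r"
    then have "\<bar>x $ i - y $ i\<bar> < r" for i
      using dist_vec_nth_le[of x i y] by (auto simp: dist_real_def)
    then show "y \<in> Q"
      unfolding Q_def a_def by (auto simp: mem_box_cart) (smt (verit))+
  qed
  moreover have "emeasure lebesgue Q = ennreal ((2 * r) ^ CARD('n))"
  proof -
    have ne: "cbox a (\<chi> i. a $ i + 2 * r) \<noteq> {}"
      using assms by (auto simp: interval_ne_empty_cart)
    have "measure lebesgue Q = (2 * r) ^ CARD('n)"
      using content_cbox_cart[OF ne] by (simp add: Q_def)
    then show ?thesis
      using emeasure_eq_ennreal_measure[of lebesgue Q] emeasure_lborel_cbox_finite[of a "\<chi> i. a $ i + 2 * r"]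
      by (simp add: less_top Q_def)
  qed
  moreover have "\<dots> = ennreal (2 ^ CARD('n) / unit_ball_vol (real CARD('n))) * emeasure lebesgue (ball x r)"
  proof -
    have "unit_ball_vol (real CARD('n)) \<noteq> 0"
      using unit_ball_vol_pos[of "real CARD('n)"] by linarith
    then show ?thesis
      using assms by (simp add: emeasure_ball ennreal_mult'[symmetric] power_mult_distrib)
  qed
  ultimately show thesis using Q that by metis
qed

end

sublocale endpoint_weights \<subseteq> A1_weight "\<lambda>x. ennreal (\<nu> x)" A
proof
  show "(\<lambda>x. ennreal (\<nu> x)) \<in> borel_measurable lebesgue" by measurable
  show "AE x in lebesgue. 0 < ennreal (\<nu> x)" using \<nu>_pos by eventually_elim simp
  show "AE x in lebesgue. ennreal (\<nu> x) < \<infinity>" by simp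
  show "1 \<le> A" by (simp add: A_def)
  fix x :: "real ^ 'n" and r :: real
  assume r: "0 < r"
  obtain Q where Q: "Q \<in> cubes" "ball x r \<subseteq> Q"
    and mQ: "emeasure lebesgue Q = ennreal (2 ^ CARD('n) / unit_ball_vol (real CARD('n))) * emeasure lebesgue (ball x r)"
    using ball_in_cube[OF r] by metis
  have Qs: "Q \<in> sets lebesgue" using cubeE[OF Q(1)] by metis
  have rt: "0 \<le> root m c0" using c0_pos by (intro real_root_ge_zero) simp
  show "AE y in lebesgue. y \<in> ball x r \<longrightarrow>
      emeasure (density lebesgue (\<lambda>x. ennreal (\<nu> x))) (ball x r) \<le> ennreal A * ennreal (\<nu> y) * emeasure lebesgue (ball x r)"
    using cube_A1[OF Q(1)]
  proof eventually_elim
    case (elim y)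
    show ?case
    proof
      assume "y \<in> ball x r"
      then have "y \<in> Q" using Q by auto
      have "emeasure (density lebesgue (\<lambda>x. ennreal (\<nu> x))) (ball x r) \<le> emeasure (density lebesgue (\<lambda>x. ennreal (\<nu> x))) Q"
        using Q Qs by (intro emeasure_mono) auto
      also have "\<dots> \<le> ennreal (root m c0) * ennreal (\<nu> y) * emeasure lebesgue Q"
        using elim \<open>y \<in> Q\<close> by simp
      also have "\<dots> = ennreal (root m c0 * (2 ^ CARD('n) / unit_ball_vol (real CARD('n)))) * ennreal (\<nu> y) * emeasure lebesgue (ball x r)"
        unfolding mQ using rt by (subst ennreal_mult') (auto simp: mult_ac)
      also have "\<dots> \<le> ennreal A * ennreal (\<nu> y) * emeasure lebesgue (ball x r)"
        by (intro mult_right_mono ennreal_leI) (auto simp: A_def)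
      finally show "emeasure (density lebesgue (\<lambda>x. ennreal (\<nu> x))) (ball x r) \<le> ennreal A * ennreal (\<nu> y) * emeasure lebesgue (ball x r)" .
    qed
  qed
qed

section \<open>The weights built from a majorant\<close>

lemma ennreal_prod_mono:
  fixes f g :: "'i \<Rightarrow> ennreal"
  assumes "\<And>i. i \<in> I \<Longrightarrow> f i \<le> g i"
  shows "prod f I \<le> prod g I"
  using assms by (induction I rule: infinite_finite_induct) (auto intro!: mult_mono)

locale extrapolation_weights = endpoint_weights m v for m and v :: "nat \<Rightarrow> real ^ 'n \<Rightarrow> real" +
  fixes ps :: "nat \<Rightarrow> real" and p :: real and H :: "real ^ 'n \<Rightarrow> ennreal"
  assumes ps: "\<And>i. i \<in> {1..m} \<Longrightarrow> 1 \<le> ps i"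
    and p: "1 / p = (\<Sum>i\<in>{1..m}. 1 / ps i)"
    and H_measurable[measurable]: "H \<in> borel_measurable lebesgue"
    and H_pos: "0 < (\<integral>\<^sup>+x. H x \<partial>lebesgue)"
    and H_fin: "(\<integral>\<^sup>+x. H x \<partial>lebesgue) < \<infinity>"
begin

lemma p_pos: "0 < p"
proof -
  have "0 < (\<Sum>i\<in>{1..m}. 1 / ps i)"
    using m ps by (intro sum_pos) (auto intro!: divide_pos_pos order.strict_trans2[OF zero_less_one])
  then show ?thesis using p by (metis zero_less_divide_1_iff)
qed

text \<open>Fixes the sign of the exponent \<open>1 - m * p\<close>: lower bounds for
  \<open>n\<close> turn into upper bounds for the product weight.\<close>

lemma mp_ge_1: "1 \<le> real m * p"
proof -
  have "(\<Sum>i\<in>{1..m}. 1 / ps i) \<le> (\<Sum>i\<in>{1..m}. 1)"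
    using ps by (intro sum_mono) (auto simp: divide_le_eq_1 intro: order.strict_trans2[OF zero_less_one])
  then have "1 / p \<le> real m" using p by simp
  then show ?thesis using p_pos by (simp add: field_simps)
qed

definition n :: "real ^ 'n \<Rightarrow> real" where "n x = enn2real (majorant H x)"

definition w :: "nat \<Rightarrow> real ^ 'n \<Rightarrow> real" where
  "w i x = v i x powr ps i * (\<nu> x * n x) powr (1 - ps i)"

lemma n_measurable[measurable]: "n \<in> borel_measurable lebesgue"
  unfolding n_def[abs_def] by measurable

lemma w_measurable[measurable]: "i \<in> {1..m} \<Longrightarrow> w i \<in> borel_measurable lebesgue"
  unfolding w_def[abs_def] by measurable

lemma majorant_pos: "0 < majorant H x"
  using maxfun_pos[OF H_measurable H_pos, of x] unfolding majorant_def by (simp add: less_max_iff_disj)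

lemma AE_good: "AE x in lebesgue. (\<forall>i\<in>{1..m}. 0 < v i x) \<and> 0 < \<nu> x \<and> 0 < n x \<and> majorant H x = ennreal (n x)"
  using v_pos \<nu>_pos majorant_finite[OF H_measurable H_fin]
proof eventually_elim
  case (elim x)
  then show ?case
    using majorant_pos[of x] by (auto simp: n_def less_top enn2real_positive_iff)
qed

lemma w_pos: "AE x in lebesgue. \<forall>i\<in>{1..m}. 0 < w i x"
  using AE_good by eventually_elim (auto simp: w_def)

text \<open>The powers \<open>v i powr p\<close> multiply to \<open>\<nu> powr (m * p)\<close>,
  while the exponents \<open>p / ps i - p\<close> of \<open>\<nu> * n\<close> add up to
  \<open>1 - m * p\<close>; hence a single power of \<open>\<nu>\<close> survives.\<close>

lemma W_eq: "AE x in lebesgue. (\<Prod>i\<in>{1..m}. w i x powr (p / ps i)) = \<nu> x * n x powr (1 - real m * p)"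
  using AE_good
proof eventually_elim
  case (elim x)
  have ps0: "0 < ps i" if "i \<in> {1..m}" for i using ps[OF that] by simp
  have \<nu>n: "0 < \<nu> x * n x" using elim by simp
  have "(\<Prod>i\<in>{1..m}. w i x powr (p / ps i))
      = (\<Prod>i\<in>{1..m}. v i x powr p * (\<nu> x * n x) powr (p * (1 / ps i) - p))"
  proof (intro prod.cong refl)
    fix i assume i: "i \<in> {1..m}"
    have "ps i * (p / ps i) = p" "(1 - ps i) * (p / ps i) = p * (1 / ps i) - p"
      using ps0[OF i] by (auto simp: field_simps)
    then show "w i x powr (p / ps i) = v i x powr p * (\<nu> x * n x) powr (p * (1 / ps i) - p)"
      using elim i by (simp add: w_def powr_mult powr_powr)
  qed
  also have "\<dots> = (\<Prod>i\<in>{1..m}. v i x powr p) * (\<Prod>i\<in>{1..m}. (\<nu> x * n x) powr (p * (1 / ps i) - p))"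
    by (rule prod.distrib)
  also have "(\<Prod>i\<in>{1..m}. v i x powr p) = (\<Prod>i\<in>{1..m}. v i x) powr p"
    by (rule prod_powr_distrib[symmetric])
  also have "\<dots> = \<nu> x powr (real m * p)"
  proof -
    have "(\<Prod>i\<in>{1..m}. v i x) = \<nu> x powr real m"
      using elim \<nu>_power[of x] by (simp add: powr_realpow)
    then show ?thesis by (simp only: powr_powr)
  qed
  also have "(\<Prod>i\<in>{1..m}. (\<nu> x * n x) powr (p * (1 / ps i) - p))
      = (\<nu> x * n x) powr (\<Sum>i\<in>{1..m}. p * (1 / ps i) - p)"
    using \<nu>n by (intro powr_sum[symmetric]) auto
  also have "(\<Sum>i\<in>{1..m}. p * (1 / ps i) - p) = 1 - real m * p"
    using p p_pos unfolding sum_subtractf sum_distrib_left[symmetric] p[symmetric] by simp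
  also have "\<nu> x powr (real m * p) * (\<nu> x * n x) powr (1 - real m * p) = \<nu> x * n x powr (1 - real m * p)"
    using elim by (simp add: powr_mult mult.assoc[symmetric] powr_add[symmetric])
  finally show ?case .
qed

text \<open>On \<open>Q\<close> almost everywhere \<open>v i \<ge> 1 / s\<close>, so
  \<open>1 / w i > t\<close> forces \<open>\<nu> * n > \<tau>\<close> for a suitable
  \<open>\<tau>\<close>, and there \<open>w i < 1 / t\<close>. With \<open>weak\<close> the
  normalised \<open>w i\<close>-measure of the level set is at most \<open>K / (t * \<tau>)\<close>.
  For \<open>ps i = 1\<close> the weight \<open>w i\<close> agrees with \<open>v i\<close> almost
  everywhere.\<close>

lemma dual_factor_w_le:
  assumes Q: "Q \<in> cubes" and i: "i \<in> {1..m}" and s: "S i Q = ennreal s" "0 < s" and K: "0 < K"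
    and weak: "\<And>t. 0 < t \<Longrightarrow>
      ennreal t * emeasure lebesgue (Q \<inter> {x. ennreal t < ennreal (\<nu> x) * majorant H x}) \<le> ennreal K * emeasure lebesgue Q"
  shows "dual_factor (ps i) (w i) Q \<le> ennreal (s * K powr (1 - 1 / ps i))"
proof -
  obtain l where l: "0 < (l::real)" and Qs[measurable]: "Q \<in> sets lebesgue" and mQ: "emeasure lebesgue Q = ennreal (l ^ CARD('n))" "measure lebesgue Q = l ^ CARD('n)"
    using cubeE[OF Q] by metis
  define L where "L = l ^ CARD('n)"
  have L: "0 < L" using l by (simp add: L_def)
  note wm[measurable] = w_measurable[OF i]
  have v_lower: "AE x in lebesgue. x \<in> Q \<longrightarrow> inverse (v i x) \<le> s"
    using S_AE[OF Qs, of i] unfolding s(1) using s(2) by (auto simp: ennreal_le_iff)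
  show ?thesis
  proof (cases "ps i = 1")
    case True
    have "esssup (restrict_space lebesgue Q) (\<lambda>x. ennreal (inverse (w i x))) \<le> ennreal s"
    proof (rule esssup_I)
      show "(\<lambda>x. ennreal (inverse (w i x))) \<in> borel_measurable (lebesgue_on Q)"
        by (rule measurable_restrict_space1) measurable
      have "AE x in lebesgue. x \<in> Q \<longrightarrow> ennreal (inverse (w i x)) \<le> ennreal s"
        using v_lower AE_good
      proof eventually_elim
        case (elim x)
        have "inverse (w i x) \<le> s" if "x \<in> Q"
        proof -
          have "0 < v i x" "inverse (v i x) \<le> s" "\<nu> x * n x \<noteq> 0" using elim i that by auto
          then show ?thesis by (simp add: w_def True)
        qed
        then show ?case by (auto intro: ennreal_leI)
      qed
      then show "AE x in lebesgue_on Q. ennreal (inverse (w i x)) \<le> ennreal s"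
        by (simp add: AE_restrict_space_iff)
    qed
    then show ?thesis using True K by (simp add: dual_factor_def)
  next
    case False
    define q where "q = ps i"
    have q: "1 < q" using False ps[OF i] by (simp add: q_def)
    define e where "e = (q - 1) / q"
    have e: "0 < e" using q by (simp add: e_def)
    have "weak_norm (weighted (\<lambda>x. w i x / L)) (q / (q - 1)) (\<lambda>x. indicator Q x * inverse (w i x))
        \<le> ennreal (s * K powr (1 - 1 / q))"
      unfolding weak_norm_def
    proof (rule SUP_least)
      fix t :: real assume "t \<in> {0<..}"
      then have t: "0 < t" by simp
      \<comment> \<open>The solution of
        \<open>\<tau> powr (q - 1) = t * s powr (- q)\<close>.\<close>
      define \<tau> where "\<tau> = t powr (1 / (q - 1)) * s powr (- q / (q - 1))"
      have \<tau>: "0 < \<tau>" using t s by (simp add: \<tau>_def)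
      define E where "E = {x \<in> space (weighted (\<lambda>x. w i x / L)). norm (indicator Q x * inverse (w i x)) > t}"
      define Z where "Z = Q \<inter> {x. ennreal \<tau> < ennreal (\<nu> x) * majorant H x}"
      have E_eq: "E = {x \<in> space lebesgue. norm (indicator Q x * inverse (w i x)) > t}"
        by (simp add: E_def weighted_def)
      have [measurable]: "E \<in> sets lebesgue" unfolding E_eq by measurable
      have [measurable]: "Z \<in> sets lebesgue" unfolding Z_def by (auto intro!: sets.Int sets_lebesgue_less)
      have "emeasure (weighted (\<lambda>x. w i x / L)) E = (\<integral>\<^sup>+x. ennreal (w i x / L) * indicator E x \<partial>lebesgue)"
        unfolding weighted_def by (rule emeasure_density) measurable
      also have "\<dots> \<le> (\<integral>\<^sup>+x. ennreal (1 / (t * L)) * indicator Z x \<partial>lebesgue)"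
        using AE_good v_lower
      proof (intro nn_integral_mono_AE, eventually_elim)
        case (elim x)
        show ?case
        proof (cases "x \<in> E")
          case True
          have x: "x \<in> Q" using True t by (cases "x \<in> Q") (auto simp: E_eq)
          have "0 < v i x" "0 < \<nu> x * n x" using elim i by auto
          then have wx: "0 < w i x"
            unfolding w_def by (intro mult_pos_pos) (metis powr_gt_zero less_irrefl)+
          have tw: "t < inverse (w i x)" using True x wx by (simp add: E_eq)
          then have w_lt: "w i x < 1 / t" using wx t by (simp add: field_simps)
          have vx: "0 < v i x" "inverse (v i x) \<le> s" using elim i x by auto
          have "1 / s \<le> v i x" using vx s by (simp add: field_simps)
          then have "(1 / s) powr q \<le> v i x powr q" using s q by (intro powr_mono2) auto
          then have sv: "s powr (- q) \<le> v i x powr q" using s by (simp add: powr_minus_divide powr_divide)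
          define y where "y = \<nu> x * n x"
          have y: "0 < y" using elim by (simp add: y_def)
          have "s powr (- q) * y powr (1 - q) \<le> w i x"
            unfolding w_def q_def[symmetric] y_def[symmetric] using sv by (intro mult_right_mono) auto
          with w_lt have "s powr (- q) * y powr (1 - q) < 1 / t" by simp
          then have "t * s powr (- q) * (y powr (1 - q) * y powr (q - 1)) < y powr (q - 1)"
            using t y by (simp add: field_simps)
          then have "t * s powr (- q) < y powr (q - 1)"
            using y by (simp add: powr_add[symmetric])
          then have "(t * s powr (- q)) powr (1 / (q - 1)) < (y powr (q - 1)) powr (1 / (q - 1))"
            using t s q by (intro powr_less_mono2) auto
          then have "\<tau> < y" using t s q y by (simp add: \<tau>_def powr_mult powr_powr)
          then have "x \<in> Z"
            using x elim y \<tau> by (auto simp: Z_def y_def ennreal_mult[symmetric] ennreal_less_iff)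
          moreover have "w i x / L \<le> 1 / (t * L)" using w_lt L t by (simp add: field_simps)
          ultimately show ?thesis by (simp add: ennreal_leI indicator_def)
        qed simp
      qed
      also have "\<dots> = ennreal (1 / (t * L)) * emeasure lebesgue Z"
        by (simp add: nn_integral_cmult)
      also have "emeasure lebesgue Z = ennreal (1 / \<tau>) * (ennreal \<tau> * emeasure lebesgue Z)"
        using \<tau> by (simp add: mult.assoc[symmetric] ennreal_mult'[symmetric])
      also have "ennreal (1 / (t * L)) * (ennreal (1 / \<tau>) * (ennreal \<tau> * emeasure lebesgue Z))
          \<le> ennreal (1 / (t * L)) * (ennreal (1 / \<tau>) * (ennreal K * ennreal L))"
        unfolding Z_def L_def mQ(1)[symmetric] by (intro mult_left_mono weak \<tau>) auto
      also have "\<dots> = ennreal (1 / (t * L) * (1 / \<tau> * (K * L)))"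
        using t L \<tau> K by (simp only: ennreal_mult'[symmetric] ennreal_mult''[symmetric]) (subst ennreal_mult'[symmetric], auto)+
      also have "1 / (t * L) * (1 / \<tau> * (K * L)) = K / (t * \<tau>)"
        using L by simp
      finally have "ennreal t * ennpow (emeasure (weighted (\<lambda>x. w i x / L)) E) (1 / (q / (q - 1)))
          \<le> ennreal t * ennpow (ennreal (K / (t * \<tau>))) (1 / (q / (q - 1)))"
        using q by (intro mult_left_mono ennpow_mono) auto
      also have "\<dots> = ennreal (t * (K / (t * \<tau>)) powr e)"
        using t K \<tau> by (simp add: ennpow_ennreal ennreal_mult' e_def)
      \<comment> \<open>Because \<open>e / (q - 1) = 1 - e\<close>, the powers of \<open>t\<close>
        in \<open>(t * \<tau>) powr e\<close> combine to \<open>t\<close> itself, and the bound no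
        longer depends on the level.\<close>
      also have "t * (K / (t * \<tau>)) powr e = s * K powr e"
      proof -
        have "(t * \<tau>) powr e = t powr e * (t powr (e / (q - 1)) * s powr (- q * e / (q - 1)))"
          using t s by (simp add: \<tau>_def powr_mult powr_powr)
        also have "- q * e / (q - 1) = - 1" using q by (simp add: e_def field_simps)
        also have "e / (q - 1) = 1 - e" using q by (simp add: e_def field_simps)
        finally have "(t * \<tau>) powr e = t / s"
          using t s by (simp add: powr_minus mult.assoc[symmetric] powr_add[symmetric] divide_inverse)
        then show ?thesis using t s K \<tau> by (simp add: powr_divide)
      qed
      also have "e = 1 - 1 / q" using q by (simp add: e_def field_simps)
      finally show "ennreal t * ennpow (emeasure (weighted (\<lambda>x. w i x / L))
          {x \<in> space (weighted (\<lambda>x. w i x / L)). t < norm (indicator Q x * inverse (w i x))}) (1 / (q / (q - 1)))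
          \<le> ennreal (s * K powr (1 - 1 / q))"
        by (simp add: E_def)
    qed
    then show ?thesis
      using False by (simp add: dual_factor_def q_def L_def mQ)
  qed
qed

text \<open>The infimum over \<open>Q\<close> is finite because \<open>maxfun H\<close> is finite
  almost everywhere, and positive because one ball that contains \<open>Q\<close> and carries mass
  of \<open>H\<close> competes at every point of \<open>Q\<close>. It need not be attained, hence
  the factor 2.\<close>

lemma maxfun_near_inf:
  assumes Q: "Q \<in> sets lebesgue" "emeasure lebesgue Q \<noteq> 0" and QB: "Q \<subseteq> ball z R"
  obtains \<eta> y where "0 < \<eta>" "\<And>x. x \<in> Q \<Longrightarrow> ennreal \<eta> \<le> maxfun H x" "y \<in> Q" "maxfun H y \<le> ennreal (2 * \<eta>)"
proof -
  define I where "I = (INF x\<in>Q. maxfun H x)"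
  have "\<exists>y\<in>Q. maxfun H y < \<infinity>"
  proof (rule ccontr)
    assume *: "\<not> (\<exists>y\<in>Q. maxfun H y < \<infinity>)"
    from majorant_finite[OF H_measurable H_fin] have "AE x in lebesgue. x \<notin> Q"
    proof eventually_elim
      case (elim x)
      then have "maxfun H x < \<infinity>" by (simp add: majorant_def)
      with * show ?case by auto
    qed
    with not_AE_not_in[OF Q] show False by simp
  qed
  then have I_fin: "I < \<infinity>" unfolding I_def by (subst INF_less_iff) auto
  have "0 < maxfun H z" using maxfun_pos[OF H_measurable H_pos] .
  then obtain c r where cr: "0 < r" "z \<in> ball c r" "0 < emeasure (density lebesgue H) (ball c r)"
    unfolding less_maxfun_iff by auto
  \<comment> \<open>Seen from \<open>z\<close>, radius \<open>2 * r\<close> contains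
    \<open>ball c r\<close> and radius \<open>R\<close> contains \<open>Q\<close>.\<close>
  define R' where "R' = max R (2 * r)"
  have R': "0 < R'" using cr by (simp add: R'_def)
  have "ball c r \<subseteq> ball z R'"
  proof
    fix x assume "x \<in> ball c r"
    then show "x \<in> ball z R'"
      using cr(2) dist_triangle[of z x c] by (auto simp: R'_def dist_commute less_max_iff_disj)
  qed
  then have "0 < emeasure (density lebesgue H) (ball z R')"
    using cr(3) by (intro order.strict_trans2[OF cr(3)] emeasure_mono) auto
  then have "0 < emeasure (density lebesgue H) (ball z R') / emeasure U (ball z R')"
    using U_ball_finite[OF R', of z] by (simp add: ennreal_zero_less_divide)
  also have "\<dots> \<le> I"
    unfolding I_def
  proof (rule INF_greatest)
    fix x assume "x \<in> Q"
    then have x: "x \<in> ball z R'" using QB by (auto simp: R'_def)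
    show "emeasure (density lebesgue H) (ball z R') / emeasure U (ball z R') \<le> maxfun H x"
      unfolding maxfun_def using R' x by (intro SUP_upper2[of "(z, R')"]) auto
  qed
  finally have I_pos: "0 < I" .
  define \<eta> where "\<eta> = enn2real I"
  have \<eta>: "0 < \<eta>" "I = ennreal \<eta>" using I_fin I_pos by (auto simp: \<eta>_def less_top enn2real_positive_iff)
  have "I < ennreal (2 * \<eta>)" using \<eta> by (simp add: ennreal_less_iff)
  then obtain y where "y \<in> Q" "maxfun H y < ennreal (2 * \<eta>)"
    unfolding I_def INF_less_iff by blast
  moreover have "ennreal \<eta> \<le> maxfun H x" if "x \<in> Q" for x
    using that unfolding \<eta>(2)[symmetric] I_def by (rule INF_lower)
  ultimately show thesis using \<eta> that by (metis less_imp_le)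
qed

text \<open>With \<open>a\<close> the average of \<open>\<nu>\<close> on \<open>Q\<close> and
  \<open>\<eta>\<close> the infimum of \<open>maxfun H\<close> there, the first factor is at most
  \<open>\<eta> powr (1 / p - m) * a powr (1 / p)\<close>, and the dual factors contribute
  \<open>(\<Prod>i. s i) * K powr (m - 1 / p)\<close> with \<open>K\<close> proportional to
  \<open>\<eta> * a\<close>. The powers of \<open>\<eta>\<close> cancel and those of
  \<open>a\<close> give \<open>a ^ m\<close>, which leaves the quantity bounded by
  \<open>c0\<close>.\<close>

lemma A_R_w: "A_R m ps w"
proof -
  \<comment> \<open>The ratio of the volumes of \<open>ball c R\<close> and \<open>Q\<close>, where
    \<open>c\<close> is the lower corner of the cube. The radius \<open>R\<close> is
    \<open>CARD('n) + 1\<close> sides: the l1 norm gives \<open>CARD('n)\<close> sides, and one more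
    makes the inclusion in the open ball strict.\<close>
  define q where "q = unit_ball_vol (real CARD('n)) * (real CARD('n) + 1) ^ CARD('n)"
  have q: "0 < q" unfolding q_def by (intro mult_pos_pos zero_less_power) auto
  obtain C where C: "0 < C" and mw: "\<And>(h :: real ^ 'n \<Rightarrow> ennreal) z R Q t y. h \<in> borel_measurable lebesgue \<Longrightarrow> 0 < R \<Longrightarrow>
    Q \<in> sets lebesgue \<Longrightarrow> Q \<subseteq> ball z R \<Longrightarrow> emeasure lebesgue (ball z R) \<le> ennreal q * emeasure lebesgue Q \<Longrightarrow>
    0 < t \<Longrightarrow> y \<in> Q \<Longrightarrow>
    ennreal t * emeasure lebesgue (Q \<inter> {x. ennreal t < ennreal (\<nu> x) * majorant h x})
      \<le> ennreal C * (maxfun h y * emeasure U Q)"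
    using mixed_weak_type_local[OF q] by blast
  have he: "harmonic_exponent m ps = p"
    unfolding harmonic_exponent_def p[symmetric] using p_pos by simp
  define b where "b = (2 * C) powr (real m - 1 / p) * c0"
  have "A_R_const m ps w \<le> ennreal b"
    unfolding A_R_const_def he Let_def
  proof (rule SUP_least)
    fix Q :: "(real ^ 'n) set" assume Q: "Q \<in> cubes"
    obtain c l where l: "0 < (l::real)" and Qeq: "Q = cbox c (\<chi> i. c $ i + l)" and Qs[measurable]: "Q \<in> sets lebesgue"
      and mQ: "emeasure lebesgue Q = ennreal (l ^ CARD('n))"
      using cubeE[OF Q] by metis
    have mQ0: "emeasure lebesgue Q \<noteq> 0" using mQ l by simp
    define R where "R = (real CARD('n) + 1) * l"
    have R: "0 < R" using l by (simp add: R_def add_pos_pos)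
    have QB: "Q \<subseteq> ball c R"
    proof
      fix x assume "x \<in> Q"
      then have *: "\<bar>(x - c) $ i\<bar> \<le> l" for i by (auto simp: Qeq mem_box_cart abs_le_iff) (smt (verit) l)
      have "norm (x - c) \<le> (\<Sum>i\<in>UNIV. \<bar>(x - c) $ i\<bar>)" by (rule norm_le_l1_cart)
      also have "\<dots> \<le> (\<Sum>i\<in>(UNIV :: 'n set). l)" using * by (rule sum_mono)
      also have "\<dots> < R" using l by (simp add: R_def distrib_right)
      finally show "x \<in> ball c R" by (simp add: dist_norm norm_minus_commute)
    qed
    have qQ: "emeasure lebesgue (ball c R) \<le> ennreal q * emeasure lebesgue Q"
      unfolding mQ using R l q by (simp add: emeasure_ball R_def q_def power_mult_distrib ennreal_mult'[symmetric] mult_ac)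
    obtain a s where a: "0 < a" and s: "\<And>i. i \<in> {1..m} \<Longrightarrow> 0 < s i" "\<And>i. i \<in> {1..m} \<Longrightarrow> S i Q = ennreal (s i)"
      and Ua: "emeasure U Q = ennreal a * emeasure lebesgue Q"
      and le: "a ^ m * (\<Prod>i\<in>{1..m}. s i) \<le> c0"
      using cube_bound[OF Q] by metis
    obtain \<eta> y where \<eta>: "0 < \<eta>" and \<eta>_le: "\<And>x. x \<in> Q \<Longrightarrow> ennreal \<eta> \<le> maxfun H x" and y: "y \<in> Q" "maxfun H y \<le> ennreal (2 * \<eta>)"
      using maxfun_near_inf[OF Qs mQ0 QB] by metis
    \<comment> \<open>\<open>mixed_weak_type_local\<close> at the near minimiser \<open>y\<close>,
      with \<open>2 * \<eta>\<close> for \<open>maxfun H y\<close> and \<open>a * |Q|\<close> for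
      the \<open>U\<close>-mass of \<open>Q\<close>.\<close>
    define K where "K = 2 * C * (\<eta> * a)"
    have K: "0 < K" using C \<eta> a by (simp add: K_def)
    have weak: "ennreal t * emeasure lebesgue (Q \<inter> {x. ennreal t < ennreal (\<nu> x) * majorant H x}) \<le> ennreal K * emeasure lebesgue Q"
      if "0 < t" for t
    proof -
      have "ennreal t * emeasure lebesgue (Q \<inter> {x. ennreal t < ennreal (\<nu> x) * majorant H x})
          \<le> ennreal C * (maxfun H y * emeasure U Q)"
        using R QB qQ that y by (intro mw) auto
      also have "\<dots> \<le> ennreal C * (ennreal (2 * \<eta>) * emeasure U Q)"
        using y by (intro mult_left_mono mult_right_mono) auto
      also have "\<dots> = ennreal (C * (2 * \<eta> * a)) * emeasure lebesgue Q"
        unfolding Ua using C \<eta> a by (simp add: ennreal_mult mult.assoc)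
      also have "C * (2 * \<eta> * a) = K" by (simp add: K_def)
      finally show ?thesis .
    qed
    have "(\<integral>\<^sup>+ x\<in>Q. ennreal (\<Prod>i\<in>{1..m}. w i x powr (p / ps i)) \<partial>lebesgue)
        \<le> (\<integral>\<^sup>+ x. ennreal (\<eta> powr (1 - real m * p)) * (ennreal (\<nu> x) * indicator Q x) \<partial>lebesgue)"
      using W_eq AE_good
    proof (intro nn_integral_mono_AE, eventually_elim)
      case (elim x)
      show ?case
      proof (cases "x \<in> Q")
        case True
        have "ennreal \<eta> \<le> ennreal (n x)"
          using \<eta>_le[OF True] elim by (metis majorant_def max.cobounded1 order_trans)
        then have "\<eta> \<le> n x" using elim by (simp add: ennreal_le_iff)
        then have "n x powr (1 - real m * p) \<le> \<eta> powr (1 - real m * p)"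
          using \<eta> mp_ge_1 by (intro powr_mono2') auto
        then have "\<nu> x * n x powr (1 - real m * p) \<le> \<eta> powr (1 - real m * p) * \<nu> x"
          using elim by (simp add: mult.commute)
        moreover have "(\<Prod>i\<in>{1..m}. w i x powr (p / ps i)) = \<nu> x * n x powr (1 - real m * p)"
          using elim by blast
        ultimately show ?thesis using True by (simp add: ennreal_mult'[symmetric] ennreal_leI)
      qed simp
    qed
    also have "\<dots> = ennreal (\<eta> powr (1 - real m * p)) * emeasure U Q"
      by (subst nn_integral_cmult) (auto simp: emeasure_density)
    also have "\<dots> = ennreal (\<eta> powr (1 - real m * p) * a) * emeasure lebesgue Q"
      unfolding Ua using a by (simp add: ennreal_mult mult.assoc)
    finally have "(\<integral>\<^sup>+ x\<in>Q. ennreal (\<Prod>i\<in>{1..m}. w i x powr (p / ps i)) \<partial>lebesgue) / emeasure lebesgue Q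
        \<le> ennreal (\<eta> powr (1 - real m * p) * a) * emeasure lebesgue Q / emeasure lebesgue Q"
      by (rule divide_right_mono_ennreal)
    also have "\<dots> = ennreal (\<eta> powr (1 - real m * p) * a)"
      using mQ mQ0 by (intro mult_divide_eq_ennreal) auto
    finally have "ennpow ((\<integral>\<^sup>+ x\<in>Q. ennreal (\<Prod>i\<in>{1..m}. w i x powr (p / ps i)) \<partial>lebesgue) / emeasure lebesgue Q) (1 / p)
        \<le> ennpow (ennreal (\<eta> powr (1 - real m * p) * a)) (1 / p)"
      using p_pos by (intro ennpow_mono) auto
    also have "\<dots> = ennreal ((\<eta> powr (1 - real m * p) * a) powr (1 / p))"
      using a by (intro ennpow_ennreal) auto
    also have "(\<eta> powr (1 - real m * p) * a) powr (1 / p) = \<eta> powr (1 / p - real m) * a powr (1 / p)"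
      using p_pos \<eta> a by (simp add: powr_mult powr_powr diff_divide_distrib)
    finally have f1: "ennpow ((\<integral>\<^sup>+ x\<in>Q. ennreal (\<Prod>i\<in>{1..m}. w i x powr (p / ps i)) \<partial>lebesgue) / emeasure lebesgue Q) (1 / p)
        \<le> ennreal (\<eta> powr (1 / p - real m) * a powr (1 / p))" .
    have "(\<Prod>i\<in>{1..m}. dual_factor (ps i) (w i) Q) \<le> (\<Prod>i\<in>{1..m}. ennreal (s i * K powr (1 - 1 / ps i)))"
      by (intro ennreal_prod_mono dual_factor_w_le Q s K weak) auto
    also have "\<dots> = ennreal (\<Prod>i\<in>{1..m}. s i * K powr (1 - 1 / ps i))"
      using s K by (intro prod_ennreal less_imp_le mult_pos_pos) auto
    also have "(\<Prod>i\<in>{1..m}. s i * K powr (1 - 1 / ps i)) = (\<Prod>i\<in>{1..m}. s i) * K powr (real m - 1 / p)"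
    proof -
      have "(\<Prod>i\<in>{1..m}. K powr (1 - 1 / ps i)) = K powr (\<Sum>i\<in>{1..m}. 1 - 1 / ps i)"
        using K by (intro powr_sum[symmetric]) auto
      also have "(\<Sum>i\<in>{1..m}. 1 - 1 / ps i) = real m - 1 / p"
        unfolding sum_subtractf p by simp
      finally show ?thesis by (simp add: prod.distrib)
    qed
    finally have "ennpow ((\<integral>\<^sup>+ x\<in>Q. ennreal (\<Prod>i\<in>{1..m}. w i x powr (p / ps i)) \<partial>lebesgue) / emeasure lebesgue Q) (1 / p)
        * (\<Prod>i\<in>{1..m}. dual_factor (ps i) (w i) Q)
        \<le> ennreal (\<eta> powr (1 / p - real m) * a powr (1 / p)) * ennreal ((\<Prod>i\<in>{1..m}. s i) * K powr (real m - 1 / p))"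
      by (intro mult_mono f1) auto
    also have "\<dots> = ennreal (\<eta> powr (1 / p - real m) * a powr (1 / p) * ((\<Prod>i\<in>{1..m}. s i) * K powr (real m - 1 / p)))"
      by (rule ennreal_mult'[symmetric]) simp
    also have "\<eta> powr (1 / p - real m) * a powr (1 / p) * ((\<Prod>i\<in>{1..m}. s i) * K powr (real m - 1 / p))
        = (2 * C) powr (real m - 1 / p) * (a ^ m * (\<Prod>i\<in>{1..m}. s i))"
    proof -
      have Kp: "K powr (real m - 1 / p) = (2 * C) powr (real m - 1 / p) * (\<eta> powr (real m - 1 / p) * a powr (real m - 1 / p))"
        using C \<eta> a by (simp add: K_def powr_mult)
      have \<eta>p: "\<eta> powr (1 / p - real m) * \<eta> powr (real m - 1 / p) = 1"
        using \<eta> by (simp add: powr_add[symmetric])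
      have ap: "a powr (1 / p) * a powr (real m - 1 / p) = a ^ m"
        using a by (simp add: powr_add[symmetric] powr_realpow)
      have "\<eta> powr (1 / p - real m) * a powr (1 / p) * ((\<Prod>i\<in>{1..m}. s i) * K powr (real m - 1 / p))
          = (2 * C) powr (real m - 1 / p) * ((a powr (1 / p) * a powr (real m - 1 / p)) * (\<Prod>i\<in>{1..m}. s i))
            * (\<eta> powr (1 / p - real m) * \<eta> powr (real m - 1 / p))"
        unfolding Kp by (simp only: mult_ac)
      then show ?thesis unfolding \<eta>p ap by simp
    qed
    also have "ennreal \<dots> \<le> ennreal b"
      unfolding b_def using le by (intro ennreal_leI mult_left_mono) auto
    finally show "ennpow ((\<integral>\<^sup>+ x\<in>Q. ennreal (\<Prod>i\<in>{1..m}. w i x powr (p / ps i)) \<partial>lebesgue) / emeasure lebesgue Q) (1 / p)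
        * (\<Prod>i\<in>{1..m}. dual_factor (ps i) (w i) Q) \<le> ennreal b" .
  qed
  then have "A_R_const m ps w < \<infinity>"
    by (rule order.strict_trans1) simp
  moreover have "weight (w i)" if "i \<in> {1..m}" for i
    unfolding weight_def
  proof
    show "AE x in lebesgue. 0 < w i x"
      using w_pos by eventually_elim (use that in auto)
  qed (use that in measurable)
  ultimately show ?thesis by (simp add: A_R_def)
qed

end

section \<open>Lorentz norms\<close>

lemma sigma_finite_lebesgue: "sigma_finite_measure (lebesgue :: 'a::euclidean_space measure)"
proof
  show "\<exists>A::'a set set. countable A \<and> A \<subseteq> sets lebesgue \<and> \<Union> A = space lebesgue \<and> (\<forall>a\<in>A. emeasure lebesgue a \<noteq> \<infinity>)"
  proof (intro exI[of _ "range (\<lambda>n. ball 0 (real n))"] conjI)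
    show "\<Union> (range (\<lambda>n. ball 0 (real n))) = space (lebesgue :: 'a measure)"
      using reals_Archimedean2 by (auto simp: set_eq_iff)
  qed (auto simp: emeasure_ball)
qed

lemma sigma_finite_weighted:
  assumes "w \<in> borel_measurable lebesgue"
  shows "sigma_finite_measure (weighted w)"
  unfolding weighted_def
  using assms sigma_finite_measure.sigma_finite_iff_density_finite[OF sigma_finite_lebesgue, of "\<lambda>x. ennreal (w x)"]
  by simp

lemma nn_integral_layer_cake:
  fixes f :: "'a \<Rightarrow> 'b::{real_normed_vector, second_countable_topology}"
  assumes "sigma_finite_measure M" and [measurable]: "f \<in> borel_measurable M"
  shows "(\<integral>\<^sup>+x. ennreal (norm (f x)) \<partial>M)
    = (\<integral>\<^sup>+s\<in>{0<..}. emeasure M {x \<in> space M. norm (f x) > s} \<partial>lborel)"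
proof -
  interpret M: sigma_finite_measure M by fact
  interpret P: pair_sigma_finite M lborel by unfold_locales
  define g :: "'a \<times> real \<Rightarrow> ennreal" where "g = (\<lambda>(x, s). indicator {0<..} s * indicator {y \<in> space (M \<Otimes>\<^sub>M lborel). norm (f (fst y)) > snd y} (x, s))"
  have [measurable]: "g \<in> borel_measurable (M \<Otimes>\<^sub>M lborel)"
    unfolding g_def by measurable
  have "(\<integral>\<^sup>+x. ennreal (norm (f x)) \<partial>M) = (\<integral>\<^sup>+x. (\<integral>\<^sup>+s. g (x, s) \<partial>lborel) \<partial>M)"
  proof (intro nn_integral_cong)
    fix x assume x: "x \<in> space M"
    have "(\<integral>\<^sup>+s. g (x, s) \<partial>lborel) = (\<integral>\<^sup>+s. indicator {0<..<norm (f x)} s \<partial>lborel)"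
      using x by (intro nn_integral_cong) (auto simp: g_def indicator_def space_pair_measure)
    then show "ennreal (norm (f x)) = (\<integral>\<^sup>+s. g (x, s) \<partial>lborel)" by simp
  qed
  also have "\<dots> = (\<integral>\<^sup>+s. (\<integral>\<^sup>+x. g (x, s) \<partial>M) \<partial>lborel)"
    by (rule P.Fubini'[symmetric]) simp
  also have "\<dots> = (\<integral>\<^sup>+s\<in>{0<..}. emeasure M {x \<in> space M. norm (f x) > s} \<partial>lborel)"
  proof (intro nn_integral_cong)
    fix s :: real
    have "(\<integral>\<^sup>+x. g (x, s) \<partial>M) = (\<integral>\<^sup>+x. indicator {0<..} s * indicator {x \<in> space M. norm (f x) > s} x \<partial>M)"
      by (intro nn_integral_cong) (auto simp: g_def indicator_def space_pair_measure)
    also have "\<dots> = indicator {0<..} s * emeasure M {x \<in> space M. norm (f x) > s}"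
      by (subst nn_integral_cmult) auto
    finally show "(\<integral>\<^sup>+x. g (x, s) \<partial>M) = emeasure M {x \<in> space M. norm (f x) > s} * indicator {0<..} s"
      by (simp add: mult.commute)
  qed
  finally show ?thesis .
qed

lemma ennpow_cmult:
  assumes "0 < c"
  shows "ennpow (ennreal c * x) a = ennreal (c powr a) * ennpow x a"
proof (cases x)
  case (real r)
  then show ?thesis using assms by (simp add: ennpow_ennreal ennreal_mult'[symmetric] powr_mult)
next
  case top
  then show ?thesis using assms by (simp add: ennpow_def ennreal_mult_top)
qed

text \<open>The embedding of Lorentz exponent \<open>q\<close> into exponent 1, for distribution
  functions. Monotonicity gives \<open>(s * \<phi> s) powr q \<le> I\<close> for every
  \<open>s\<close>; writing \<open>\<phi> s\<close> as \<open>(s * \<phi> s) powr (1 - q)\<close>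
  times the integrand of \<open>I\<close> and integrating gives
  \<open>I powr (1 / q - 1) * I\<close>.\<close>

lemma nn_integral_antimono_le:
  fixes \<phi> :: "real \<Rightarrow> ennreal"
  assumes q: "0 < q" "q \<le> 1" and mono: "\<And>s t. 0 < s \<Longrightarrow> s \<le> t \<Longrightarrow> \<phi> t \<le> \<phi> s"
    and [measurable]: "\<phi> \<in> borel_measurable borel"
  shows "(\<integral>\<^sup>+s\<in>{0<..}. \<phi> s \<partial>lborel) \<le> ennpow (\<integral>\<^sup>+s\<in>{0<..}. ennreal (s powr (q - 1)) * ennpow (\<phi> s) q \<partial>lborel) (1 / q)"
proof -
  define I where "I = (\<integral>\<^sup>+s\<in>{0<..}. ennreal (s powr (q - 1)) * ennpow (\<phi> s) q \<partial>lborel)"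
  show ?thesis
  proof (cases "I = \<infinity>")
    case True
    then show ?thesis unfolding I_def by (simp add: ennpow_def)
  next
    case False
    define J where "J = enn2real I"
    have J: "0 \<le> J" "I = ennreal J" using False by (auto simp: J_def less_top)
    \<comment> \<open>Both factors of the integrand decrease, so on \<open>{0<..s}\<close>, of
      length \<open>s\<close>, it is at least its value at \<open>s\<close>.\<close>
    have le: "ennreal (s powr q) * ennpow (\<phi> s) q \<le> I" if s: "0 < s" for s
    proof -
      have "ennreal (s powr q) * ennpow (\<phi> s) q = ennreal (s powr (q - 1)) * ennpow (\<phi> s) q * emeasure lborel {0<..s}"
      proof -
        have "s powr q = s powr (q - 1) * s" using s by (simp add: powr_diff)
        then have "ennreal (s powr q) = ennreal (s powr (q - 1)) * ennreal s"
          by (simp only: ennreal_mult' powr_ge_zero)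
        then show ?thesis using s by (simp add: mult_ac)
      qed
      also have "\<dots> = (\<integral>\<^sup>+r. ennreal (s powr (q - 1)) * ennpow (\<phi> s) q * indicator {0<..s} r \<partial>lborel)"
        by (simp add: nn_integral_cmult)
      also have "\<dots> \<le> I"
        unfolding I_def
      proof (intro nn_integral_mono)
        fix r :: real
        show "ennreal (s powr (q - 1)) * ennpow (\<phi> s) q * indicator {0<..s} r
            \<le> ennreal (r powr (q - 1)) * ennpow (\<phi> r) q * indicator {0<..} r"
        proof (cases "0 < r \<and> r \<le> s")
          case True
          then have "s powr (q - 1) \<le> r powr (q - 1)" using q by (intro powr_mono2') auto
          then show ?thesis using True q mono[of r s]
            by (auto intro!: mult_mono ennreal_leI ennpow_mono)
        qed (auto simp: indicator_def)
      qed
      finally show ?thesis .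
    qed
    have pt: "\<phi> s \<le> ennreal (J powr (1 / q - 1)) * (ennreal (s powr (q - 1)) * ennpow (\<phi> s) q)" if s: "0 < s" for s
    proof (cases "\<phi> s")
      case top
      then have "I = \<infinity>" using le[OF s] s by (simp add: ennpow_def ennreal_mult_top top_unique)
      with False show ?thesis by simp
    next
      case (real a)
      show ?thesis
      proof (cases "a = 0")
        case True
        then show ?thesis using real by simp
      next
        case False
        then have a: "0 < a" using real by simp
        have "s powr q * a powr q \<le> J"
          using le[OF s] real J by (simp add: ennpow_ennreal ennreal_mult'[symmetric])
        then have "((s * a) powr q) powr (1 / q - 1) \<le> J powr (1 / q - 1)"
          using s a q by (intro powr_mono2) (auto simp: powr_mult)
        then have "(s * a) powr (1 - q) \<le> J powr (1 / q - 1)"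
          using q by (simp add: powr_powr algebra_simps)
        then have "(s * a) powr (1 - q) * (s powr (q - 1) * a powr q) \<le> J powr (1 / q - 1) * (s powr (q - 1) * a powr q)"
          by (rule mult_right_mono) auto
        also have "(s * a) powr (1 - q) * (s powr (q - 1) * a powr q) = (s powr (1 - q) * s powr (q - 1)) * (a powr (1 - q) * a powr q)"
          using s a by (simp add: powr_mult mult_ac)
        also have "\<dots> = a" using s a by (simp add: powr_add[symmetric])
        finally show ?thesis using real by (simp add: ennpow_ennreal ennreal_mult'[symmetric] ennreal_leI)
      qed
    qed
    have [measurable]: "(\<lambda>s. ennpow (\<phi> s) q) \<in> borel_measurable borel"
      unfolding ennpow_def by measurable
    have "(\<integral>\<^sup>+s\<in>{0<..}. \<phi> s \<partial>lborel)
        \<le> (\<integral>\<^sup>+s. ennreal (J powr (1 / q - 1)) * (ennreal (s powr (q - 1)) * ennpow (\<phi> s) q * indicator {0<..} s) \<partial>lborel)"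
      using pt by (intro nn_integral_mono) (auto simp: indicator_def)
    also have "\<dots> = ennreal (J powr (1 / q - 1)) * I"
      unfolding I_def by (rule nn_integral_cmult) measurable
    also have "\<dots> = ennpow I (1 / q)"
    proof (cases "J = 0")
      case False
      then have "J powr (1 / q - 1) * J = J powr (1 / q)"
        using J by (simp add: powr_diff)
      then show ?thesis using J by (simp add: ennpow_ennreal ennreal_mult'[symmetric])
    qed (simp add: J ennpow_def)
    finally show ?thesis by (simp add: I_def)
  qed
qed

lemma level_set_measurable:
  fixes f :: "'a \<Rightarrow> 'b::{real_normed_vector, second_countable_topology}"
  assumes "sigma_finite_measure M" and [measurable]: "f \<in> borel_measurable M"
  shows "(\<lambda>s. emeasure M {x \<in> space M. norm (f x) > s}) \<in> borel_measurable borel"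
proof -
  interpret M: sigma_finite_measure M by fact
  define Z where "Z = {y \<in> space (borel \<Otimes>\<^sub>M M). norm (f (snd y)) > fst y}"
  have [measurable]: "Z \<in> sets (borel \<Otimes>\<^sub>M M)" unfolding Z_def by measurable
  have "(\<lambda>s. \<integral>\<^sup>+x. indicator Z (s, x) \<partial>M) \<in> borel_measurable borel"
    by (rule M.borel_measurable_nn_integral_fst) measurable
  moreover have "(\<integral>\<^sup>+x. indicator Z (s, x) \<partial>M) = emeasure M {x \<in> space M. norm (f x) > s}" for s
  proof -
    have "(\<integral>\<^sup>+x. indicator Z (s, x) \<partial>M) = (\<integral>\<^sup>+x. indicator {x \<in> space M. norm (f x) > s} x \<partial>M)"
      by (intro nn_integral_cong) (auto simp: Z_def indicator_def space_pair_measure)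
    then show ?thesis by simp
  qed
  ultimately show ?thesis by simp
qed

text \<open>With \<open>q = 1 / ps i\<close> this bounds the integral of \<open>v i * |f i|\<close>
  by the norm in the conclusion of the theorem, so the normalised pieces of \<open>H\<close> have
  integral at most 1.\<close>

lemma nn_integral_le_lorentz_norm:
  fixes f :: "'a \<Rightarrow> 'b::{real_normed_vector, second_countable_topology}"
  assumes "sigma_finite_measure M" and [measurable]: "f \<in> borel_measurable M" and q: "0 < q" "q \<le> 1"
  shows "(\<integral>\<^sup>+x. ennreal (norm (f x)) \<partial>M) \<le> lorentz_norm M 1 q f"
  unfolding nn_integral_layer_cake[OF assms(1,2)] lorentz_norm_def ennreal_1 mult_1 div_by_1
  using q by (intro nn_integral_antimono_le level_set_measurable assms emeasure_mono) auto

lemma nn_integral_weighted: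
  assumes [measurable]: "w \<in> borel_measurable lebesgue" "f \<in> borel_measurable lebesgue"
  shows "(\<integral>\<^sup>+x. f x \<partial>weighted w) = (\<integral>\<^sup>+x. ennreal (w x) * f x \<partial>lebesgue)"
  unfolding weighted_def by (rule nn_integral_density) measurable

lemma weighted_norm_le_lorentz_norm:
  fixes f :: "real ^ 'n \<Rightarrow> complex"
  assumes [measurable]: "w \<in> borel_measurable lebesgue" "f \<in> borel_measurable lebesgue" and q: "0 < q" "q \<le> 1"
  shows "(\<integral>\<^sup>+x. ennreal (w x) * ennreal (norm (f x)) \<partial>lebesgue) \<le> lorentz_norm (weighted w) 1 q f"
proof -
  have "f \<in> borel_measurable (weighted w)" unfolding weighted_def by simp
  then have "(\<integral>\<^sup>+x. ennreal (norm (f x)) \<partial>weighted w) \<le> lorentz_norm (weighted w) 1 q f"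
    using q by (intro nn_integral_le_lorentz_norm sigma_finite_weighted) auto
  then show ?thesis by (simp add: nn_integral_weighted)
qed

lemma AE_zero_of_lorentz_norm_zero:
  fixes f :: "real ^ 'n \<Rightarrow> complex"
  assumes [measurable]: "w \<in> borel_measurable lebesgue" "f \<in> borel_measurable lebesgue" and q: "0 < q" "q \<le> 1"
    and pos: "AE x in lebesgue. 0 < w x" and zero: "lorentz_norm (weighted w) 1 q f = 0"
  shows "AE x in lebesgue. f x = 0"
proof -
  have "(\<integral>\<^sup>+x. ennreal (w x) * ennreal (norm (f x)) \<partial>lebesgue) = 0"
    using weighted_norm_le_lorentz_norm[of w f q] q zero by simp
  then have "AE x in lebesgue. ennreal (w x) * ennreal (norm (f x)) = 0"
    by (subst (asm) nn_integral_0_iff_AE) auto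
  with pos show ?thesis by eventually_elim auto
qed

lemma lorentz_norm_AE_zero:
  fixes f :: "real ^ 'n \<Rightarrow> complex"
  assumes [measurable]: "f \<in> borel_measurable lebesgue" "w \<in> borel_measurable lebesgue"
    and zero: "AE x in lebesgue. f x = 0"
  shows "lorentz_norm (weighted w) p \<alpha> f = 0"
proof -
  have "emeasure (weighted w) {x \<in> space (weighted w). norm (f x) > s} = 0" if "0 < s" for s :: real
  proof -
    define E where "E = {x \<in> space lebesgue. norm (f x) > s}"
    have [measurable]: "E \<in> sets lebesgue" unfolding E_def by measurable
    have E_eq: "{x \<in> space (weighted w). norm (f x) > s} = E"
      by (simp add: weighted_def E_def)
    have "emeasure (weighted w) E = (\<integral>\<^sup>+x. ennreal (w x) * indicator E x \<partial>lebesgue)"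
      unfolding weighted_def by (rule emeasure_density) measurable
    also have "\<dots> = (\<integral>\<^sup>+x. 0 \<partial>(lebesgue :: (real ^ 'n) measure))"
      using zero that by (intro nn_integral_cong_AE) (auto elim!: eventually_mono simp: indicator_def E_def)
    finally show ?thesis unfolding E_eq by simp
  qed
  then have "(\<integral>\<^sup>+ s\<in>{0<..}. ennreal (s powr (\<alpha> - 1)) *
      ennpow (emeasure (weighted w) {x \<in> space (weighted w). norm (f x) > s}) (\<alpha> / p) \<partial>lborel) = (\<integral>\<^sup>+ s. 0 \<partial>(lborel :: real measure))"
    by (intro nn_integral_cong) (auto simp: indicator_def ennpow_def)
  then show ?thesis by (simp add: lorentz_norm_def ennpow_def)
qed

section \<open>Transfer of the norms between \<open>v\<close> and \<open>w\<close>\<close>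

context extrapolation_weights
begin

text \<open>Where \<open>|f| > s\<close>, the domination gives
  \<open>v i * s \<le> c * \<nu> * n\<close>; as \<open>1 - ps i \<le> 0\<close>, this yields
  \<open>w i \<le> (s / c) powr (1 - ps i) * v i\<close>. The \<open>1 / ps i\<close>-th power of
  this bound for level sets produces exactly the weight \<open>s powr (1 / ps i - 1)\<close> of the
  norm on the \<open>v\<close> side. The outer factor \<open>ps i\<close> is the normalisation of
  \<open>lorentz_norm\<close>.\<close>

lemma lorentz_norm_w_le:
  fixes f :: "real ^ 'n \<Rightarrow> complex"
  assumes [measurable]: "f \<in> borel_measurable lebesgue" and i: "i \<in> {1..m}"
    and L: "lorentz_norm (weighted (v i)) 1 (1 / ps i) f = ennreal L" "0 \<le> L" and c: "0 < c"
    and dom: "AE x in lebesgue. ennreal (v i x) * ennreal (norm (f x)) \<le> ennreal c * H x"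
  shows "lorentz_norm (weighted (w i)) (ps i) 1 f \<le> ennreal (ps i * (c powr (1 - 1 / ps i) * L powr (1 / ps i)))"
proof -
  note [measurable] = w_measurable[OF i] v_measurable[OF i]
  define q where "q = ps i"
  have q: "1 \<le> q" using ps[OF i] by (simp add: q_def)
  define E where "E s = {x \<in> space lebesgue. norm (f x) > s}" for s
  have [measurable]: "E s \<in> sets lebesgue" for s unfolding E_def by measurable
  have space: "space (weighted u) = space lebesgue" for u :: "real ^ 'n \<Rightarrow> real" by (simp add: weighted_def)
  have level: "emeasure (weighted (w i)) (E s) \<le> ennreal ((s / c) powr (1 - q)) * emeasure (weighted (v i)) (E s)"
    if s: "0 < s" for s
  proof -
    have "emeasure (weighted (w i)) (E s) = (\<integral>\<^sup>+x. ennreal (w i x) * indicator (E s) x \<partial>lebesgue)"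
      unfolding weighted_def by (rule emeasure_density) measurable
    also have "\<dots> \<le> (\<integral>\<^sup>+x. ennreal ((s / c) powr (1 - q)) * (ennreal (v i x) * indicator (E s) x) \<partial>lebesgue)"
      using AE_good dom le_mult_majorant[of H]
    proof (intro nn_integral_mono_AE, eventually_elim)
      case (elim x)
      show ?case
      proof (cases "x \<in> E s")
        case True
        then have fx: "s < norm (f x)" by (simp add: E_def)
        have vx: "0 < v i x" and nx: "0 < \<nu> x" "0 < n x" "majorant H x = ennreal (n x)" using elim i by auto
        have "ennreal (v i x * norm (f x)) \<le> ennreal c * H x" using elim vx by (simp add: ennreal_mult')
        also have "\<dots> \<le> ennreal c * (ennreal (\<nu> x) * majorant H x)"
          using elim by (intro mult_left_mono) auto
        also have "\<dots> = ennreal (c * (\<nu> x * n x))" using nx c by (simp add: ennreal_mult)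
        finally have "v i x * norm (f x) \<le> c * (\<nu> x * n x)" using c nx by (simp add: ennreal_le_iff)
        moreover have "v i x * s \<le> v i x * norm (f x)" using fx vx by simp
        ultimately have "v i x * (s / c) \<le> \<nu> x * n x" using c by (simp add: field_simps)
        then have "(\<nu> x * n x) powr (1 - q) \<le> (v i x * (s / c)) powr (1 - q)"
          using vx s c q by (intro powr_mono2') auto
        then have "v i x powr q * (\<nu> x * n x) powr (1 - q) \<le> v i x powr q * (v i x * (s / c)) powr (1 - q)"
          by (rule mult_left_mono) auto
        also have "\<dots> = (v i x powr q * v i x powr (1 - q)) * (s / c) powr (1 - q)"
          using vx s c by (subst powr_mult) (auto simp: mult_ac)
        also have "v i x powr q * v i x powr (1 - q) = v i x" using vx by (simp add: powr_add[symmetric])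
        finally have "w i x \<le> (s / c) powr (1 - q) * v i x" by (simp add: w_def q_def mult.commute)
        then show ?thesis using True by (simp add: ennreal_mult'[symmetric] ennreal_leI)
      qed simp
    qed
    also have "\<dots> = ennreal ((s / c) powr (1 - q)) * emeasure (weighted (v i)) (E s)"
      unfolding weighted_def by (subst nn_integral_cmult) (auto simp: emeasure_density)
    finally show ?thesis .
  qed
  have e: "(1 - q) * (1 / q) = 1 / q - 1" using q by (simp add: field_simps)
  define \<phi> where "\<phi> s = emeasure (weighted (v i)) (E s)" for s
  have [measurable]: "\<phi> \<in> borel_measurable borel"
  proof -
    have "f \<in> borel_measurable (weighted (v i))" by (simp add: weighted_def)
    then have "(\<lambda>s. emeasure (weighted (v i)) {x \<in> space (weighted (v i)). norm (f x) > s}) \<in> borel_measurable borel"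
      by (intro level_set_measurable sigma_finite_weighted) auto
    then show ?thesis unfolding \<phi>_def[abs_def] E_def space .
  qed
  have [measurable]: "(\<lambda>s. ennpow (\<phi> s) (1 / q)) \<in> borel_measurable borel"
    unfolding ennpow_def by measurable
  define I where "I = (\<integral>\<^sup>+ s\<in>{0<..}. ennreal (s powr (1 / q - 1)) * ennpow (\<phi> s) (1 / q) \<partial>lborel)"
  \<comment> \<open>The outer exponent of the \<open>v i\<close> norm is \<open>q\<close>, so
    \<open>I\<close> is the \<open>1 / q\<close>-th power of \<open>L\<close>.\<close>
  have IL: "ennpow I q = ennreal L"
    using L(1) unfolding lorentz_norm_def I_def \<phi>_def E_def space q_def by simp
  have "I \<noteq> \<infinity>" using IL by (auto simp: ennpow_def)
  then have "I = ennreal (L powr (1 / q))"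
    using IL q L(2) by (cases I) (auto simp: ennpow_def powr_powr)
  have "(\<integral>\<^sup>+ s\<in>{0<..}. ennreal (s powr (1 - 1)) * ennpow (emeasure (weighted (w i)) (E s)) (1 / q) \<partial>lborel)
      \<le> (\<integral>\<^sup>+ s. ennreal (c powr (1 - 1 / q)) * (ennreal (s powr (1 / q - 1)) * ennpow (\<phi> s) (1 / q) * indicator {0<..} s) \<partial>lborel)"
  proof (intro nn_integral_mono)
    fix s :: real
    show "ennreal (s powr (1 - 1)) * ennpow (emeasure (weighted (w i)) (E s)) (1 / q) * indicator {0<..} s
        \<le> ennreal (c powr (1 - 1 / q)) * (ennreal (s powr (1 / q - 1)) * ennpow (\<phi> s) (1 / q) * indicator {0<..} s)"
    proof (cases "0 < s")
      case True
      have "ennpow (emeasure (weighted (w i)) (E s)) (1 / q) \<le> ennpow (ennreal ((s / c) powr (1 - q)) * \<phi> s) (1 / q)"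
        unfolding \<phi>_def using True q by (intro ennpow_mono level) auto
      also have "\<dots> = ennreal (((s / c) powr (1 - q)) powr (1 / q)) * ennpow (\<phi> s) (1 / q)"
        using True c by (intro ennpow_cmult) simp
      also have "((s / c) powr (1 - q)) powr (1 / q) = (s / c) powr (1 / q - 1)"
        using e by (simp only: powr_powr)
      also have "\<dots> = c powr (1 - 1 / q) * s powr (1 / q - 1)"
        using True c powr_minus_divide[of c "1 / q - 1"] by (simp add: powr_divide)
      finally show ?thesis using True by (simp add: ennreal_mult mult.assoc)
    qed simp
  qed
  also have "\<dots> = ennreal (c powr (1 - 1 / q)) * I"
    unfolding I_def by (rule nn_integral_cmult) measurable
  also have "\<dots> = ennreal (c powr (1 - 1 / q) * L powr (1 / q))"
    using \<open>I = ennreal (L powr (1 / q))\<close> by (simp add: ennreal_mult)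
  finally have *: "(\<integral>\<^sup>+ s\<in>{0<..}. ennreal (s powr (1 - 1)) * ennpow (emeasure (weighted (w i)) (E s)) (1 / q) \<partial>lborel)
      \<le> ennreal (c powr (1 - 1 / q) * L powr (1 / q))" .
  have "lorentz_norm (weighted (w i)) q 1 f \<le> ennpow (ennreal q * ennreal (c powr (1 - 1 / q) * L powr (1 / q))) (1 / 1)"
    unfolding lorentz_norm_def using * by (intro ennpow_mono mult_left_mono) (auto simp: E_def space)
  also have "\<dots> = ennreal (q * (c powr (1 - 1 / q) * L powr (1 / q)))"
    using q by (simp add: ennreal_mult[symmetric] ennpow_ennreal)
  finally show ?thesis by (simp add: q_def)
qed

text \<open>Split \<open>{|g| > t}\<close> at the level \<open>\<mu>\<close> of the majorant. Above
  it, \<open>majorant_weak_type\<close> gives \<open>B0 / \<mu>\<close> without reference to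
  \<open>g\<close>; below it, \<open>\<nu> = n powr (m * p - 1) * W\<close> is at most
  \<open>\<mu> powr (m * p - 1) * W\<close>, which the hypothesis on \<open>g\<close>
  controls.\<close>

lemma weak_norm_\<nu>_le:
  obtains B where "0 < B" and "\<And>(g :: real ^ 'n \<Rightarrow> complex) \<Gamma>. g \<in> borel_measurable lebesgue \<Longrightarrow> 0 < \<Gamma> \<Longrightarrow>
    weak_norm (weighted (\<lambda>x. \<Prod>i\<in>{1..m}. w i x powr (p / ps i))) p g \<le> ennreal \<Gamma> \<Longrightarrow>
    weak_norm (weighted \<nu>) (1 / real m) g \<le> ennreal (B * \<Gamma>)"
proof -
  define W where "W x = (\<Prod>i\<in>{1..m}. w i x powr (p / ps i))" for x
  have [measurable]: "W \<in> borel_measurable lebesgue" unfolding W_def[abs_def] by measurable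
  define B0 where "B0 = (A * 5 ^ DIM(real ^ 'n) + 1) * enn2real (\<integral>\<^sup>+x. H x \<partial>lebesgue)"
  have B0: "0 \<le> B0" using A_ge1 by (simp add: B0_def)
  have weak: "emeasure U {x. ennreal \<mu> < majorant H x} \<le> ennreal (B0 / \<mu>)" if \<mu>: "0 < \<mu>" for \<mu>
  proof -
    have "ennreal \<mu> * emeasure U {x. ennreal \<mu> < majorant H x} \<le> ennreal (A * 5 ^ DIM(real ^ 'n) + 1) * (\<integral>\<^sup>+x. H x \<partial>lebesgue)"
      using \<mu> by (intro majorant_weak_type) auto
    also have "(\<integral>\<^sup>+x. H x \<partial>lebesgue) = ennreal (enn2real (\<integral>\<^sup>+x. H x \<partial>lebesgue))"
      using H_fin by (simp add: less_top)
    also have "ennreal (A * 5 ^ DIM(real ^ 'n) + 1) * \<dots> = ennreal B0"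
      using A_ge1 by (simp add: B0_def ennreal_mult)
    also have "ennreal B0 = ennreal \<mu> * ennreal (B0 / \<mu>)"
      using \<mu> B0 by (simp add: ennreal_mult[symmetric])
    finally show ?thesis using \<mu> by (subst (asm) ennreal_mult_le_mult_iff) auto
  qed
  have space: "space (weighted u) = space lebesgue" for u :: "real ^ 'n \<Rightarrow> real" by (simp add: weighted_def)
  have main: "weak_norm (weighted \<nu>) (1 / real m) g \<le> ennreal ((B0 + 1) ^ m * \<Gamma>)"
    if [measurable]: "g \<in> borel_measurable lebesgue" and \<Gamma>: "0 < \<Gamma>" and g: "weak_norm (weighted W) p g \<le> ennreal \<Gamma>"
    for g :: "real ^ 'n \<Rightarrow> complex" and \<Gamma>
    unfolding weak_norm_def
  proof (rule SUP_least)
    fix t :: real assume "t \<in> {0<..}"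
    then have t: "0 < t" by simp
    define E where "E = {x \<in> space lebesgue. norm (g x) > t}"
    have [measurable]: "E \<in> sets lebesgue" unfolding E_def by measurable
    have "ennreal t * ennpow (emeasure (weighted W) E) (1 / p) \<le> weak_norm (weighted W) p g"
      unfolding weak_norm_def using t by (intro SUP_upper2[of t]) (auto simp: E_def space)
    also note g
    finally have le: "ennreal t * ennpow (emeasure (weighted W) E) (1 / p) \<le> ennreal \<Gamma>" .
    have WE: "emeasure (weighted W) E \<le> ennreal ((\<Gamma> / t) powr p)"
    proof (cases "emeasure (weighted W) E")
      case top
      then have False using le t by (simp add: ennpow_def ennreal_mult_top top_unique)
      then show ?thesis ..
    next
      case (real a)
      then have "t * a powr (1 / p) \<le> \<Gamma>"
        using le t \<Gamma> by (simp add: ennpow_ennreal ennreal_mult'[symmetric] ennreal_le_iff)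
      then have "a powr (1 / p) \<le> \<Gamma> / t" using t by (simp add: field_simps)
      then have "(a powr (1 / p)) powr p \<le> (\<Gamma> / t) powr p"
        using p_pos by (intro powr_mono2) auto
      then show ?thesis using real p_pos by (simp add: powr_powr ennreal_leI)
    qed
    \<comment> \<open>Balances the two parts: the second becomes \<open>1 / \<mu>\<close>, and
      \<open>t / \<mu> ^ m = \<Gamma>\<close> removes \<open>t\<close> from the final bound.\<close>
    define \<mu> where "\<mu> = (t / \<Gamma>) powr (1 / real m)"
    have \<mu>: "0 < \<mu>" using t \<Gamma> by (simp add: \<mu>_def)
    define Z where "Z = {x. ennreal \<mu> < majorant H x}"
    have [measurable]: "Z \<in> sets lebesgue" unfolding Z_def by (rule sets_lebesgue_less) auto
    have "emeasure U E \<le> emeasure U Z + emeasure U (E - Z)"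
      by (rule order_trans[OF _ emeasure_subadditive]) (auto intro!: emeasure_mono)
    also have "emeasure U (E - Z) \<le> ennreal (\<mu> powr (real m * p - 1)) * emeasure (weighted W) E"
    proof -
      have "emeasure U (E - Z) = (\<integral>\<^sup>+x. ennreal (\<nu> x) * indicator (E - Z) x \<partial>lebesgue)"
        by (simp add: emeasure_density)
      also have "\<dots> \<le> (\<integral>\<^sup>+x. ennreal (\<mu> powr (real m * p - 1)) * (ennreal (W x) * indicator E x) \<partial>lebesgue)"
        using AE_good W_eq
      proof (intro nn_integral_mono_AE, eventually_elim)
        case (elim x)
        show ?case
        proof (cases "x \<in> E - Z")
          case True
          have nx: "0 < n x" "0 < \<nu> x" "majorant H x = ennreal (n x)" using elim by auto
          have "n x \<le> \<mu>" using True nx \<mu> by (auto simp: Z_def not_less ennreal_le_iff)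
          then have "n x powr (real m * p - 1) \<le> \<mu> powr (real m * p - 1)"
            using nx mp_ge_1 by (intro powr_mono2) auto
          then have "n x powr (real m * p - 1) * W x \<le> \<mu> powr (real m * p - 1) * W x"
            by (rule mult_right_mono) (auto simp: W_def intro: prod_nonneg)
          moreover have "n x powr (real m * p - 1) * W x = \<nu> x"
          proof -
            have "W x = \<nu> x * n x powr (1 - real m * p)" using elim unfolding W_def by blast
            then have "n x powr (real m * p - 1) * W x = \<nu> x * (n x powr (real m * p - 1) * n x powr (1 - real m * p))"
              by (simp add: mult_ac)
            also have "\<dots> = \<nu> x" using nx by (simp add: powr_add[symmetric])
            finally show ?thesis .
          qed
          ultimately show ?thesis using True by (simp add: ennreal_mult'[symmetric] ennreal_leI)
        qed simp
      qed
      also have "\<dots> = ennreal (\<mu> powr (real m * p - 1)) * emeasure (weighted W) E"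
        unfolding weighted_def by (subst nn_integral_cmult) (auto simp: emeasure_density)
      finally show ?thesis .
    qed
    also have "\<dots> \<le> ennreal (\<mu> powr (real m * p - 1)) * ennreal ((\<Gamma> / t) powr p)"
      using WE by (rule mult_left_mono) auto
    also have "\<dots> = ennreal (1 / \<mu>)"
    proof -
      have "(\<Gamma> / t) powr p = (t / \<Gamma>) powr (- p)"
        using t \<Gamma> by (simp add: powr_minus_divide powr_divide)
      then have "\<mu> powr (real m * p - 1) * (\<Gamma> / t) powr p = (t / \<Gamma>) powr ((1 / real m) * (real m * p - 1) + - p)"
        unfolding \<mu>_def powr_powr powr_add by simp
      also have "(1 / real m) * (real m * p - 1) + - p = - (1 / real m)"
        using m by (simp add: field_simps)
      also have "(t / \<Gamma>) powr (- (1 / real m)) = 1 / \<mu>"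
        by (simp only: powr_minus_divide \<mu>_def)
      finally show ?thesis by (simp add: ennreal_mult'[symmetric])
    qed
    finally have "emeasure U E \<le> emeasure U Z + ennreal (1 / \<mu>)" by (simp add: add_left_mono)
    also have "\<dots> \<le> ennreal (B0 / \<mu>) + ennreal (1 / \<mu>)"
      unfolding Z_def by (intro add_right_mono weak \<mu>)
    also have "\<dots> = ennreal ((B0 + 1) / \<mu>)"
      using B0 \<mu> by (simp add: ennreal_plus[symmetric] add_divide_distrib del: ennreal_plus)
    finally have UE: "emeasure (weighted \<nu>) E \<le> ennreal ((B0 + 1) / \<mu>)"
      by (simp add: weighted_def)
    have "ennreal t * ennpow (emeasure (weighted \<nu>) E) (1 / (1 / real m)) \<le> ennreal t * ennpow (ennreal ((B0 + 1) / \<mu>)) (1 / (1 / real m))"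
      using UE by (intro mult_left_mono ennpow_mono) auto
    also have "\<dots> = ennreal (t * ((B0 + 1) / \<mu>) ^ m)"
      using B0 \<mu> t by (simp add: ennpow_ennreal ennreal_mult' powr_realpow add_nonneg_pos)
    also have "t * ((B0 + 1) / \<mu>) ^ m = (B0 + 1) ^ m * \<Gamma>"
    proof -
      have "\<mu> ^ m = t / \<Gamma>" using t \<Gamma> m unfolding \<mu>_def by (simp add: powr_realpow[symmetric] powr_powr)
      then show ?thesis using t \<Gamma> by (simp add: power_divide)
    qed
    finally show "ennreal t * ennpow (emeasure (weighted \<nu>) {x \<in> space (weighted \<nu>). t < norm (g x)}) (1 / (1 / real m))
        \<le> ennreal ((B0 + 1) ^ m * \<Gamma>)"
      by (simp add: E_def space)
  qed
  show thesis
    by (rule that[of "(B0 + 1) ^ m"]) (use B0 main in \<open>auto simp: W_def[abs_def] add_nonneg_pos\<close>)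
qed

end

section \<open>The gliding hump argument\<close>

lemma ennreal_divide_le_one:
  fixes a b :: ennreal
  assumes "a \<le> b"
  shows "a / b \<le> 1"
proof (cases "b = 0")
  case False
  then show ?thesis using assms by (intro divide_le_posI_ennreal) (auto simp: zero_less_iff_neq_zero)
qed (use assms in auto)

theorem theorem1p1:
  fixes m :: nat
    and ps :: "nat \<Rightarrow> real"
    and p :: real
    and F :: "((nat \<Rightarrow> real ^ 'n \<Rightarrow> complex) \<times> (real ^ 'n \<Rightarrow> complex)) set"
  assumes "1 \<le> m"
    and "\<And>i. i \<in> {1..m} \<Longrightarrow> 1 \<le> ps i"
    and "1 / p = (\<Sum>i\<in>{1..m}. 1 / ps i)"
    and "\<And>f g i. (f, g) \<in> F \<Longrightarrow> i \<in> {1..m} \<Longrightarrow> f i \<in> borel_measurable lebesgue"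
    and "\<And>f g. (f, g) \<in> F \<Longrightarrow> g \<in> borel_measurable lebesgue"
    and "\<And>w :: nat \<Rightarrow> real ^ 'n \<Rightarrow> real. A_R m ps w \<Longrightarrow>
      \<exists>C::real. \<forall>(f, g)\<in>F.
        weak_norm (weighted (\<lambda>x. \<Prod>i\<in>{1..m}. w i x powr (p / ps i))) p g
          \<le> ennreal C * (\<Prod>i\<in>{1..m}. lorentz_norm (weighted (w i)) (ps i) 1 (f i))"
  shows "\<forall>v :: nat \<Rightarrow> real ^ 'n \<Rightarrow> real. A_endpoint m v \<longrightarrow>
      (\<exists>C::real. \<forall>(f, g)\<in>F.
        weak_norm (weighted (\<lambda>x. \<Prod>i\<in>{1..m}. v i x powr (1 / real m))) (1 / real m) g
          \<le> ennreal C * (\<Prod>i\<in>{1..m}. lorentz_norm (weighted (v i)) 1 (1 / ps i) (f i)))"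
proof (intro allI impI)
  fix v :: "nat \<Rightarrow> real ^ 'n \<Rightarrow> real"
  assume v: "A_endpoint m v"
  interpret endpoint_weights m v
    using assms(1) v by unfold_locales
  note f_meas = assms(4) and g_meas = assms(5)
  have ps: "1 \<le> ps i" if "i \<in> {1..m}" for i using assms(2) that by blast
  have q: "0 < 1 / ps i" "1 / ps i \<le> 1" if "i \<in> {1..m}" for i
    using ps[OF that] by auto
  define L where "L f i = lorentz_norm (weighted (v i)) 1 (1 / ps i) (f i)" for f :: "nat \<Rightarrow> real ^ 'n \<Rightarrow> complex" and i
  have \<nu>_eq: "(\<lambda>x. \<Prod>i\<in>{1..m}. v i x powr (1 / real m)) = \<nu>" by (simp add: \<nu>_def[abs_def])
  have "\<exists>C::real. \<forall>(f, g)\<in>F. weak_norm (weighted \<nu>) (1 / real m) g \<le> ennreal C * (\<Prod>i\<in>{1..m}. L f i)"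
  proof (rule ccontr)
    assume neg: "\<not> (\<exists>C::real. \<forall>(f, g)\<in>F. weak_norm (weighted \<nu>) (1 / real m) g \<le> ennreal C * (\<Prod>i\<in>{1..m}. L f i))"
    \<comment> \<open>Each of the \<open>m\<close> functions will cost a factor \<open>2 ^ k\<close>
      for being dominated by \<open>H\<close>, which uses up \<open>2 ^ (k * m)\<close>; the factor
      \<open>Suc k\<close> remains to defeat every fixed constant.\<close>
    have "\<exists>z\<in>F. ennreal (real (Suc k) * 2 ^ (k * m)) * (\<Prod>i\<in>{1..m}. L (fst z) i) < weak_norm (weighted \<nu>) (1 / real m) (snd z)" for k
    proof (rule ccontr)
      assume "\<not> ?thesis"
      then have "\<forall>(f, g)\<in>F. weak_norm (weighted \<nu>) (1 / real m) g \<le> ennreal (real (Suc k) * 2 ^ (k * m)) * (\<Prod>i\<in>{1..m}. L f i)"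
        by (auto simp: not_less)
      with neg show False by blast
    qed
    then obtain z where z: "\<And>k. z k \<in> F"
      and bad: "\<And>k. ennreal (real (Suc k) * 2 ^ (k * m)) * (\<Prod>i\<in>{1..m}. L (fst (z k)) i) < weak_norm (weighted \<nu>) (1 / real m) (snd (z k))"
      by metis
    define f where "f k = fst (z k)" for k
    define g where "g k = snd (z k)" for k
    have fg: "(f k, g k) \<in> F" for k using z[of k] by (simp add: f_def g_def)
    have fm[measurable]: "f k i \<in> borel_measurable lebesgue" if "i \<in> {1..m}" for k i
      using f_meas[OF fg that] .
    \<comment> \<open>Division in \<open>ennreal\<close> keeps \<open>h_int\<close> valid also when
      \<open>L (f k) i\<close> is zero or infinite; these cases are excluded only after
      \<open>w\<close> is available.\<close>
    define h where "h k i x = ennreal (v i x) * ennreal (norm (f k i x)) / L (f k) i" for k i x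
    have hm[measurable]: "h k i \<in> borel_measurable lebesgue" if "i \<in> {1..m}" for k i
      using v_measurable[OF that] fm[OF that] unfolding h_def[abs_def] by measurable
    have h_int: "(\<integral>\<^sup>+x. h k i x \<partial>lebesgue) \<le> 1" if i: "i \<in> {1..m}" for k i
    proof -
      note [measurable] = v_measurable[OF i] fm[OF i]
      have "(\<integral>\<^sup>+x. h k i x \<partial>lebesgue) = (\<integral>\<^sup>+x. ennreal (v i x) * ennreal (norm (f k i x)) \<partial>lebesgue) / L (f k) i"
        unfolding h_def by (rule nn_integral_divide) measurable
      also have "\<dots> \<le> 1"
        unfolding L_def using q[OF i] by (intro ennreal_divide_le_one weighted_norm_le_lorentz_norm) measurable
      finally show ?thesis .
    qed
    define G where "G k x = ennreal ((1 / 2) ^ k) * (\<Sum>i\<in>{1..m}. h k i x)" for k x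
    have Gm[measurable]: "G k \<in> borel_measurable lebesgue" for k
      unfolding G_def[abs_def] by measurable
    \<comment> \<open>The indicator only serves to make the integral positive.\<close>
    define H where "H x = indicator (ball 0 1) x + (\<Sum>k. G k x)" for x :: "real ^ 'n"
    have ind: "(indicator (ball 0 1) :: real ^ 'n \<Rightarrow> ennreal) \<in> borel_measurable lebesgue"
      by (rule borel_measurable_indicator) simp
    have Hm[measurable]: "H \<in> borel_measurable lebesgue"
      unfolding H_def[abs_def] by (intro borel_measurable_add borel_measurable_suminf_order ind Gm)
    have "(\<integral>\<^sup>+x. H x \<partial>lebesgue) = emeasure lebesgue (ball (0 :: real ^ 'n) 1) + (\<Sum>k. \<integral>\<^sup>+x. G k x \<partial>lebesgue)"
      unfolding H_def using ind by (subst nn_integral_add) (auto simp: nn_integral_suminf)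
    moreover have "(\<Sum>k. \<integral>\<^sup>+x. G k x \<partial>lebesgue) \<le> (\<Sum>k. ennreal (real m * (1 / 2) ^ k))"
    proof (intro suminf_le allI)
      fix k
      have "(\<integral>\<^sup>+x. G k x \<partial>lebesgue) = ennreal ((1 / 2) ^ k) * (\<Sum>i\<in>{1..m}. \<integral>\<^sup>+x. h k i x \<partial>lebesgue)"
        unfolding G_def by (subst nn_integral_cmult) (auto intro!: arg_cong2[where f = "(*)"] nn_integral_sum)
      also have "\<dots> \<le> ennreal ((1 / 2) ^ k) * (\<Sum>i\<in>{1..m}. 1)"
        by (intro mult_left_mono sum_mono h_int) auto
      also have "\<dots> = ennreal (real m * (1 / 2) ^ k)"
        by (simp add: ennreal_mult' ennreal_of_nat_eq_real_of_nat mult.commute)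
      finally show "(\<integral>\<^sup>+x. G k x \<partial>lebesgue) \<le> ennreal (real m * (1 / 2) ^ k)" .
    qed auto
    moreover have "(\<Sum>k. ennreal (real m * (1 / 2) ^ k)) = ennreal (real m * 2)"
    proof (rule suminf_ennreal_eq)
      show "(\<lambda>k. real m * (1 / 2) ^ k) sums (real m * 2)"
        using geometric_sums[of "1/2::real"] by (intro sums_mult) auto
    qed auto
    ultimately have "(\<integral>\<^sup>+x. H x \<partial>lebesgue) \<le> emeasure lebesgue (ball (0 :: real ^ 'n) 1) + ennreal (real m * 2)"
      by (simp add: add_left_mono)
    also have "\<dots> < \<infinity>" using emeasure_ball_pos_finite(2)[of 1 "0 :: real ^ 'n"] by simp
    finally have H_fin: "(\<integral>\<^sup>+x. H x \<partial>lebesgue) < \<infinity>" .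
    have "0 < emeasure lebesgue (ball (0 :: real ^ 'n) 1)"
      by (rule emeasure_ball_pos_finite) simp
    also have "\<dots> = (\<integral>\<^sup>+x. indicator (ball (0 :: real ^ 'n) 1) x \<partial>lebesgue)" by simp
    also have "\<dots> \<le> (\<integral>\<^sup>+x. H x \<partial>lebesgue)"
      unfolding H_def by (intro nn_integral_mono) simp
    finally have H_pos: "0 < (\<integral>\<^sup>+x. H x \<partial>lebesgue)" .
    interpret extrapolation_weights m v ps p H
      using ps assms(3) H_pos H_fin by unfold_locales auto
    obtain C where C: "\<And>k. weak_norm (weighted (\<lambda>x. \<Prod>i\<in>{1..m}. w i x powr (p / ps i))) p (g k)
          \<le> ennreal C * (\<Prod>i\<in>{1..m}. lorentz_norm (weighted (w i)) (ps i) 1 (f k i))"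
      using assms(6)[OF A_R_w] fg by blast
    \<comment> \<open>The real \<open>C\<close> may be zero or negative, whereas \<open>weak\<close>
      needs a positive \<open>\<Gamma>\<close>.\<close>
    define C' where "C' = max C 1"
    have C': "ennreal C \<le> ennreal C'" "1 \<le> C'" by (auto simp: C'_def intro: ennreal_leI)
    obtain B where B: "0 < B" and weak: "\<And>(g :: real ^ 'n \<Rightarrow> complex) \<Gamma>. g \<in> borel_measurable lebesgue \<Longrightarrow> 0 < \<Gamma> \<Longrightarrow>
        weak_norm (weighted (\<lambda>x. \<Prod>i\<in>{1..m}. w i x powr (p / ps i))) p g \<le> ennreal \<Gamma> \<Longrightarrow>
        weak_norm (weighted \<nu>) (1 / real m) g \<le> ennreal (B * \<Gamma>)"
      using weak_norm_\<nu>_le by blast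
    have gm: "g k \<in> borel_measurable lebesgue" for k using g_meas[OF fg] .
    define P where "P = (\<Prod>i\<in>{1..m}. ps i)"
    have P: "0 < P" unfolding P_def using ps by (intro prod_pos) (auto intro: order.strict_trans2[OF zero_less_one])
    \<comment> \<open>\<open>H\<close> involves the whole sequence, so \<open>w\<close>,
      \<open>C'\<close> and \<open>B\<close> are fixed before \<open>k\<close>; a right side
      independent of \<open>k\<close> is the contradiction sought.\<close>
    have less: "real (Suc k) < B * (C' * P)" for k
    proof -
      have bad': "ennreal (real (Suc k) * 2 ^ (k * m)) * (\<Prod>i\<in>{1..m}. L (f k) i) < weak_norm (weighted \<nu>) (1 / real m) (g k)"
        using bad[of k] by (simp add: f_def g_def)
      \<comment> \<open>If it vanished, \<open>f k i\<close> would be zero almost everywhere, the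
        hypothesis for \<open>w\<close> would make the weak norm of \<open>g k\<close> zero, and
        \<open>weak\<close> with arbitrarily small \<open>\<Gamma>\<close> would contradict the
        strict inequality \<open>bad'\<close>.\<close>
      have L_nz: "L (f k) i \<noteq> 0" if i: "i \<in> {1..m}" for i
      proof
        assume "L (f k) i = 0"
        then have "AE x in lebesgue. f k i x = 0"
          using i q[OF i] v_pos unfolding L_def
          by (intro AE_zero_of_lorentz_norm_zero[of "v i" "f k i" "1 / ps i"]) (auto elim!: eventually_mono)
        then have "lorentz_norm (weighted (w i)) (ps i) 1 (f k i) = 0"
          using i by (intro lorentz_norm_AE_zero) auto
        then have "(\<Prod>i\<in>{1..m}. lorentz_norm (weighted (w i)) (ps i) 1 (f k i)) = 0"
          using i by (intro prod_zero) auto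
        with C[of k] have "weak_norm (weighted (\<lambda>x. \<Prod>i\<in>{1..m}. w i x powr (p / ps i))) p (g k) \<le> ennreal C * 0"
          by (simp only:)
        then have zero: "weak_norm (weighted (\<lambda>x. \<Prod>i\<in>{1..m}. w i x powr (p / ps i))) p (g k) = 0"
          by (simp only: mult_zero_right le_zero_eq)
        have "weak_norm (weighted \<nu>) (1 / real m) (g k) \<le> 0"
        proof (rule ennreal_le_epsilon)
          fix e :: real assume e: "0 < e"
          have "weak_norm (weighted \<nu>) (1 / real m) (g k) \<le> ennreal (B * (e / B))"
          proof (rule weak[OF gm])
            show "0 < e / B" using e B by simp
          qed (unfold zero, rule zero_le)
          then show "weak_norm (weighted \<nu>) (1 / real m) (g k) \<le> 0 + ennreal e" using B by simp
        qed
        with bad' show False by simp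
      qed
      have L_fin: "L (f k) i \<noteq> \<infinity>" if i: "i \<in> {1..m}" for i
      proof
        assume "L (f k) i = \<infinity>"
        then have "(\<Prod>j\<in>{1..m}. L (f k) j) = \<infinity> * (\<Prod>j\<in>{1..m} - {i}. L (f k) j)"
          using i by (subst prod.remove[of _ i]) auto
        moreover have "(\<Prod>j\<in>{1..m} - {i}. L (f k) j) \<noteq> 0"
          using L_nz by (simp add: prod_zero_iff)
        ultimately have "(\<Prod>j\<in>{1..m}. L (f k) j) = \<infinity>" by (simp add: ennreal_top_mult)
        with bad' show False by (simp add: ennreal_mult_top)
      qed
      define l where "l i = enn2real (L (f k) i)" for i
      have l: "0 < l i" "L (f k) i = ennreal (l i)" if "i \<in> {1..m}" for i
        using L_nz[OF that] L_fin[OF that] by (auto simp: l_def less_top enn2real_positive_iff zero_less_iff_neq_zero)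
      have lor: "lorentz_norm (weighted (w i)) (ps i) 1 (f k i) \<le> ennreal (ps i * (2 ^ k * l i))" if i: "i \<in> {1..m}" for i
      proof -
        \<comment> \<open>\<open>v i * |f k i|\<close> is \<open>l i\<close> times
          \<open>h k i\<close>, and \<open>h k i\<close> enters \<open>H\<close> with the
          coefficient \<open>(1 / 2) ^ k\<close>.\<close>
        define c where "c = 2 ^ k * l i"
        have c: "0 < c" using l(1)[OF i] by (simp add: c_def)
        have dom: "ennreal (v i x) * ennreal (norm (f k i x)) \<le> ennreal c * H x" for x
        proof -
          have "h k i x \<le> (\<Sum>i\<in>{1..m}. h k i x)" using i by (intro member_le_sum) auto
          then have "ennreal ((1 / 2) ^ k) * h k i x \<le> G k x"
            unfolding G_def by (rule mult_left_mono) simp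
          also have "\<dots> \<le> (\<Sum>k. G k x)"
            using sum_le_suminf[of "\<lambda>k. G k x" "{k}"] by simp
          also have "\<dots> \<le> H x" by (simp add: H_def)
          finally have "ennreal c * (ennreal ((1 / 2) ^ k) * h k i x) \<le> ennreal c * H x"
            by (rule mult_left_mono) simp
          moreover have "ennreal c * (ennreal ((1 / 2) ^ k) * h k i x) = ennreal (c * (1 / 2) ^ k) * h k i x"
            using c by (simp add: ennreal_mult mult.assoc)
          moreover have "c * (1 / 2) ^ k = l i" by (simp add: c_def power_one_over)
          moreover have "ennreal (l i) * h k i x = ennreal (v i x) * ennreal (norm (f k i x))"
            unfolding h_def l(2)[OF i] using l(1)[OF i] mult_divide_eq_ennreal[of "ennreal (l i)"]
            by (simp add: ennreal_times_divide mult.commute[of "ennreal (l i)"])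
          ultimately show ?thesis by simp
        qed
        have "lorentz_norm (weighted (w i)) (ps i) 1 (f k i) \<le> ennreal (ps i * (c powr (1 - 1 / ps i) * l i powr (1 / ps i)))"
          using i c dom l[OF i] by (intro lorentz_norm_w_le) (auto simp: L_def)
        \<comment> \<open>Enlarging \<open>l i\<close> to \<open>c\<close> merges the two powers
          into \<open>c\<close>, at the price of a full \<open>2 ^ k\<close> for each index.\<close>
        also have "c powr (1 - 1 / ps i) * l i powr (1 / ps i) \<le> c powr (1 - 1 / ps i) * c powr (1 / ps i)"
        proof (intro mult_left_mono powr_mono2)
          have "1 * l i \<le> 2 ^ k * l i" using l(1)[OF i] by (intro mult_right_mono) auto
          then show "l i \<le> c" by (simp add: c_def)
        qed (use q[OF i] l(1)[OF i] in auto)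
        then have "ennreal (ps i * (c powr (1 - 1 / ps i) * l i powr (1 / ps i))) \<le> ennreal (ps i * (c powr (1 - 1 / ps i) * c powr (1 / ps i)))"
          by (rule ennreal_leI[OF mult_left_mono]) (use ps[OF i] in simp)
        also have "c powr (1 - 1 / ps i) * c powr (1 / ps i) = 2 ^ k * l i"
          using c by (simp add: powr_add[symmetric]) (simp add: c_def)
        finally show ?thesis .
      qed
      define \<Lambda> where "\<Lambda> = (\<Prod>i\<in>{1..m}. l i)"
      have \<Lambda>: "0 < \<Lambda>" unfolding \<Lambda>_def using l by (intro prod_pos) auto
      define \<Gamma> where "\<Gamma> = C' * (P * (2 ^ (k * m) * \<Lambda>))"
      have \<Gamma>: "0 < \<Gamma>" using C' P \<Lambda> by (simp add: \<Gamma>_def)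
      have "weak_norm (weighted (\<lambda>x. \<Prod>i\<in>{1..m}. w i x powr (p / ps i))) p (g k)
          \<le> ennreal C' * (\<Prod>i\<in>{1..m}. ennreal (ps i * (2 ^ k * l i)))"
        by (rule order_trans[OF C]) (intro mult_mono C' ennreal_prod_mono lor, auto)
      also have "(\<Prod>i\<in>{1..m}. ennreal (ps i * (2 ^ k * l i))) = ennreal (\<Prod>i\<in>{1..m}. ps i * (2 ^ k * l i))"
      proof (rule prod_ennreal)
        fix i assume "i \<in> {1..m}"
        then show "0 \<le> ps i * (2 ^ k * l i)" using ps[of i] l(1)[of i] by simp
      qed
      also have "(\<Prod>i\<in>{1..m}. ps i * (2 ^ k * l i)) = P * (2 ^ (k * m) * \<Lambda>)"
        by (simp add: prod.distrib P_def \<Lambda>_def power_mult)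
      also have "ennreal C' * ennreal (P * (2 ^ (k * m) * \<Lambda>)) = ennreal \<Gamma>"
        using C' by (simp add: \<Gamma>_def ennreal_mult')
      finally have "weak_norm (weighted \<nu>) (1 / real m) (g k) \<le> ennreal (B * \<Gamma>)"
        by (intro weak gm \<Gamma>)
      moreover have "(\<Prod>i\<in>{1..m}. L (f k) i) = ennreal \<Lambda>"
      proof -
        have "(\<Prod>i\<in>{1..m}. L (f k) i) = (\<Prod>i\<in>{1..m}. ennreal (l i))" using l by (intro prod.cong) auto
        also have "\<dots> = ennreal \<Lambda>" unfolding \<Lambda>_def using l by (intro prod_ennreal) (auto intro: less_imp_le)
        finally show ?thesis .
      qed
      ultimately have "ennreal (real (Suc k) * 2 ^ (k * m)) * ennreal \<Lambda> < ennreal (B * \<Gamma>)"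
        using bad' by simp
      then have "ennreal (real (Suc k) * 2 ^ (k * m) * \<Lambda>) < ennreal (B * \<Gamma>)"
        using \<Lambda> by (subst ennreal_mult'') auto
      then have "real (Suc k) * 2 ^ (k * m) * \<Lambda> < B * \<Gamma>"
        using \<Lambda> by (subst (asm) ennreal_less_iff) auto
      also have "B * \<Gamma> = (B * (C' * P)) * (2 ^ (k * m) * \<Lambda>)" by (simp add: \<Gamma>_def)
      finally have "real (Suc k) * (2 ^ (k * m) * \<Lambda>) < (B * (C' * P)) * (2 ^ (k * m) * \<Lambda>)"
        by (simp only: mult.assoc)
      then show ?thesis using \<Lambda> by (subst (asm) mult_less_cancel_right_pos) auto
    qed
    obtain k where "B * (C' * P) \<le> real k" using real_arch_simple by blast
    with less[of k] show False by simp
  qed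
  then show "\<exists>C::real. \<forall>(f, g)\<in>F.
        weak_norm (weighted (\<lambda>x. \<Prod>i\<in>{1..m}. v i x powr (1 / real m))) (1 / real m) g
          \<le> ennreal C * (\<Prod>i\<in>{1..m}. lorentz_norm (weighted (v i)) 1 (1 / ps i) (f i))"
    unfolding \<nu>_eq L_def .
qed

end
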